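(* Let $M=\{0,1\}^{\mathbb N_0}$ and let $\mathcal T$ be the product topology on $M$ arising from the discrete topology on $\{0,1\}$. Let $\gamma\colon\mathbb N_0\to\mathbb N_0$, $\gamma(n)=n+1$, and let $c$ be Boolean complementation on $\{0,1\}$. Let $\mathbf M_1=\langle M;\vee,\wedge,\neg,\underline 0,\underline 1\rangle$, where $\vee,\wedge$ are pointwise, $\underline 0,\underline 1$ are the constant maps onto $0$ and $1$, and $\neg(a)=c\circ a\circ\gamma$. Let $\mathbf M_2=\langle M;u,\preccurlyeq\rangle$, where $u(a)=a\circ\gamma$ and $a\preccurlyeq b$ if and only if $a(n)\leqslant b(n)$ for all even $n$ and $a(n)\geqslant b(n)$ for all odd $n$. Let $\mathbf M_i^{\mathcal T}$ be $\mathbf M_i$ with the topology $\mathcal T$ added, and put $\mathcal A_i=\mathbb{ISP}(\mathbf M_i)$, $\mathcal X_i=\mathbb{IS}_c\mathbb P^+(\mathbf M_i^{\mathcal T})$ for $i\in\{1,2\}$. Let $\omega=\pi_0\colon M\to\{0,1\}$, $\pi_0(a)=a(0)$. Then: (a) $\mathbf M_2^{\mathcal T}$ fully dualises $\mathbf M_1$, with $\mathbf M_1$ injective in $\mathcal A_1$ and $\mathbf M_2^{\mathcal T}$ injective in $\mathcal X_2$; (b) $\mathbf M_1^{\mathcal T}$ fully dualises $\mathbf M_2$, with $\mathbf M_2$ injective in $\mathcal A_2$ and $\mathbf M_1^{\mathcal T}$ injective in $\mathcal X_1$; (c) for all $\mathbf A\in\mathcal A_1$ and $\mathbf X\in\mathcal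 X_2$, composition with $\omega$ on the left gives isomorphisms $\mathcal A_1(\mathbf A,\mathbf M_1)^\flat\cong\mathcal D(\mathbf A^\flat,\mathbf D)$ in $\mathcal P$ and $\mathcal X_2(\mathbf X,\mathbf M_2^{\mathcal T})^\flat\cong\mathcal P(\mathbf X^\flat,\widetilde{\mathbf D})$ in $\mathcal D$; and for all $\mathbf A\in\mathcal A_2$ and $\mathbf X\in\mathcal X_1$, composition with $\omega$ on the left gives isomorphisms $\mathcal A_2(\mathbf A,\mathbf M_2)^\flat\cong\mathcal Q(\mathbf A^\flat,\mathbf 2)$ in $\mathcal D_{\mathcal T}$ and $\mathcal X_1(\mathbf X,\mathbf M_1^{\mathcal T})^\flat\cong\mathcal D_{\mathcal T}(\mathbf X^\flat,\widetilde{\mathbf 2})$ in $\mathcal Q$. In particular, $\mathbf M_2^{\mathcal T}=\langle\{0,1\}^{\mathbb N_0};u,\preccurlyeq,\mathcal T\rangle$ strongly dualises $\mathbf M_1$ and $\mathbf M_1^{\mathcal T}=\langle\{0,1\}^{\mathbb N_0};\vee,\wedge,\neg,\underline 0,\underline 1,\mathcal T\rangle$ strongly dualises $\mathbf M_2$.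
   Context: **Structures and classes.** A total structure is a non-empty set with a set of finitary operations (nullary allowed) and a set of finitary relations. Operations and relations are lifted pointwise to powers. A substructure is a subset closed under the operations, with the restricted relations. Homomorphisms preserve operations and relations. $\mathbb{ISP}(\mathbf M)$ is the category of all (non-empty) structures isomorphic to substructures of powers of $\mathbf M$, with homomorphisms as morphisms. For a structure with compact Hausdorff topology $\mathbf M^{\mathcal T}$, $\mathbb{IS}_c\mathbb P^+(\mathbf M^{\mathcal T})$ is the category of all structures with topology isomorphic to topologically closed substructures of powers $(\mathbf M^{\mathcal T})^S$ with $S\ne\varnothing$ (product topology), with continuous homomorphisms as morphisms; the empty structure belongs to it if the type has no nullary operations. $\mathcal C(\mathbf A,\mathbf B)$ denotes the set of morphisms in a category $\mathcal C$. Embeddings are isomorphisms onto substructures in $\mathbb{ISP}(\mathbf M)$ and isomorphisms onto topologically closed substructures in $\mathbb{IS}_c\mathbb P^+(\mathbf M^{\mathcal T})$; injectivity is with respect to these embeddings. **Dualities.** Let $\mathbf P$ be a total structure and $\mathbf Q^{\mathcal T}$ a total structure with compact Hausdorff topology on the same set that is an alter ego of $\mathbf P$: relations of $\mathbf Q$ form substructures of powers of $\mathbf P$, operations of $\mathbf Q$ are homomorphisms from powers of $\mathbf P$ to $\mathbf P$, and relations of $\mathbf P$ are closed and operations of $\mathbf P$ are continuous with respect to $\mathcal T$. (In the theorem, $\mathbf M_2^{\mathcal T}$ is an alter ego of $\mathbf M_1$ and $\mathbf M_1^{\mathcal T}$ is an alter ego of $\mathbf M_2$.) Let $\mathcal A=\mathbb{ISP}(\mathbf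 P)$, $\mathcal X=\mathbb{IS}_c\mathbb P^+(\mathbf Q^{\mathcal T})$. For $\mathbf A\in\mathcal A$, $\mathcal A(\mathbf A,\mathbf P)$ is a closed substructure $\mathrm D(\mathbf A)$ of $(\mathbf Q^{\mathcal T})^A$; for $\mathbf X\in\mathcal X$, $\mathcal X(\mathbf X,\mathbf Q^{\mathcal T})$ is a substructure $\mathrm E(\mathbf X)$ of $\mathbf P^X$. $\mathbf Q^{\mathcal T}$ fully dualises $\mathbf P$ if the evaluation maps $e_{\mathbf A}\colon\mathbf A\to\mathrm{ED}(\mathbf A)$, $e_{\mathbf A}(a)(x)=x(a)$, and $\varepsilon_{\mathbf X}\colon\mathbf X\to\mathrm{DE}(\mathbf X)$, $\varepsilon_{\mathbf X}(x)(\alpha)=\alpha(x)$, are isomorphisms for all $\mathbf A\in\mathcal A$ and $\mathbf X\in\mathcal X$; it strongly dualises $\mathbf P$ if in addition $\mathbf Q^{\mathcal T}$ is injective in $\mathcal X$. **Base categories.** $\mathbf D$ is the two-element bounded lattice, $\mathcal D=\mathbb{ISP}(\mathbf D)$ (bounded distributive lattices); $\widetilde{\mathbf D}=\langle\{0,1\};\leqslant,\mathcal T\rangle$ is the two-element chain with discrete topology, $\mathcal P=\mathbb{IS}_c\mathbb P^+(\widetilde{\mathbf D})$ (Priestley spaces); $\mathbf 2=\langle\{0,1\};\leqslant\rangle$, $\mathcal Q=\mathbb{ISP}(\mathbf 2)$ (non-empty ordered sets); $\widetilde{\mathbf 2}=\langle\{0,1\};\vee,\wedge,0,1,\mathcal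 T\rangle$ with discrete topology, $\mathcal D_{\mathcal T}=\mathbb{IS}_c\mathbb P^+(\widetilde{\mathbf 2})$ (non-trivial Boolean-topological bounded distributive lattices). The hom-sets $\mathcal D(\mathbf L,\mathbf D)\subseteq\widetilde{\mathbf D}^L$, $\mathcal P(\mathbf Y,\widetilde{\mathbf D})\subseteq\mathbf D^Y$, $\mathcal Q(\mathbf L,\mathbf 2)\subseteq\widetilde{\mathbf 2}^L$, $\mathcal D_{\mathcal T}(\mathbf Y,\widetilde{\mathbf 2})\subseteq\mathbf 2^Y$ carry pointwise structure. The superscript $\flat$ on an object of $\mathcal A_1$ or $\mathcal X_1$ means forgetting $\neg$ (leaving the bounded lattice, with topology if present), and on an object of $\mathcal A_2$ or $\mathcal X_2$ means forgetting $u$ (leaving the order, with topology if present). *)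

theory Defs
  imports "HOL-Analysis.Analysis"
begin

section \<open>Structures\<close>

text \<open>
  A signature assigns arities to the operation and relation symbols of a type; a symbol that is
  mapped to \<^const>\<open>None\<close> does not belong to it. A structure interprets symbols on lists;
  only its values at symbols of the signature, on lists of the right length over the carrier,
  are meaningful.
\<close>

record ('f, 'r) signature =
  opar :: "'f \<Rightarrow> nat option"
  relar :: "'r \<Rightarrow> nat option"

record ('a, 'f, 'r) struct =
  carrier :: "'a set"
  opn :: "'f \<Rightarrow> 'a list \<Rightarrow> 'a"
  reln :: "'r \<Rightarrow> 'a list set"

record ('a, 'f, 'r) tstruct = "('a, 'f, 'r) struct" +
  topo :: "'a topology"

definition tuples :: "'a set \<Rightarrow> nat \<Rightarrow> 'a list set" where
  "tuples A n = {xs. length xs = n \<and> set xs \<subseteq> A}"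

definition is_structure :: "('f, 'r) signature \<Rightarrow> ('a, 'f, 'r, 'z) struct_scheme \<Rightarrow> bool" where
  "is_structure \<Sigma> A \<longleftrightarrow>
     (\<forall>f n. opar \<Sigma> f = Some n \<longrightarrow> (\<forall>xs \<in> tuples (carrier A) n. opn A f xs \<in> carrier A)) \<and>
     (\<forall>r n. relar \<Sigma> r = Some n \<longrightarrow> reln A r \<subseteq> tuples (carrier A) n)"

definition total_structure :: "('f, 'r) signature \<Rightarrow> ('a, 'f, 'r, 'z) struct_scheme \<Rightarrow> bool" where
  "total_structure \<Sigma> A \<longleftrightarrow> is_structure \<Sigma> A \<and> carrier A \<noteq> {}"

text \<open>The carrier may be empty here, which forces the signature to have no nullary operations.\<close>

definition is_tstructure :: "('f, 'r) signature \<Rightarrow> ('a, 'f, 'r) tstruct \<Rightarrow> bool" where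
  "is_tstructure \<Sigma> X \<longleftrightarrow> is_structure \<Sigma> X \<and> topspace (topo X) = carrier X"

definition with_topo :: "'a topology \<Rightarrow> ('a, 'f, 'r) struct \<Rightarrow> ('a, 'f, 'r) tstruct" where
  "with_topo T A = \<lparr>carrier = carrier A, opn = opn A, reln = reln A, topo = T\<rparr>"

definition reduct ::
  "('f, 'r) signature \<Rightarrow> ('a, 'f, 'r, 'z) struct_scheme \<Rightarrow> ('a, 'f, 'r, 'z) struct_scheme" where
  "reduct \<Sigma> A =
     A\<lparr>opn := (\<lambda>f. if opar \<Sigma> f = None then undefined else opn A f),
       reln := (\<lambda>r. if relar \<Sigma> r = None then {} else reln A r)\<rparr>"

subsection \<open>Morphisms\<close>

text \<open>Morphisms are extensional functions, so that hom-sets are subsets of powers.\<close>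

definition shom :: "('f, 'r) signature \<Rightarrow> ('a, 'f, 'r, 'z) struct_scheme
    \<Rightarrow> ('b, 'f, 'r, 'w) struct_scheme \<Rightarrow> ('a \<Rightarrow> 'b) set" where
  "shom \<Sigma> A B = {\<phi> \<in> carrier A \<rightarrow>\<^sub>E carrier B.
     (\<forall>f n. opar \<Sigma> f = Some n \<longrightarrow>
        (\<forall>xs \<in> tuples (carrier A) n. \<phi> (opn A f xs) = opn B f (map \<phi> xs))) \<and>
     (\<forall>r n. relar \<Sigma> r = Some n \<longrightarrow> (\<forall>xs \<in> reln A r. map \<phi> xs \<in> reln B r))}"

definition thom :: "('f, 'r) signature \<Rightarrow> ('a, 'f, 'r) tstruct
    \<Rightarrow> ('b, 'f, 'r) tstruct \<Rightarrow> ('a \<Rightarrow> 'b) set" where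
  "thom \<Sigma> X Y = {\<phi> \<in> shom \<Sigma> X Y. continuous_map (topo X) (topo Y) \<phi>}"

definition siso :: "('f, 'r) signature \<Rightarrow> ('a \<Rightarrow> 'b) \<Rightarrow> ('a, 'f, 'r, 'z) struct_scheme
    \<Rightarrow> ('b, 'f, 'r, 'w) struct_scheme \<Rightarrow> bool" where
  "siso \<Sigma> \<phi> A B \<longleftrightarrow> \<phi> \<in> shom \<Sigma> A B \<and>
     (\<exists>\<psi> \<in> shom \<Sigma> B A. (\<forall>a \<in> carrier A. \<psi> (\<phi> a) = a) \<and> (\<forall>b \<in> carrier B. \<phi> (\<psi> b) = b))"

definition tiso :: "('f, 'r) signature \<Rightarrow> ('a \<Rightarrow> 'b) \<Rightarrow> ('a, 'f, 'r) tstruct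
    \<Rightarrow> ('b, 'f, 'r) tstruct \<Rightarrow> bool" where
  "tiso \<Sigma> \<phi> X Y \<longleftrightarrow> \<phi> \<in> thom \<Sigma> X Y \<and>
     (\<exists>\<psi> \<in> thom \<Sigma> Y X. (\<forall>x \<in> carrier X. \<psi> (\<phi> x) = x) \<and> (\<forall>y \<in> carrier Y. \<phi> (\<psi> y) = y))"

subsection \<open>Substructures and powers\<close>

definition is_sub :: "('f, 'r) signature \<Rightarrow> 'a set \<Rightarrow> ('a, 'f, 'r, 'z) struct_scheme \<Rightarrow> bool" where
  "is_sub \<Sigma> C A \<longleftrightarrow> C \<subseteq> carrier A \<and>
     (\<forall>f n. opar \<Sigma> f = Some n \<longrightarrow> (\<forall>xs \<in> tuples C n. opn A f xs \<in> C))"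

definition sub :: "('a, 'f, 'r, 'z) struct_scheme \<Rightarrow> 'a set \<Rightarrow> ('a, 'f, 'r, 'z) struct_scheme" where
  "sub A C = A\<lparr>carrier := C, reln := (\<lambda>r. reln A r \<inter> lists C)\<rparr>"

definition tsub :: "('a, 'f, 'r) tstruct \<Rightarrow> 'a set \<Rightarrow> ('a, 'f, 'r) tstruct" where
  "tsub X C = (sub X C)\<lparr>topo := subtopology (topo X) C\<rparr>"

definition pow :: "('f, 'r) signature \<Rightarrow> ('m, 'f, 'r, 'z) struct_scheme \<Rightarrow> 's set
    \<Rightarrow> ('s \<Rightarrow> 'm, 'f, 'r) struct" where
  "pow \<Sigma> M S =
     \<lparr>carrier = S \<rightarrow>\<^sub>E carrier M,
      opn = (\<lambda>f gs. \<lambda>s\<in>S. opn M f (map (\<lambda>g. g s) gs)),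
      reln = (\<lambda>r. {gs \<in> tuples (S \<rightarrow>\<^sub>E carrier M) (the (relar \<Sigma> r)).
                   \<forall>s\<in>S. map (\<lambda>g. g s) gs \<in> reln M r})\<rparr>"

definition tpow :: "('f, 'r) signature \<Rightarrow> ('m, 'f, 'r) tstruct \<Rightarrow> 's set
    \<Rightarrow> ('s \<Rightarrow> 'm, 'f, 'r) tstruct" where
  "tpow \<Sigma> M S = with_topo (product_topology (\<lambda>_. topo M) S) (pow \<Sigma> M S)"

definition semb :: "('f, 'r) signature \<Rightarrow> ('a \<Rightarrow> 'b) \<Rightarrow> ('a, 'f, 'r, 'z) struct_scheme
    \<Rightarrow> ('b, 'f, 'r, 'w) struct_scheme \<Rightarrow> bool" where
  "semb \<Sigma> \<phi> A B \<longleftrightarrow> (\<exists>C. is_sub \<Sigma> C B \<and> siso \<Sigma> \<phi> A (sub B C))"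

definition temb :: "('f, 'r) signature \<Rightarrow> ('a \<Rightarrow> 'b) \<Rightarrow> ('a, 'f, 'r) tstruct
    \<Rightarrow> ('b, 'f, 'r) tstruct \<Rightarrow> bool" where
  "temb \<Sigma> \<phi> X Y \<longleftrightarrow>
     (\<exists>C. is_sub \<Sigma> C Y \<and> closedin (topo Y) C \<and> tiso \<Sigma> \<phi> X (tsub Y C))"

section \<open>The classes generated by a structure\<close>

text \<open>
  An existential quantifier cannot range over all index sets of all types. The index sets below
  are sets of functions from the structure into the generator; the lemmas \<open>ISP_I\<close> and \<open>IScP_I\<close>
  show that this is no restriction.
\<close>

definition ISP :: "('f, 'r) signature \<Rightarrow> ('m, 'f, 'r) struct \<Rightarrow> ('a, 'f, 'r) struct set" where
  "ISP \<Sigma> M = {A. total_structure \<Sigma> A \<and> (\<exists>(S :: ('a \<Rightarrow> 'm) set) \<phi>. semb \<Sigma> \<phi> A (pow \<Sigma> M S))}"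

definition IScP :: "('f, 'r) signature \<Rightarrow> ('m, 'f, 'r) tstruct \<Rightarrow> ('a, 'f, 'r) tstruct set" where
  "IScP \<Sigma> M = {X. is_tstructure \<Sigma> X \<and>
     (\<exists>(S :: ('a \<Rightarrow> 'm) set) \<phi>. S \<noteq> {} \<and> temb \<Sigma> \<phi> X (tpow \<Sigma> M S))}"

lemma carrier_sub [simp]: "carrier (sub A C) = C"
  and opn_sub [simp]: "opn (sub A C) = opn A"
  and reln_sub [simp]: "reln (sub A C) r = reln A r \<inter> lists C"
  by (simp_all add: sub_def)

lemma tsub_simps [simp]:
  "carrier (tsub X C) = C" "opn (tsub X C) = opn X"
  "reln (tsub X C) r = reln X r \<inter> lists C" "topo (tsub X C) = subtopology (topo X) C"
  by (simp_all add: tsub_def)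

lemma tpow_simps [simp]:
  "carrier (tpow \<Sigma> M S) = carrier (pow \<Sigma> M S)" "opn (tpow \<Sigma> M S) = opn (pow \<Sigma> M S)"
  "reln (tpow \<Sigma> M S) = reln (pow \<Sigma> M S)"
  "topo (tpow \<Sigma> M S) = product_topology (\<lambda>_. topo M) S"
  by (simp_all add: tpow_def with_topo_def)

lemma shom_tsub_tpow: "shom \<Sigma> X (tsub (tpow \<Sigma> M S) C) = shom \<Sigma> X (sub (pow \<Sigma> M S) C)"
  "shom \<Sigma> (tsub (tpow \<Sigma> M S) C) X = shom \<Sigma> (sub (pow \<Sigma> M S) C) X"
  by (simp_all add: shom_def)

lemma is_sub_tpow: "is_sub \<Sigma> C (tpow \<Sigma> M S) = is_sub \<Sigma> C (pow \<Sigma> M S)"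
  by (simp add: is_sub_def)

lemma shom_op:
  "\<phi> \<in> shom \<Sigma> A B \<Longrightarrow> opar \<Sigma> f = Some n \<Longrightarrow> xs \<in> tuples (carrier A) n \<Longrightarrow>
     \<phi> (opn A f xs) = opn B f (map \<phi> xs)"
  unfolding shom_def by blast

lemma shom_rel:
  "\<phi> \<in> shom \<Sigma> A B \<Longrightarrow> relar \<Sigma> r = Some n \<Longrightarrow> xs \<in> reln A r \<Longrightarrow> map \<phi> xs \<in> reln B r"
  unfolding shom_def by blast

lemma shomI:
  assumes "\<And>a. a \<in> carrier A \<Longrightarrow> \<phi> a \<in> carrier B" "\<phi> \<in> extensional (carrier A)"
    and "\<And>f n xs. opar \<Sigma> f = Some n \<Longrightarrow> xs \<in> tuples (carrier A) n \<Longrightarrow>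
           \<phi> (opn A f xs) = opn B f (map \<phi> xs)"
    and "\<And>r n xs. relar \<Sigma> r = Some n \<Longrightarrow> xs \<in> reln A r \<Longrightarrow> map \<phi> xs \<in> reln B r"
  shows "\<phi> \<in> shom \<Sigma> A B"
  using assms unfolding shom_def PiE_iff mem_Collect_eq by blast

lemma is_structure_op:
  "is_structure \<Sigma> A \<Longrightarrow> opar \<Sigma> f = Some n \<Longrightarrow> xs \<in> tuples (carrier A) n \<Longrightarrow> opn A f xs \<in> carrier A"
  unfolding is_structure_def by blast

lemma is_structure_rel:
  "is_structure \<Sigma> A \<Longrightarrow> relar \<Sigma> r = Some n \<Longrightarrow> xs \<in> reln A r \<Longrightarrow> xs \<in> tuples (carrier A) n"
  unfolding is_structure_def by blast

lemma tuples_iff: "xs \<in> tuples A n \<longleftrightarrow> length xs = n \<and> set xs \<subseteq> A"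
  by (simp add: tuples_def)

lemma shom_proj:
  assumes \<phi>: "\<phi> \<in> shom \<Sigma> A (sub (pow \<Sigma> M S) C)" and C: "C \<subseteq> carrier (pow \<Sigma> M S)"
    and A: "is_structure \<Sigma> A" and s: "s \<in> S"
  shows "(\<lambda>a\<in>carrier A. \<phi> a s) \<in> shom \<Sigma> A M"
proof -
  let ?h = "\<lambda>a\<in>carrier A. \<phi> a s"
  have m: "\<phi> a \<in> S \<rightarrow>\<^sub>E carrier M" if "a \<in> carrier A" for a
    using \<phi> C that by (auto simp: shom_def pow_def)
  have mp: "map ?h xs = map (\<lambda>g. g s) (map \<phi> xs)" if "set xs \<subseteq> carrier A" for xs
    using that by (auto simp: subset_iff)
  have "?h (opn A f xs) = opn M f (map ?h xs)"
    if f: "opar \<Sigma> f = Some n" and xs: "xs \<in> tuples (carrier A) n" for f n xs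
  proof -
    have "opn A f xs \<in> carrier A" by (rule is_structure_op[OF A f xs])
    moreover have "\<phi> (opn A f xs) = opn (pow \<Sigma> M S) f (map \<phi> xs)"
      by (rule shom_op[OF \<phi> f xs, simplified])
    ultimately show ?thesis
      using mp[of xs] xs s unfolding pow_def tuples_def by (simp del: map_map)
  qed
  moreover have "map ?h xs \<in> reln M r"
    if r: "relar \<Sigma> r = Some n" and xs: "xs \<in> reln A r" for r n xs
  proof -
    have "set xs \<subseteq> carrier A" using is_structure_rel[OF A r xs] by (simp add: tuples_iff)
    moreover have "map \<phi> xs \<in> reln (pow \<Sigma> M S) r" using shom_rel[OF \<phi> r xs] by simp
    ultimately show ?thesis using mp[of xs] s by (simp add: pow_def del: map_map)
  qed
  ultimately show ?thesis using m s by (auto simp: shom_def PiE_iff)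
qed

lemma restrict_inv_into:
  assumes "inj_on f A"
  shows "\<forall>a\<in>A. restrict (inv_into A f) (f ` A) (f a) = a"
    and "\<forall>b\<in>f ` A. f (restrict (inv_into A f) (f ` A) b) = b"
  using assms by auto

text \<open>
  If a structure embeds in some power, and \<open>H\<close> is a set of homomorphisms that contains the
  coordinates of this embedding, then evaluation embeds it in the power with index set \<open>H\<close>.
\<close>

lemma siso_eval:
  fixes A :: "('a, 'f, 'r, 'z) struct_scheme" and M :: "('m, 'f, 'r, 'w) struct_scheme"
  assumes A: "is_structure \<Sigma> A" and \<phi>: "siso \<Sigma> \<phi> A (sub (pow \<Sigma> M S) C)"
    and C: "C \<subseteq> carrier (pow \<Sigma> M S)" and H: "H \<subseteq> shom \<Sigma> A M"
    and SH: "\<And>s. s \<in> S \<Longrightarrow> (\<lambda>a\<in>carrier A. \<phi> a s) \<in> H"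
  defines "\<psi> \<equiv> \<lambda>a\<in>carrier A. \<lambda>h\<in>H. h a"
  shows "inj_on \<psi> (carrier A)"
    and "is_sub \<Sigma> (\<psi> ` carrier A) (pow \<Sigma> M H)"
    and "\<psi> \<in> shom \<Sigma> A (sub (pow \<Sigma> M H) (\<psi> ` carrier A))"
    and "restrict (inv_into (carrier A) \<psi>) (\<psi> ` carrier A)
           \<in> shom \<Sigma> (sub (pow \<Sigma> M H) (\<psi> ` carrier A)) A"
proof -
  from \<phi> obtain \<eta> where \<phi>h: "\<phi> \<in> shom \<Sigma> A (sub (pow \<Sigma> M S) C)"
    and \<eta>: "\<eta> \<in> shom \<Sigma> (sub (pow \<Sigma> M S) C) A" and \<eta>\<phi>: "\<And>a. a \<in> carrier A \<Longrightarrow> \<eta> (\<phi> a) = a"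
    by (auto simp: siso_def)
  have \<phi>m: "\<phi> a \<in> S \<rightarrow>\<^sub>E carrier M" if "a \<in> carrier A" for a
    using \<phi>h C that by (auto simp: shom_def pow_def)
  have \<phi>C: "\<phi> a \<in> C" if "a \<in> carrier A" for a
    using \<phi>h that by (auto simp: shom_def)
  have \<psi>s: "\<psi> a (\<lambda>a\<in>carrier A. \<phi> a s) = \<phi> a s" if "a \<in> carrier A" "s \<in> S" for a s
    using that SH[of s] by (simp add: \<psi>_def)
  show inj: "inj_on \<psi> (carrier A)"
  proof (rule inj_onI)
    fix a b assume a: "a \<in> carrier A" and b: "b \<in> carrier A" and eq: "\<psi> a = \<psi> b"
    have "\<phi> a = \<phi> b"
      using \<phi>m[OF a] \<phi>m[OF b] \<psi>s[OF a] \<psi>s[OF b] eq by (intro PiE_ext[of _ S "\<lambda>_. carrier M"]) auto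
    then show "a = b" using \<eta>\<phi> a b by metis
  qed
  have opA: "opn A f xs \<in> carrier A" if "opar \<Sigma> f = Some n" "xs \<in> tuples (carrier A) n" for f n xs
    by (rule is_structure_op[OF A that])
  have mp: "map (\<lambda>g. g h) (map \<psi> xs) = map h xs" if "set xs \<subseteq> carrier A" "h \<in> H" for h xs
    using that by (auto simp: \<psi>_def subset_iff)
  have op: "opn (pow \<Sigma> M H) f (map \<psi> xs) = \<psi> (opn A f xs)"
    if f: "opar \<Sigma> f = Some n" and xs: "xs \<in> tuples (carrier A) n" for f n xs
  proof -
    have "h (opn A f xs) = opn M f (map (\<lambda>g. g h) (map \<psi> xs))" if h: "h \<in> H" for h
      using mp[OF _ h, of xs] shom_op[OF _ f xs, of h M] H h xs by (auto simp: tuples_iff simp del: map_map)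
    then have "(\<lambda>h\<in>H. opn M f (map (\<lambda>g. g h) (map \<psi> xs))) = (\<lambda>h\<in>H. h (opn A f xs))"
      by (intro restrict_ext) simp
    then show ?thesis using opA[OF f xs] by (simp add: pow_def \<psi>_def)
  qed
  have \<psi>P: "\<psi> a \<in> H \<rightarrow>\<^sub>E carrier M" if "a \<in> carrier A" for a
    using that H by (auto simp: \<psi>_def shom_def)
  have lift: "\<exists>xs \<in> tuples (carrier A) n. ys = map \<psi> xs" if "ys \<in> tuples (\<psi> ` carrier A) n" for ys n
  proof -
    have "ys = map \<psi> (map (inv_into (carrier A) \<psi>) ys)"
      using that by (auto simp: tuples_def subset_iff f_inv_into_f intro!: map_idI[symmetric])
    moreover have "map (inv_into (carrier A) \<psi>) ys \<in> tuples (carrier A) n"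
      using that by (auto simp: tuples_def subset_iff inv_into_into)
    ultimately show ?thesis by blast
  qed
  show "is_sub \<Sigma> (\<psi> ` carrier A) (pow \<Sigma> M H)"
  proof -
    have "opn (pow \<Sigma> M H) f ys \<in> \<psi> ` carrier A"
      if f: "opar \<Sigma> f = Some n" and ys: "ys \<in> tuples (\<psi> ` carrier A) n" for f n ys
      using lift[OF ys] op[OF f] opA[OF f] by auto
    moreover have "\<psi> ` carrier A \<subseteq> carrier (pow \<Sigma> M H)"
      using \<psi>P by (simp add: pow_def image_subset_iff)
    ultimately show ?thesis unfolding is_sub_def by blast
  qed
  have relp: "map \<psi> xs \<in> reln (pow \<Sigma> M H) r"
    if r: "relar \<Sigma> r = Some n" and xs: "xs \<in> reln A r" for r n xs
  proof -
    have xs': "xs \<in> tuples (carrier A) n" by (rule is_structure_rel[OF A r xs])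
    have "map (\<lambda>g. g h) (map \<psi> xs) \<in> reln M r" if h: "h \<in> H" for h
      using mp[OF _ h, of xs] xs' shom_rel[OF _ r xs, of h M] H h by (auto simp: tuples_iff simp del: map_map)
    moreover have "map \<psi> xs \<in> tuples (H \<rightarrow>\<^sub>E carrier M) n"
      using xs' \<psi>P by (auto simp: tuples_def)
    ultimately show ?thesis using r by (simp add: pow_def)
  qed
  have "map \<psi> xs \<in> lists (\<psi> ` carrier A)" if "relar \<Sigma> r = Some n" "xs \<in> reln A r" for r n xs
    using is_structure_rel[OF A that] unfolding tuples_iff in_lists_conv_set set_map by blast
  then show "\<psi> \<in> shom \<Sigma> A (sub (pow \<Sigma> M H) (\<psi> ` carrier A))"
    using op relp by (intro shomI) (auto simp: \<psi>_def)
  let ?i = "restrict (inv_into (carrier A) \<psi>) (\<psi> ` carrier A)"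
  have i: "?i (\<psi> a) = a" if "a \<in> carrier A" for a
    using that inj by simp
  have im: "map ?i (map \<psi> xs) = xs" if "set xs \<subseteq> carrier A" for xs
    using that inj by (auto simp: subset_iff intro!: map_idI)
  have "?i (opn (pow \<Sigma> M H) f ys) = opn A f (map ?i ys)"
    if f: "opar \<Sigma> f = Some n" and ys: "ys \<in> tuples (\<psi> ` carrier A) n" for f n ys
  proof -
    obtain xs where xs: "xs \<in> tuples (carrier A) n" "ys = map \<psi> xs" using lift[OF ys] by blast
    show ?thesis
      unfolding xs(2) op[OF f xs(1)] i[OF opA[OF f xs(1)]]
      using im[of xs] xs(1) by (simp only: tuples_def mem_Collect_eq)
  qed
  moreover have "map ?i ys \<in> reln A r"
    if r: "relar \<Sigma> r = Some n" and ys: "ys \<in> reln (pow \<Sigma> M H) r \<inter> lists (\<psi> ` carrier A)" for r n ys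
  proof -
    have "ys \<in> tuples (\<psi> ` carrier A) n"
      using ys r by (auto simp: pow_def tuples_def)
    then obtain xs where xs: "xs \<in> tuples (carrier A) n" "ys = map \<psi> xs" using lift by blast
    have xc: "set xs \<subseteq> carrier A" using xs by (simp add: tuples_def)
    have "map (\<lambda>g. g s) (map \<phi> xs) \<in> reln M r" if s: "s \<in> S" for s
    proof -
      let ?h = "\<lambda>a\<in>carrier A. \<phi> a s"
      have "map (\<lambda>g. g ?h) ys \<in> reln M r"
        using ys SH[OF s] unfolding pow_def by (simp del: restrict_apply)
      also have "map (\<lambda>g. g ?h) ys = map (\<lambda>g. g s) (map \<phi> xs)"
        using xc \<psi>s s by (auto simp: xs(2) subset_iff)
      finally show ?thesis .
    qed
    moreover have "map \<phi> xs \<in> tuples (S \<rightarrow>\<^sub>E carrier M) n" "map \<phi> xs \<in> lists C"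
      using xs(1) \<phi>m \<phi>C unfolding tuples_iff in_lists_conv_set set_map length_map by blast+
    ultimately have "map \<phi> xs \<in> reln (pow \<Sigma> M S) r \<inter> lists C"
      using r by (simp add: pow_def)
    then have "map \<eta> (map \<phi> xs) \<in> reln A r" using shom_rel[OF \<eta> r] by (simp del: map_map)
    moreover have "map \<eta> (map \<phi> xs) = xs" using xc \<eta>\<phi> by (auto simp: subset_iff intro!: map_idI)
    ultimately show ?thesis using im[OF xc] xs(2) by simp
  qed
  ultimately show "?i \<in> shom \<Sigma> (sub (pow \<Sigma> M H) (\<psi> ` carrier A)) A"
    using i by (intro shomI) auto
qed

lemma ISP_I:
  fixes S :: "'s set"
  assumes A: "total_structure \<Sigma> A" and \<phi>: "semb \<Sigma> \<phi> A (pow \<Sigma> M S)"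
  shows "A \<in> ISP \<Sigma> M"
proof -
  let ?H = "shom \<Sigma> A M" and ?\<psi> = "\<lambda>a\<in>carrier A. \<lambda>h\<in>shom \<Sigma> A M. h a"
  have A': "is_structure \<Sigma> A" using A by (simp add: total_structure_def)
  from \<phi> obtain C where C: "is_sub \<Sigma> C (pow \<Sigma> M S)" "siso \<Sigma> \<phi> A (sub (pow \<Sigma> M S) C)"
    by (auto simp: semb_def)
  have Cs: "C \<subseteq> carrier (pow \<Sigma> M S)" using C by (simp add: is_sub_def)
  have SH: "(\<lambda>a\<in>carrier A. \<phi> a s) \<in> ?H" if "s \<in> S" for s
    using shom_proj[OF _ Cs A' that] C by (simp add: siso_def)
  note * = siso_eval[OF A' C(2) Cs subset_refl SH]
  have "siso \<Sigma> ?\<psi> A (sub (pow \<Sigma> M ?H) (?\<psi> ` carrier A))"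
    unfolding siso_def carrier_sub
    using *(3,4) restrict_inv_into[OF *(1)] by blast
  then have "semb \<Sigma> ?\<psi> A (pow \<Sigma> M ?H)" using *(2) by (auto simp: semb_def)
  then show ?thesis using A by (auto simp: ISP_def)
qed

lemma IScP_I:
  fixes S :: "'s set"
  assumes X: "is_tstructure \<Sigma> X" and \<phi>: "temb \<Sigma> \<phi> X (tpow \<Sigma> M S)" and S: "S \<noteq> {}"
    and M: "compact_space (topo M)" "Hausdorff_space (topo M)"
  shows "X \<in> IScP \<Sigma> M"
proof -
  let ?H = "thom \<Sigma> X M" and ?\<psi> = "\<lambda>a\<in>carrier X. \<lambda>h\<in>thom \<Sigma> X M. h a"
  let ?C' = "?\<psi> ` carrier X"
  let ?i = "restrict (inv_into (carrier X) ?\<psi>) ?C'"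
  have X': "is_structure \<Sigma> X" and tX: "topspace (topo X) = carrier X"
    using X by (simp_all add: is_tstructure_def)
  from \<phi> obtain C where Csub: "is_sub \<Sigma> C (pow \<Sigma> M S)"
    and Ccl: "closedin (product_topology (\<lambda>_. topo M) S) C"
    and Ciso: "tiso \<Sigma> \<phi> X (tsub (tpow \<Sigma> M S) C)"
    by (auto simp: temb_def is_sub_tpow)
  have siso: "siso \<Sigma> \<phi> X (sub (pow \<Sigma> M S) C)"
    using Ciso by (auto simp: siso_def tiso_def thom_def shom_tsub_tpow)
  have Cs: "C \<subseteq> carrier (pow \<Sigma> M S)" using Csub by (simp add: is_sub_def)
  have \<phi>c: "continuous_map (topo X) (product_topology (\<lambda>_. topo M) S) \<phi>" and \<phi>C: "\<phi> \<in> carrier X \<rightarrow> C"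
    using Ciso by (auto simp: tiso_def thom_def shom_def continuous_map_in_subtopology)
  obtain \<eta> where \<eta>c: "continuous_map (subtopology (product_topology (\<lambda>_. topo M) S) C) (topo X) \<eta>"
    and \<eta>\<phi>: "\<And>a. a \<in> carrier X \<Longrightarrow> \<eta> (\<phi> a) = a" and \<eta>X: "\<eta> ` C \<subseteq> carrier X"
  proof -
    from Ciso obtain \<eta> where \<eta>: "\<eta> \<in> thom \<Sigma> (tsub (tpow \<Sigma> M S) C) X"
      "\<forall>a\<in>carrier X. \<eta> (\<phi> a) = a"
      by (auto simp: tiso_def)
    from \<eta>(1) have "continuous_map (subtopology (product_topology (\<lambda>_. topo M) S) C) (topo X) \<eta>"
      "\<eta> \<in> C \<rightarrow>\<^sub>E carrier X"
      by (simp_all add: thom_def shom_def)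
    then show thesis using \<eta>(2) that by (simp add: image_subset_iff PiE_iff)
  qed
  have SH: "(\<lambda>a\<in>carrier X. \<phi> a s) \<in> ?H" if s: "s \<in> S" for s
  proof -
    have "(\<lambda>a\<in>carrier X. \<phi> a s) \<in> shom \<Sigma> X M"
      using shom_proj[OF _ Cs X' s] siso by (simp add: siso_def)
    moreover have "continuous_map (topo X) (topo M) (\<lambda>a. \<phi> a s)"
      using \<phi>c s by (simp add: continuous_map_componentwise)
    then have "continuous_map (topo X) (topo M) (\<lambda>a\<in>carrier X. \<phi> a s)"
      by (rule continuous_map_eq) (simp add: tX)
    ultimately show ?thesis by (simp add: thom_def)
  qed
  have H: "?H \<subseteq> shom \<Sigma> X M" by (auto simp: thom_def)
  note * = siso_eval[OF X' siso Cs H SH]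
  have Hne: "?H \<noteq> {}" using S SH by blast
  have \<psi>c: "continuous_map (topo X) (product_topology (\<lambda>_. topo M) ?H) ?\<psi>"
  proof -
    have "continuous_map (topo X) (topo M) (\<lambda>a. ?\<psi> a h)" if "h \<in> ?H" for h
      by (rule continuous_map_eq[of _ _ h]) (use that in \<open>auto simp: tX thom_def\<close>)
    then show ?thesis by (auto simp: continuous_map_componentwise tX)
  qed
  have "compact_space (product_topology (\<lambda>_. topo M) S)"
    using M(1) by (simp add: compact_space_product_topology)
  then have "compactin (product_topology (\<lambda>_. topo M) S) C"
    using Ccl by (rule closedin_compact_space)
  then have "compactin (subtopology (product_topology (\<lambda>_. topo M) S) C) C"
    by (simp add: compactin_subtopology)
  then have "compactin (topo X) (\<eta> ` C)"
    using \<eta>c by (rule image_compactin)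
  moreover have "\<eta> ` C = carrier X"
  proof
    show "carrier X \<subseteq> \<eta> ` C"
    proof
      fix a assume a: "a \<in> carrier X"
      show "a \<in> \<eta> ` C" using \<phi>C a by (intro image_eqI[of _ _ "\<phi> a"]) (auto simp: \<eta>\<phi>)
    qed
  qed (rule \<eta>X)
  ultimately have "compactin (topo X) (carrier X)" by simp
  then have "compactin (product_topology (\<lambda>_. topo M) ?H) ?C'"
    using \<psi>c by (rule image_compactin)
  then have cl: "closedin (product_topology (\<lambda>_. topo M) ?H) ?C'"
    using M(2) by (intro compactin_imp_closedin) (auto simp: Hausdorff_space_product_topology)
  let ?p = "\<lambda>w. \<lambda>s\<in>S. w (\<lambda>a\<in>carrier X. \<phi> a s)"
  have p\<psi>: "?p (?\<psi> a) = \<phi> a" if a: "a \<in> carrier X" for a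
  proof -
    have "\<phi> a \<in> extensional S" using \<phi>C Cs a by (auto simp: pow_def PiE_iff)
    then show ?thesis using SH a by (auto simp: extensional_def fun_eq_iff)
  qed
  have "continuous_map (product_topology (\<lambda>_. topo M) ?H) (product_topology (\<lambda>_. topo M) S) ?p"
    using SH by (auto simp: continuous_map_componentwise intro: continuous_map_product_projection)
  then have "continuous_map (subtopology (product_topology (\<lambda>_. topo M) ?H) ?C')
               (subtopology (product_topology (\<lambda>_. topo M) S) C) ?p"
    unfolding continuous_map_in_subtopology
  proof (intro conjI continuous_map_from_subtopology)
    have "?p w \<in> C" if "w \<in> ?C'" for w
    proof -
      from that obtain a where "a \<in> carrier X" "w = ?\<psi> a" by (rule imageE)
      then show ?thesis using p\<psi>[of a] \<phi>C by (simp only:) blast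
    qed
    then show "?p \<in> topspace (subtopology (product_topology (\<lambda>_. topo M) ?H) ?C') \<rightarrow> C"
      unfolding topspace_subtopology by blast
  qed
  then have "continuous_map (subtopology (product_topology (\<lambda>_. topo M) ?H) ?C') (topo X) (\<eta> \<circ> ?p)"
    using \<eta>c continuous_map_compose by blast
  then have ic: "continuous_map (subtopology (product_topology (\<lambda>_. topo M) ?H) ?C') (topo X) ?i"
  proof (rule continuous_map_eq)
    fix w assume "w \<in> topspace (subtopology (product_topology (\<lambda>_. topo M) ?H) ?C')"
    then obtain a where a: "a \<in> carrier X" "w = ?\<psi> a" by auto
    show "(\<eta> \<circ> ?p) w = ?i w"
      unfolding a(2) o_apply p\<psi>[OF a(1)] \<eta>\<phi>[OF a(1)]
      by (rule bspec[OF restrict_inv_into(1)[OF *(1)] a(1), symmetric])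
  qed
  have "tiso \<Sigma> ?\<psi> X (tsub (tpow \<Sigma> M ?H) ?C')"
    unfolding tiso_def tsub_simps
  proof (intro conjI bexI)
    show "?\<psi> \<in> thom \<Sigma> X (tsub (tpow \<Sigma> M ?H) ?C')"
      using *(3) \<psi>c by (auto simp: thom_def shom_tsub_tpow continuous_map_in_subtopology tX)
    show "?i \<in> thom \<Sigma> (tsub (tpow \<Sigma> M ?H) ?C') X"
      using *(4) ic by (simp add: thom_def shom_tsub_tpow)
  qed (use restrict_inv_into[OF *(1)] in blast)+
  then have "temb \<Sigma> ?\<psi> X (tpow \<Sigma> M ?H)"
    unfolding temb_def using *(2) cl by (intro exI[of _ ?C']) (simp add: is_sub_tpow)
  then show ?thesis using X Hne by (auto simp: IScP_def)
qed

section \<open>Dualities\<close>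

text \<open>
  Conversion between tuples as lists, used in structures, and as elements of the power with
  index set \<open>{..<n}\<close>.
\<close>

definition rel_fun :: "nat \<Rightarrow> 'a list set \<Rightarrow> (nat \<Rightarrow> 'a) set" where
  "rel_fun n R = (\<lambda>xs. \<lambda>i\<in>{..<n}. xs ! i) ` R"

definition op_fun :: "nat \<Rightarrow> 'a set \<Rightarrow> ('a list \<Rightarrow> 'a) \<Rightarrow> (nat \<Rightarrow> 'a) \<Rightarrow> 'a" where
  "op_fun n A F = (\<lambda>g \<in> {..<n} \<rightarrow>\<^sub>E A. F (map g [0..<n]))"

definition alter_ego :: "('f, 'r) signature \<Rightarrow> ('m, 'f, 'r) struct
    \<Rightarrow> ('g, 'q) signature \<Rightarrow> ('m, 'g, 'q) tstruct \<Rightarrow> bool" where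
  "alter_ego \<Sigma> P \<Sigma>' Q \<longleftrightarrow>
     total_structure \<Sigma> P \<and> total_structure \<Sigma>' Q \<and> is_tstructure \<Sigma>' Q \<and>
     carrier Q = carrier P \<and> compact_space (topo Q) \<and> Hausdorff_space (topo Q) \<and>
     (\<forall>r n. relar \<Sigma>' r = Some n \<longrightarrow> is_sub \<Sigma> (rel_fun n (reln Q r)) (pow \<Sigma> P {..<n})) \<and>
     (\<forall>f n. opar \<Sigma>' f = Some n \<longrightarrow> op_fun n (carrier P) (opn Q f) \<in> shom \<Sigma> (pow \<Sigma> P {..<n}) P) \<and>
     (\<forall>r n. relar \<Sigma> r = Some n \<longrightarrow>
        closedin (product_topology (\<lambda>_. topo Q) {..<n}) (rel_fun n (reln P r))) \<and>
     (\<forall>f n. opar \<Sigma> f = Some n \<longrightarrow>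
        continuous_map (product_topology (\<lambda>_. topo Q) {..<n}) (topo Q) (op_fun n (carrier P) (opn P f)))"

definition dualD :: "('f, 'r) signature \<Rightarrow> ('m, 'f, 'r) struct
    \<Rightarrow> ('g, 'q) signature \<Rightarrow> ('m, 'g, 'q) tstruct
    \<Rightarrow> ('a, 'f, 'r) struct \<Rightarrow> ('a \<Rightarrow> 'm, 'g, 'q) tstruct" where
  "dualD \<Sigma> P \<Sigma>' Q A = tsub (tpow \<Sigma>' Q (carrier A)) (shom \<Sigma> A P)"

definition dualE :: "('f, 'r) signature \<Rightarrow> ('m, 'f, 'r) struct
    \<Rightarrow> ('g, 'q) signature \<Rightarrow> ('m, 'g, 'q) tstruct
    \<Rightarrow> ('x, 'g, 'q) tstruct \<Rightarrow> ('x \<Rightarrow> 'm, 'f, 'r) struct" where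
  "dualE \<Sigma> P \<Sigma>' Q X = sub (pow \<Sigma> P (carrier X)) (thom \<Sigma>' X Q)"

definition evalA :: "('f, 'r) signature \<Rightarrow> ('m, 'f, 'r) struct
    \<Rightarrow> ('a, 'f, 'r) struct \<Rightarrow> 'a \<Rightarrow> ('a \<Rightarrow> 'm) \<Rightarrow> 'm" where
  "evalA \<Sigma> P A = (\<lambda>a \<in> carrier A. \<lambda>x \<in> shom \<Sigma> A P. x a)"

definition evalX :: "('g, 'q) signature \<Rightarrow> ('m, 'g, 'q) tstruct
    \<Rightarrow> ('x, 'g, 'q) tstruct \<Rightarrow> 'x \<Rightarrow> ('x \<Rightarrow> 'm) \<Rightarrow> 'm" where
  "evalX \<Sigma>' Q X = (\<lambda>x \<in> carrier X. \<lambda>\<alpha> \<in> thom \<Sigma>' X Q. \<alpha> x)"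

text \<open>
  Types cannot be quantified inside a definition, so the types over which the structures of a
  class range are passed as arguments.
\<close>

definition fully_dualises :: "'a itself \<Rightarrow> 'x itself
    \<Rightarrow> ('g, 'q) signature \<Rightarrow> ('m, 'g, 'q) tstruct
    \<Rightarrow> ('f, 'r) signature \<Rightarrow> ('m, 'f, 'r) struct \<Rightarrow> bool" where
  "fully_dualises (_ :: 'a itself) (_ :: 'x itself) \<Sigma>' Q \<Sigma> P \<longleftrightarrow>
     alter_ego \<Sigma> P \<Sigma>' Q \<and>
     (\<forall>A \<in> (ISP \<Sigma> P :: ('a, 'f, 'r) struct set).
        siso \<Sigma> (evalA \<Sigma> P A) A (dualE \<Sigma> P \<Sigma>' Q (dualD \<Sigma> P \<Sigma>' Q A))) \<and>
     (\<forall>X \<in> (IScP \<Sigma>' Q :: ('x, 'g, 'q) tstruct set).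
        tiso \<Sigma>' (evalX \<Sigma>' Q X) X (dualD \<Sigma> P \<Sigma>' Q (dualE \<Sigma> P \<Sigma>' Q X)))"

definition injective_ISP :: "'a itself \<Rightarrow> 'b itself
    \<Rightarrow> ('f, 'r) signature \<Rightarrow> ('m, 'f, 'r) struct \<Rightarrow> bool" where
  "injective_ISP (_ :: 'a itself) (_ :: 'b itself) \<Sigma> M \<longleftrightarrow>
     (\<forall>A \<in> (ISP \<Sigma> M :: ('a, 'f, 'r) struct set).
      \<forall>B \<in> (ISP \<Sigma> M :: ('b, 'f, 'r) struct set).
      \<forall>\<phi> g. semb \<Sigma> \<phi> A B \<and> g \<in> shom \<Sigma> A M \<longrightarrow>
        (\<exists>h \<in> shom \<Sigma> B M. \<forall>a \<in> carrier A. h (\<phi> a) = g a))"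

definition injective_IScP :: "'x itself \<Rightarrow> 'y itself
    \<Rightarrow> ('f, 'r) signature \<Rightarrow> ('m, 'f, 'r) tstruct \<Rightarrow> bool" where
  "injective_IScP (_ :: 'x itself) (_ :: 'y itself) \<Sigma> M \<longleftrightarrow>
     (\<forall>X \<in> (IScP \<Sigma> M :: ('x, 'f, 'r) tstruct set).
      \<forall>Y \<in> (IScP \<Sigma> M :: ('y, 'f, 'r) tstruct set).
      \<forall>\<phi> g. temb \<Sigma> \<phi> X Y \<and> g \<in> thom \<Sigma> X M \<longrightarrow>
        (\<exists>h \<in> thom \<Sigma> Y M. \<forall>x \<in> carrier X. h (\<phi> x) = g x))"

definition strongly_dualises :: "'a itself \<Rightarrow> 'x itself \<Rightarrow> 'y itself
    \<Rightarrow> ('g, 'q) signature \<Rightarrow> ('m, 'g, 'q) tstruct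
    \<Rightarrow> ('f, 'r) signature \<Rightarrow> ('m, 'f, 'r) struct \<Rightarrow> bool" where
  "strongly_dualises ta tx ty \<Sigma>' Q \<Sigma> P \<longleftrightarrow>
     fully_dualises ta tx \<Sigma>' Q \<Sigma> P \<and> injective_IScP tx ty \<Sigma>' Q"

section \<open>The concrete structures\<close>

text \<open>One type of symbols serves all signatures; \<open>{0, 1}\<close> is \<^typ>\<open>bool\<close>.\<close>

datatype op_sym = Join | Meet | Neg | Zero | One | Shift
datatype rel_sym = Leq

definition lat_sig :: "(op_sym, rel_sym) signature" where
  "lat_sig = \<lparr>opar = [Join \<mapsto> 2, Meet \<mapsto> 2, Zero \<mapsto> 0, One \<mapsto> 0], relar = Map.empty\<rparr>"

definition ord_sig :: "(op_sym, rel_sym) signature" where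
  "ord_sig = \<lparr>opar = Map.empty, relar = [Leq \<mapsto> 2]\<rparr>"

definition sig1 :: "(op_sym, rel_sym) signature" where
  "sig1 = \<lparr>opar = [Join \<mapsto> 2, Meet \<mapsto> 2, Neg \<mapsto> 1, Zero \<mapsto> 0, One \<mapsto> 0], relar = Map.empty\<rparr>"

definition sig2 :: "(op_sym, rel_sym) signature" where
  "sig2 = \<lparr>opar = [Shift \<mapsto> 1], relar = [Leq \<mapsto> 2]\<rparr>"

fun lat_op :: "op_sym \<Rightarrow> bool list \<Rightarrow> bool" where
  "lat_op Join [a, b] = (a \<or> b)"
| "lat_op Meet [a, b] = (a \<and> b)"
| "lat_op Zero [] = False"
| "lat_op One [] = True"
| "lat_op _ _ = undefined"

definition lat2 :: "(bool, op_sym, rel_sym) struct" where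
  "lat2 = \<lparr>carrier = UNIV, opn = lat_op, reln = (\<lambda>_. {})\<rparr>"

definition ord2 :: "(bool, op_sym, rel_sym) struct" where
  "ord2 = \<lparr>carrier = UNIV, opn = (\<lambda>_ _. undefined), reln = (\<lambda>_. {[a, b] | a b. a \<le> b})\<rparr>"

definition lat2_T :: "(bool, op_sym, rel_sym) tstruct" where
  "lat2_T = with_topo (discrete_topology UNIV) lat2"

definition ord2_T :: "(bool, op_sym, rel_sym) tstruct" where
  "ord2_T = with_topo (discrete_topology UNIV) ord2"

fun op1 :: "op_sym \<Rightarrow> (nat \<Rightarrow> bool) list \<Rightarrow> (nat \<Rightarrow> bool)" where
  "op1 Join [a, b] = (\<lambda>n. a n \<or> b n)"
| "op1 Meet [a, b] = (\<lambda>n. a n \<and> b n)"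
| "op1 Neg [a] = Not \<circ> a \<circ> Suc"
| "op1 Zero [] = (\<lambda>_. False)"
| "op1 One [] = (\<lambda>_. True)"
| "op1 _ _ = undefined"

fun op2 :: "op_sym \<Rightarrow> (nat \<Rightarrow> bool) list \<Rightarrow> (nat \<Rightarrow> bool)" where
  "op2 Shift [a] = a \<circ> Suc"
| "op2 _ _ = undefined"

definition le2 :: "(nat \<Rightarrow> bool) \<Rightarrow> (nat \<Rightarrow> bool) \<Rightarrow> bool" where
  "le2 a b \<longleftrightarrow> (\<forall>n. even n \<longrightarrow> a n \<le> b n) \<and> (\<forall>n. odd n \<longrightarrow> a n \<ge> b n)"

definition M1 :: "(nat \<Rightarrow> bool, op_sym, rel_sym) struct" where
  "M1 = \<lparr>carrier = UNIV, opn = op1, reln = (\<lambda>_. {})\<rparr>"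

definition M2 :: "(nat \<Rightarrow> bool, op_sym, rel_sym) struct" where
  "M2 = \<lparr>carrier = UNIV, opn = op2, reln = (\<lambda>_. {[a, b] | a b. le2 a b})\<rparr>"

definition cantor_topology :: "(nat \<Rightarrow> bool) topology" where
  "cantor_topology = product_topology (\<lambda>_. discrete_topology UNIV) UNIV"

definition M1_T :: "(nat \<Rightarrow> bool, op_sym, rel_sym) tstruct" where
  "M1_T = with_topo cantor_topology M1"

definition M2_T :: "(nat \<Rightarrow> bool, op_sym, rel_sym) tstruct" where
  "M2_T = with_topo cantor_topology M2"

definition omega :: "(nat \<Rightarrow> bool) \<Rightarrow> bool" where
  "omega a = a 0"

text \<open>Left composition with \<open>\<omega>\<close>, made extensional on \<open>A\<close> and on the hom-set \<open>H\<close>.\<close>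

definition omega_comp :: "'a set \<Rightarrow> ('a \<Rightarrow> nat \<Rightarrow> bool) set \<Rightarrow> ('a \<Rightarrow> nat \<Rightarrow> bool) \<Rightarrow> 'a \<Rightarrow> bool" where
  "omega_comp A H = (\<lambda>x \<in> H. \<lambda>a \<in> A. omega (x a))"

text \<open>Isomorphisms in a class of structures: both structures are required to belong to it.\<close>

definition iso_ISP :: "('f, 'r) signature \<Rightarrow> ('m, 'f, 'r) struct
    \<Rightarrow> ('a \<Rightarrow> 'b) \<Rightarrow> ('a, 'f, 'r) struct \<Rightarrow> ('b, 'f, 'r) struct \<Rightarrow> bool" where
  "iso_ISP \<Sigma> M \<phi> A B \<longleftrightarrow> A \<in> ISP \<Sigma> M \<and> B \<in> ISP \<Sigma> M \<and> siso \<Sigma> \<phi> A B"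

definition iso_IScP :: "('f, 'r) signature \<Rightarrow> ('m, 'f, 'r) tstruct
    \<Rightarrow> ('a \<Rightarrow> 'b) \<Rightarrow> ('a, 'f, 'r) tstruct \<Rightarrow> ('b, 'f, 'r) tstruct \<Rightarrow> bool" where
  "iso_IScP \<Sigma> M \<phi> X Y \<longleftrightarrow> X \<in> IScP \<Sigma> M \<and> Y \<in> IScP \<Sigma> M \<and> tiso \<Sigma> \<phi> X Y"

end

theory Submission
  imports Defs
begin

text \<open>
  A homomorphism \<open>h\<close> into \<^const>\<open>M1\<close> or \<^const>\<open>M2\<close> is determined by \<open>\<omega> \<circ> h\<close>, since the remaining
  coordinates of \<open>h a\<close> are read off from the values of \<open>\<omega> \<circ> h\<close> at the iterates of \<open>\<not>\<close> or \<open>u\<close> on \<open>a\<close>;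
  it is likewise ordered by \<open>\<omega> \<circ> h\<close>. Every claim thus reduces to finding a single two-valued map.
  Consider a compact space of points with a family of clopen predicates. Suppose that the points, or
  alternatively the predicates, form a bounded lattice compatible with evaluation. By compactness, a
  two-valued function of the predicates that respects their order and lattice structure is
  evaluation at a point, and dually a clopen predicate that respects the structure of the points
  belongs to the family. Taking hom-sets, or the topological structures themselves, as the spaces
  gives the surjectivity of both evaluation maps, the injectivity statements, and (as the case of
  an identity embedding) the surjectivity of composition with \<open>\<omega>\<close>.
\<close>

section \<open>Points and clopen predicates on compact spaces\<close>

text \<open>The alternating order \<open>le2\<close> is forced by negation: for a homomorphism
  \<open>h\<close> into \<open>M1\<close>, coordinate n + 1 at \<open>a\<close> is the complement of
  coordinate n at the negation of \<open>a\<close>, so a comparison of two homomorphisms reverses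
  each time the coordinate moves up by one. For \<open>M2\<close> the same step has no complement,
  and coordinate 0 controls the ordinary coordinatewise order instead. The obstacle is that
  membership in a generated class separates elements only at some coordinate n, whereas
  \<open>omega\<close> sees only coordinate 0. Hom-sets are closed under the operations of the alter
  ego, so n-fold shift or negation moves coordinate n to 0, in the second case up to the parity of
  n. Compactness takes the place of the prime ideal theorem. There are four problems, since either
  points or predicates may form the lattice and the unknown may be a point or a predicate. On finite
  sets evaluation is symmetric, and exchanging points and predicates leaves two. An unknown
  predicate is brought to finite sets by compactness of the square of the space, which makes it
  depend on finitely many members of the family.\<close>

text \<open>Meets and joins exist in \<open>I\<close> as seen by the valuations in \<open>Q\<close>:
  one witness \<open>k\<close> must serve every \<open>q\<close>, so each \<open>q\<close> acts as a
  bounded lattice homomorphism. Adding \<open>v\<close> to \<open>Q\<close> thereby says that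
  \<open>v\<close> is a homomorphism for the same operations. Points as well as predicates can take
  the place of \<open>I\<close>.\<close>

definition lattice_closed :: "'i set \<Rightarrow> ('i \<Rightarrow> bool) set \<Rightarrow> bool" where
  "lattice_closed I Q \<longleftrightarrow>
     (\<exists>i\<in>I. \<forall>q\<in>Q. q i) \<and> (\<exists>i\<in>I. \<forall>q\<in>Q. \<not> q i) \<and>
     (\<forall>i\<in>I. \<forall>j\<in>I. \<exists>k\<in>I. \<forall>q\<in>Q. q k = (q i \<and> q j)) \<and>
     (\<forall>i\<in>I. \<forall>j\<in>I. \<exists>k\<in>I. \<forall>q\<in>Q. q k = (q i \<or> q j))"

lemma lattice_closed_Meet:
  assumes I: "lattice_closed I Q" and J: "finite J" "J \<subseteq> I"
  shows "\<exists>k\<in>I. \<forall>q\<in>Q. q k = (\<forall>j\<in>J. q j)"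
  using J
proof (induction J)
  case empty
  then show ?case using I by (simp add: lattice_closed_def)
next
  case (insert i J)
  then obtain k where k: "k \<in> I" "\<forall>q\<in>Q. q k = (\<forall>j\<in>J. q j)" by auto
  have "\<exists>m\<in>I. \<forall>q\<in>Q. q m = (q i \<and> q k)"
    using I k(1) insert.prems by (simp add: lattice_closed_def)
  then show ?case using k(2) by auto
qed

lemma lattice_closed_Join:
  assumes I: "lattice_closed I Q" and J: "finite J" "J \<subseteq> I"
  shows "\<exists>k\<in>I. \<forall>q\<in>Q. q k = (\<exists>j\<in>J. q j)"
  using J
proof (induction J)
  case empty
  then show ?case using I by (simp add: lattice_closed_def)
next
  case (insert i J)
  then obtain k where k: "k \<in> I" "\<forall>q\<in>Q. q k = (\<exists>j\<in>J. q j)" by auto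
  have "\<exists>m\<in>I. \<forall>q\<in>Q. q m = (q i \<or> q k)"
    using I k(1) insert.prems by (simp add: lattice_closed_def)
  then show ?case using k(2) by auto
qed

text \<open>The meet \<open>k\<close> of the predicates true under \<open>v\<close> and the join
  \<open>l\<close> of those false under \<open>v\<close> satisfy \<open>v k\<close> and
  \<open>\<not> v l\<close>, because \<open>v\<close> obeys the same meets and joins. A single point
  separating \<open>k\<close> from \<open>l\<close> has all the prescribed values on
  \<open>J\<close>.\<close>

lemma finite_hom_is_point:
  assumes J: "finite J" "J \<subseteq> I" and I: "lattice_closed I (insert v ((\<lambda>x i. p i x) ` X))"
    and sep: "\<And>i j. i \<in> I \<Longrightarrow> j \<in> I \<Longrightarrow> v i \<Longrightarrow> \<not> v j \<Longrightarrow> \<exists>x\<in>X. p i x \<and> \<not> p j x"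
  shows "\<exists>x\<in>X. \<forall>i\<in>J. p i x = v i"
proof -
  obtain k where k: "k \<in> I" "v k" "\<forall>x\<in>X. p k x = (\<forall>j\<in>{j\<in>J. v j}. p j x)"
    using lattice_closed_Meet[OF I, of "{j\<in>J. v j}"] J by auto
  obtain l where l: "l \<in> I" "\<not> v l" "\<forall>x\<in>X. p l x = (\<exists>j\<in>{j\<in>J. \<not> v j}. p j x)"
    using lattice_closed_Join[OF I, of "{j\<in>J. \<not> v j}"] J by auto
  from sep[OF k(1) l(1) k(2) l(2)] k(3) l(3) show ?thesis by auto
qed

text \<open>Here the points are combined instead. For a true \<open>i\<close>, the meet over all
  false \<open>j\<close> of points separating \<open>i\<close> from \<open>j\<close> satisfies
  \<open>p i\<close> and no false predicate; the join of these points over all true \<open>i\<close>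
  has the prescribed values. About \<open>v\<close> only order information enters, through
  \<open>sep\<close>.\<close>

lemma finite_monotone_is_point:
  assumes J: "finite J" and X: "lattice_closed X (p ` J)"
    and sep: "\<And>i j. i \<in> J \<Longrightarrow> j \<in> J \<Longrightarrow> v i \<Longrightarrow> \<not> v j \<Longrightarrow> \<exists>x\<in>X. p i x \<and> \<not> p j x"
  shows "\<exists>x\<in>X. \<forall>i\<in>J. p i x = v i"
proof -
  let ?J1 = "{i\<in>J. v i}" and ?J0 = "{j\<in>J. \<not> v j}"
  obtain s where s: "\<And>i j. i \<in> ?J1 \<Longrightarrow> j \<in> ?J0 \<Longrightarrow> s i j \<in> X \<and> p i (s i j) \<and> \<not> p j (s i j)"
    using sep by simp metis
  have "\<exists>x\<in>X. p i x \<and> (\<forall>j\<in>?J0. \<not> p j x)" if i: "i \<in> ?J1" for i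
  proof -
    obtain x where "x \<in> X" "\<forall>q\<in>p ` J. q x = (\<forall>y\<in>s i ` ?J0. q y)"
      using lattice_closed_Meet[OF X, of "s i ` ?J0"] s[OF i] J by auto
    then show ?thesis using s[OF i] i by (intro bexI[of _ x]) auto
  qed
  then obtain t where t: "\<And>i. i \<in> ?J1 \<Longrightarrow> t i \<in> X \<and> p i (t i) \<and> (\<forall>j\<in>?J0. \<not> p j (t i))"
    by metis
  \<comment> \<open>If no predicate is to be true, this empty join is a bottom point; likewise the
    meet above is a top point when none is to be false.\<close>
  obtain x where x: "x \<in> X" "\<forall>q\<in>p ` J. q x = (\<exists>y\<in>t ` ?J1. q y)"
    using lattice_closed_Join[OF X, of "t ` ?J1"] t J by auto
  then show ?thesis using t by (intro bexI[of _ x]) auto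
qed

section \<open>Clopen predicates and compactness\<close>

text \<open>Phrasing clopenness as continuity lets composition with continuous maps transport
  predicates between spaces.\<close>

abbreviation clopen_pred :: "'x topology \<Rightarrow> ('x \<Rightarrow> bool) \<Rightarrow> bool" where
  "clopen_pred T p \<equiv> continuous_map T (discrete_topology UNIV) p"

lemma clopen_pred_iff:
  "clopen_pred T p \<longleftrightarrow> openin T {x \<in> topspace T. p x} \<and> openin T {x \<in> topspace T. \<not> p x}"
proof
  assume p: "clopen_pred T p"
  show "openin T {x \<in> topspace T. p x} \<and> openin T {x \<in> topspace T. \<not> p x}"
    using openin_continuous_map_preimage[OF p, of "{True}"]
      openin_continuous_map_preimage[OF p, of "{False}"] by simp
next
  assume o: "openin T {x \<in> topspace T. p x} \<and> openin T {x \<in> topspace T. \<not> p x}"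
  have "openin T {x \<in> topspace T. p x \<in> U}" for U
  proof -
    have "{x \<in> topspace T. p x \<in> U} =
        (if True \<in> U then {x \<in> topspace T. p x} else {}) \<union>
        (if False \<in> U then {x \<in> topspace T. \<not> p x} else {})"
      by (auto split: if_splits) (metis (full_types))+
    then show ?thesis using o by auto
  qed
  then show "clopen_pred T p" by (simp add: continuous_map_def)
qed

lemma clopen_pred_Not: "clopen_pred T p \<Longrightarrow> clopen_pred T (\<lambda>x. \<not> p x)"
  unfolding clopen_pred_iff by simp

lemma clopen_pred_conj:
  assumes "clopen_pred T p" "clopen_pred T q"
  shows "clopen_pred T (\<lambda>x. p x \<and> q x)"
proof -
  have "{x \<in> topspace T. p x \<and> q x} = {x \<in> topspace T. p x} \<inter> {x \<in> topspace T. q x}"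
    "{x \<in> topspace T. \<not> (p x \<and> q x)} = {x \<in> topspace T. \<not> p x} \<union> {x \<in> topspace T. \<not> q x}"
    by auto
  then show ?thesis using assms unfolding clopen_pred_iff by auto
qed

lemma clopen_pred_disj:
  assumes "clopen_pred T p" "clopen_pred T q"
  shows "clopen_pred T (\<lambda>x. p x \<or> q x)"
  using clopen_pred_Not[OF clopen_pred_conj[OF assms[THEN clopen_pred_Not]]] by simp

lemma closedin_clopen_pred:
  assumes "clopen_pred T p"
  shows "closedin T {x \<in> topspace T. p x = b}"
proof -
  have "topspace T - {x \<in> topspace T. p x = b} = {x \<in> topspace T. p x = (\<not> b)}" by auto
  then show ?thesis
    using assms unfolding closedin_def clopen_pred_iff by (cases b) auto
qed

text \<open>Each prescribed value cuts out a closed set, so values attainable on every finite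
  subfamily are attainable simultaneously by the finite intersection property.\<close>

lemma compact_common_point:
  assumes T: "compact_space T" and p: "\<And>i. i \<in> I \<Longrightarrow> clopen_pred T (p i)"
    and fin: "\<And>J. finite J \<Longrightarrow> J \<subseteq> I \<Longrightarrow> \<exists>x\<in>topspace T. \<forall>i\<in>J. p i x = v i"
  shows "\<exists>x\<in>topspace T. \<forall>i\<in>I. p i x = v i"
proof -
  define C where "C i = {x \<in> topspace T. p i x = v i}" for i
  \<comment> \<open>Including the whole space keeps the intersection inside
    \<open>topspace T\<close> even for empty \<open>I\<close>.\<close>
  have "\<Inter>(insert (topspace T) (C ` I)) \<noteq> {}"
  proof (rule compact_space_fip[THEN iffD1, OF T, rule_format], intro conjI ballI allI impI)
    fix D assume "D \<in> insert (topspace T) (C ` I)"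
    then show "closedin T D" using closedin_clopen_pred[OF p] by (auto simp: C_def)
  next
    fix F assume F: "finite F \<and> F \<subseteq> insert (topspace T) (C ` I)"
    \<comment> \<open>The whole space is set aside because it may not be of the form
      \<open>C j\<close>, while \<open>fin\<close> speaks of finite sets of indices.\<close>
    then have "finite (F - {topspace T})" "F - {topspace T} \<subseteq> C ` I" by auto
    then obtain J where J: "J \<subseteq> I" "finite J" "F - {topspace T} = C ` J"
      by (meson finite_subset_image)
    obtain x where "x \<in> topspace T" "\<forall>i\<in>J. p i x = v i" using fin[OF J(2,1)] by auto
    then have "x \<in> topspace T" "\<forall>D\<in>C ` J. x \<in> D" by (auto simp: C_def)
    then have "x \<in> D" if "D \<in> F" for D
      using that J(3) by (cases "D = topspace T") auto
    then have "x \<in> \<Inter>F" by blast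
    then show "\<Inter>F \<noteq> {}" by blast
  qed
  then show ?thesis by (auto simp: C_def)
qed

text \<open>Hypothesis \<open>sep\<close> is monotonicity in contrapositive form: if every point
  satisfying \<open>p i\<close> satisfies \<open>p j\<close>, then \<open>v i\<close> implies
  \<open>v j\<close>. This is the role usually played by the prime ideal theorem: \<open>v\<close>
  is realized on finite sets of predicates, hence on all of them.\<close>

lemma hom_is_point:
  assumes T: "compact_space T" and p: "\<And>i. i \<in> I \<Longrightarrow> clopen_pred T (p i)"
    and I: "lattice_closed I (insert v ((\<lambda>x i. p i x) ` topspace T))"
    and sep: "\<And>i j. i \<in> I \<Longrightarrow> j \<in> I \<Longrightarrow> v i \<Longrightarrow> \<not> v j \<Longrightarrow> \<exists>x\<in>topspace T. p i x \<and> \<not> p j x"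
  shows "\<exists>x\<in>topspace T. \<forall>i\<in>I. p i x = v i"
proof (rule compact_common_point[OF T p])
  fix J assume J: "finite J" "J \<subseteq> I"
  show "\<exists>x\<in>topspace T. \<forall>i\<in>J. p i x = v i"
    by (rule finite_hom_is_point[OF J I sep])
qed

lemma lattice_closed_mono:
  assumes I: "lattice_closed I Q" and Q: "Q' \<subseteq> Q"
  shows "lattice_closed I Q'"
proof -
  have *: "\<exists>k\<in>I. \<forall>q\<in>Q'. R q k" if "\<exists>k\<in>I. \<forall>q\<in>Q. R q k" for R
    using that Q by blast
  show ?thesis
    using I unfolding lattice_closed_def by (intro conjI ballI *) simp_all
qed

text \<open>Compactness glues the finite solutions. The index set carries no operations, as befits
  predicates that are merely ordered.\<close>

lemma monotone_is_point:
  assumes T: "compact_space T" and p: "\<And>i. i \<in> I \<Longrightarrow> clopen_pred T (p i)"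
    and X: "lattice_closed (topspace T) (p ` I)"
    and sep: "\<And>i j. i \<in> I \<Longrightarrow> j \<in> I \<Longrightarrow> v i \<Longrightarrow> \<not> v j \<Longrightarrow> \<exists>x\<in>topspace T. p i x \<and> \<not> p j x"
  shows "\<exists>x\<in>topspace T. \<forall>i\<in>I. p i x = v i"
proof (rule compact_common_point[OF T p])
  fix J assume J: "finite J" "J \<subseteq> I"
  show "\<exists>x\<in>topspace T. \<forall>i\<in>J. p i x = v i"
  proof (rule finite_monotone_is_point[OF J(1) lattice_closed_mono[OF X image_mono[OF J(2)]]])
    fix i j assume "i \<in> J" "j \<in> J" "v i" "\<not> v j"
    then show "\<exists>x\<in>topspace T. p i x \<and> \<not> p j x" using J(2) sep by blast
  qed
qed

text \<open>Its use is that \<open>f\<close> becomes a function of finitely many bits: points with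
  the same values under all \<open>p i\<close> with \<open>i \<in> K\<close> have the same value
  under \<open>f\<close>.\<close>

lemma finite_separating_subfamily:
  assumes T: "compact_space T" and p: "\<And>i. i \<in> I \<Longrightarrow> clopen_pred T (p i)"
    and f: "clopen_pred T f"
    and sep: "\<And>x y. x \<in> topspace T \<Longrightarrow> y \<in> topspace T \<Longrightarrow> f x \<Longrightarrow> \<not> f y \<Longrightarrow> \<exists>i\<in>I. p i x \<and> \<not> p i y"
  shows "\<exists>K. finite K \<and> K \<subseteq> I \<and>
    (\<forall>x\<in>topspace T. \<forall>y\<in>topspace T. f x \<and> \<not> f y \<longrightarrow> (\<exists>i\<in>K. p i x \<and> \<not> p i y))"
proof (rule ccontr)
  assume no: "\<not> ?thesis"
  \<comment> \<open>By compactness of the square, some pair \<open>(x, y)\<close> with \<open>f x\<close> and \<open>\<not> f y\<close> is separated by no \<open>p i\<close>.\<close>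
  let ?T = "prod_topology T T"
  \<comment> \<open>The index \<open>None\<close> carries the demand that \<open>f\<close> separate
    the two coordinates, and \<open>Some i\<close> the demand that \<open>p i\<close> not do so;
    both are the prescribed value \<open>i = None\<close>.\<close>
  define P where "P = (\<lambda>i z. case i of None \<Rightarrow> f (fst z) \<and> \<not> f (snd z)
    | Some i \<Rightarrow> p i (fst z) \<and> \<not> p i (snd z))"
  have cl: "clopen_pred ?T (\<lambda>z. q (fst z) \<and> \<not> q (snd z))" if "clopen_pred T q" for q
    by (intro clopen_pred_conj clopen_pred_Not)
      (use continuous_map_compose[OF continuous_map_fst that]
           continuous_map_compose[OF continuous_map_snd that] in \<open>auto simp: o_def\<close>)
  have "\<exists>z\<in>topspace ?T. \<forall>i\<in>insert None (Some ` I). P i z = (i = None)"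
  proof (rule compact_common_point)
    show "compact_space ?T" using T by (simp add: compact_space_prod_topology)
    show "clopen_pred ?T (P i)" if "i \<in> insert None (Some ` I)" for i
    proof (cases i)
      case None
      then show ?thesis using cl[OF f] by (simp add: P_def)
    next
      case (Some k)
      then have "clopen_pred T (p k)" using that p by blast
      then show ?thesis using cl Some by (simp add: P_def)
    qed
    fix J assume J: "finite J" "J \<subseteq> insert None (Some ` I)"
    let ?K = "Some -` J"
    have "finite ?K" "?K \<subseteq> I" using J by (auto intro: finite_vimageI)
    then have "\<not> (\<forall>x\<in>topspace T. \<forall>y\<in>topspace T.
        f x \<and> \<not> f y \<longrightarrow> (\<exists>i\<in>?K. p i x \<and> \<not> p i y))"
      using no by (simp only: not_ex) metis
    then obtain x y where "x \<in> topspace T" "y \<in> topspace T" "f x" "\<not> f y"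
      "\<forall>i\<in>?K. \<not> (p i x \<and> \<not> p i y)" by auto
    then show "\<exists>z\<in>topspace ?T. \<forall>i\<in>J. P i z = (i = None)"
      by (intro bexI[of _ "(x, y)"]) (auto simp: P_def split: option.split)
  qed
  then obtain x y where "x \<in> topspace T" "y \<in> topspace T" "f x" "\<not> f y"
    "\<forall>i\<in>I. \<not> (p i x \<and> \<not> p i y)" by (auto simp: P_def)
  then show False using sep by blast
qed

text \<open>Finitely many predicates produce finitely many truth-value patterns; one point is chosen
  for each pattern that occurs.\<close>

lemma finite_representatives:
  assumes "finite K"
  shows "\<exists>X0. finite X0 \<and> X0 \<subseteq> X \<and>
    (\<forall>x\<in>X. \<exists>y\<in>X0. f x = (f y :: bool) \<and> (\<forall>k\<in>K. p k x = (p k y :: bool)))"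
proof -
  \<comment> \<open>Restriction to \<open>K\<close> places the patterns in a finite set of
    extensional functions.\<close>
  let ?c = "\<lambda>x. (f x, \<lambda>k\<in>K. p k x)"
  have "?c ` X \<subseteq> UNIV \<times> (K \<rightarrow>\<^sub>E UNIV)" by auto
  moreover have "finite (UNIV \<times> (K \<rightarrow>\<^sub>E (UNIV :: bool set)) :: (bool \<times> _) set)"
    using assms by (intro finite_cartesian_product finite_PiE) auto
  ultimately have "finite (?c ` X)" by (rule finite_subset)
  then obtain X0 where X0: "X0 \<subseteq> X" "finite X0" "?c ` X = ?c ` X0"
    by (meson finite_subset_image subset_refl)
  have "\<exists>y\<in>X0. f x = f y \<and> (\<forall>k\<in>K. p k x = p k y)" if "x \<in> X" for x
  proof -
    have "?c x \<in> ?c ` X0" using X0(3) that by blast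
    then obtain y where "y \<in> X0" and y: "?c x = ?c y" by blast
    moreover have "p k x = p k y" if "k \<in> K" for k
      using y that unfolding prod.inject by (metis restrict_apply')
    ultimately show ?thesis by auto
  qed
  then show ?thesis using X0 by blast
qed

text \<open>Points and predicates exchange roles: members of \<open>X0\<close> act as predicates on
  \<open>I\<close>, and \<open>f\<close> is the monotone function to be realized by some
  \<open>i\<close>. Agreement on \<open>X0\<close> alone would not control the other points, since
  members of \<open>I\<close> may distinguish points that all of \<open>K\<close> identifies; hence
  the restriction by \<open>inv\<close>. Members of \<open>K\<close> satisfy \<open>inv\<close>, so
  separation survives.\<close>

lemma monotone_in_lattice:
  assumes T: "compact_space T" and p: "\<And>i. i \<in> I \<Longrightarrow> clopen_pred T (p i)"
    and f: "clopen_pred T f"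
    and I: "lattice_closed I ((\<lambda>x i. p i x) ` topspace T)"
    and sep: "\<And>x y. x \<in> topspace T \<Longrightarrow> y \<in> topspace T \<Longrightarrow> f x \<Longrightarrow> \<not> f y \<Longrightarrow> \<exists>i\<in>I. p i x \<and> \<not> p i y"
  shows "\<exists>i\<in>I. \<forall>x\<in>topspace T. p i x = f x"
proof -
  let ?X = "topspace T"
  obtain K where K: "finite K" "K \<subseteq> I"
    "\<And>x y. x \<in> ?X \<Longrightarrow> y \<in> ?X \<Longrightarrow> f x \<Longrightarrow> \<not> f y \<Longrightarrow> \<exists>i\<in>K. p i x \<and> \<not> p i y"
    using finite_separating_subfamily[of T I p f, OF T p f sep] by blast
  obtain X0 where X0: "finite X0" "X0 \<subseteq> ?X"
    "\<And>x. x \<in> ?X \<Longrightarrow> \<exists>y\<in>X0. f x = f y \<and> (\<forall>k\<in>K. p k x = p k y)"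
    using finite_representatives[OF K(1), of ?X f p] by blast
  define same where "same x y \<longleftrightarrow> (\<forall>k\<in>K. p k x = p k y)" for x y
  define inv where "inv i \<longleftrightarrow> (\<forall>x\<in>?X. \<forall>y\<in>?X. same x y \<longrightarrow> p i x = p i y)" for i
  have invD: "p i x = p i y" if "inv i" "x \<in> ?X" "y \<in> ?X" "same x y" for i x y
    using that unfolding inv_def by blast
  \<comment> \<open>In the sublattice \<open>?I\<close>, agreement with \<open>f\<close> on the finite set \<open>X0\<close> implies agreement everywhere.\<close>
  let ?I = "{i\<in>I. inv i}"
  have "lattice_closed ?I ((\<lambda>x i. p i x) ` ?X)"
  proof -
    have top: "\<exists>i\<in>I. \<forall>x\<in>?X. p i x" and bot: "\<exists>i\<in>I. \<forall>x\<in>?X. \<not> p i x"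
      and meet: "\<forall>i\<in>I. \<forall>j\<in>I. \<exists>k\<in>I. \<forall>x\<in>?X. p k x = (p i x \<and> p j x)"
      and join: "\<forall>i\<in>I. \<forall>j\<in>I. \<exists>k\<in>I. \<forall>x\<in>?X. p k x = (p i x \<or> p j x)"
      using I by (simp_all add: lattice_closed_def)
    have "\<exists>k\<in>?I. \<forall>x\<in>?X. p k x = (p i x \<and> p j x)" if ij: "i \<in> ?I" "j \<in> ?I" for i j
    proof -
      have ij': "i \<in> I" "j \<in> I" using ij by simp_all
      obtain k where k: "k \<in> I" "\<forall>x\<in>?X. p k x = (p i x \<and> p j x)"
        using bspec[OF bspec[OF meet ij'(1)] ij'(2)] by (elim bexE) (rule that)
      have "inv k"
        unfolding inv_def
      proof (intro ballI impI)
        fix x y assume xy: "x \<in> ?X" "y \<in> ?X" "same x y"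
        then show "p k x = p k y"
          using ij invD[of i x y] invD[of j x y] k(2) by (simp only: mem_Collect_eq simp_thms)
      qed
      then show ?thesis using k by (intro bexI[of _ k]) simp_all
    qed
    moreover have "\<exists>k\<in>?I. \<forall>x\<in>?X. p k x = (p i x \<or> p j x)" if ij: "i \<in> ?I" "j \<in> ?I" for i j
    proof -
      have ij': "i \<in> I" "j \<in> I" using ij by simp_all
      obtain k where k: "k \<in> I" "\<forall>x\<in>?X. p k x = (p i x \<or> p j x)"
        using bspec[OF bspec[OF join ij'(1)] ij'(2)] by (elim bexE) (rule that)
      have "inv k"
        unfolding inv_def
      proof (intro ballI impI)
        fix x y assume xy: "x \<in> ?X" "y \<in> ?X" "same x y"
        then show "p k x = p k y"
          using ij invD[of i x y] invD[of j x y] k(2) by (simp only: mem_Collect_eq simp_thms)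
      qed
      then show ?thesis using k by (intro bexI[of _ k]) simp_all
    qed
    moreover obtain t where "t \<in> I" "\<forall>x\<in>?X. p t x" using top by blast
    then have "\<exists>k\<in>?I. \<forall>x\<in>?X. p k x" by (intro bexI[of _ t]) (simp_all add: inv_def)
    moreover obtain b where "b \<in> I" "\<forall>x\<in>?X. \<not> p b x" using bot by blast
    then have "\<exists>k\<in>?I. \<forall>x\<in>?X. \<not> p k x" by (intro bexI[of _ b]) (simp_all add: inv_def)
    ultimately show ?thesis unfolding lattice_closed_def ball_simps(9) by (intro conjI ballI)
  qed
  then have L: "lattice_closed ?I ((\<lambda>x i. p i x) ` X0)"
    by (rule lattice_closed_mono[OF _ image_mono[OF X0(2)]])
  have KI: "K \<subseteq> ?I" using K(2) by (auto simp: inv_def same_def)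
  have "\<exists>i\<in>?I. \<forall>x\<in>X0. p i x = f x"
  proof (rule finite_monotone_is_point[OF X0(1) L])
    fix x y assume "x \<in> X0" "y \<in> X0" "f x" "\<not> f y"
    then show "\<exists>i\<in>?I. p i x \<and> \<not> p i y" using K(3)[of x y] X0(2) KI by (meson subsetD)
  qed
  then obtain i where i: "i \<in> ?I" "\<forall>x\<in>X0. p i x = f x" by blast
  have "p i x = f x" if x: "x \<in> ?X" for x
  proof -
    obtain y where y: "y \<in> X0" "f x = f y" "same x y" using X0(3)[OF x] by (auto simp: same_def)
    then have "y \<in> ?X" using X0(2) by blast
    then show ?thesis using invD[OF _ x _ y(3), of i] y i by simp
  qed
  then show ?thesis using i by blast
qed

text \<open>With points and predicates exchanged, \<open>f\<close> is a homomorphism on the lattice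
  of points, so its values on \<open>X0\<close> are realized by a member of the finite family
  \<open>K\<close> itself. As \<open>X0\<close> represents all joint patterns of \<open>f\<close>
  and \<open>K\<close>, this member agrees with \<open>f\<close> everywhere.\<close>

lemma hom_in_family:
  assumes T: "compact_space T" and p: "\<And>i. i \<in> I \<Longrightarrow> clopen_pred T (p i)"
    and f: "clopen_pred T f"
    and X: "lattice_closed (topspace T) (insert f (p ` I))"
    and sep: "\<And>x y. x \<in> topspace T \<Longrightarrow> y \<in> topspace T \<Longrightarrow> f x \<Longrightarrow> \<not> f y \<Longrightarrow> \<exists>i\<in>I. p i x \<and> \<not> p i y"
  shows "\<exists>i\<in>I. \<forall>x\<in>topspace T. p i x = f x"
proof -
  let ?X = "topspace T"
  obtain K where K: "finite K" "K \<subseteq> I"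
    "\<And>x y. x \<in> ?X \<Longrightarrow> y \<in> ?X \<Longrightarrow> f x \<Longrightarrow> \<not> f y \<Longrightarrow> \<exists>i\<in>K. p i x \<and> \<not> p i y"
    using finite_separating_subfamily[of T I p f, OF T p f sep] by blast
  obtain X0 where X0: "finite X0" "X0 \<subseteq> ?X"
    "\<And>x. x \<in> ?X \<Longrightarrow> \<exists>y\<in>X0. f x = f y \<and> (\<forall>k\<in>K. p k x = p k y)"
    using finite_representatives[OF K(1), of ?X f p] by blast
  have "lattice_closed ?X (insert f (p ` K))"
    by (rule lattice_closed_mono[OF X]) (use K(2) in auto)
  then have "\<exists>i\<in>K. \<forall>x\<in>X0. p i x = f x"
    using finite_hom_is_point[OF X0(1,2), of f "\<lambda>x i. p i x" K] K(3) by auto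
  then obtain i where i: "i \<in> K" "\<forall>x\<in>X0. p i x = f x" by blast
  have "p i x = f x" if "x \<in> ?X" for x
    using X0(3)[OF that] i by auto
  then show ?thesis using i K(2) by blast
qed

section \<open>Structures in the generated classes\<close>

lemma opn_pow: "opn (pow \<Sigma> M S) f gs = (\<lambda>s\<in>S. opn M f (map (\<lambda>g. g s) gs))"
  by (simp add: pow_def)

lemma carrier_pow: "carrier (pow \<Sigma> M S) = S \<rightarrow>\<^sub>E carrier M"
  by (simp add: pow_def)

lemma reln_pow:
  "relar \<Sigma> r = Some n \<Longrightarrow> gs \<in> reln (pow \<Sigma> M S) r \<longleftrightarrow>
     gs \<in> tuples (S \<rightarrow>\<^sub>E carrier M) n \<and> (\<forall>s\<in>S. map (\<lambda>g. g s) gs \<in> reln M r)"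
  by (simp add: pow_def)

lemma shom_carrier: "\<phi> \<in> shom \<Sigma> A B \<Longrightarrow> a \<in> carrier A \<Longrightarrow> \<phi> a \<in> carrier B"
  by (auto simp: shom_def)

lemma shom_extensional: "\<phi> \<in> shom \<Sigma> A B \<Longrightarrow> \<phi> \<in> extensional (carrier A)"
  by (simp add: shom_def PiE_iff)

lemma shom_subset_PiE: "shom \<Sigma> A B \<subseteq> carrier A \<rightarrow>\<^sub>E carrier B"
  by (auto simp: shom_def)

lemma shom_eqI:
  assumes "\<phi> \<in> shom \<Sigma> A B" "\<psi> \<in> shom \<Sigma> A B" "\<And>a. a \<in> carrier A \<Longrightarrow> \<phi> a = \<psi> a"
  shows "\<phi> = \<psi>"
  using extensionalityI[OF assms(1,2)[THEN shom_extensional]] assms(3) by blast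

lemma map_tuples: "xs \<in> tuples A n \<Longrightarrow> (\<And>a. a \<in> A \<Longrightarrow> f a \<in> B) \<Longrightarrow> map f xs \<in> tuples B n"
  by (auto simp: tuples_def)

lemma tuples_memD: "xs \<in> tuples A n \<Longrightarrow> x \<in> set xs \<Longrightarrow> x \<in> A"
  by (auto simp: tuples_def)

lemma is_structure_sub_pow:
  assumes "is_sub \<Sigma> C (pow \<Sigma> M S)"
  shows "is_structure \<Sigma> (sub (pow \<Sigma> M S) C)"
  using assms by (auto simp: is_structure_def is_sub_def reln_pow tuples_def)

lemma shom_compose:
  assumes A: "is_structure \<Sigma> A" and \<phi>: "\<phi> \<in> shom \<Sigma> A B" and \<psi>: "\<psi> \<in> shom \<Sigma> B C"
  shows "(\<lambda>a\<in>carrier A. \<psi> (\<phi> a)) \<in> shom \<Sigma> A C"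
proof -
  have mp: "map (\<lambda>a\<in>carrier A. \<psi> (\<phi> a)) xs = map \<psi> (map \<phi> xs)" if "xs \<in> tuples (carrier A) n" for xs n
    using that by (auto simp: tuples_def)
  show ?thesis
  proof (rule shomI)
    fix f n xs assume f: "opar \<Sigma> f = Some n" and xs: "xs \<in> tuples (carrier A) n"
    have "map \<phi> xs \<in> tuples (carrier B) n" using xs shom_carrier[OF \<phi>] by (rule map_tuples)
    then show "(\<lambda>a\<in>carrier A. \<psi> (\<phi> a)) (opn A f xs) = opn C f (map (\<lambda>a\<in>carrier A. \<psi> (\<phi> a)) xs)"
      using is_structure_op[OF A f xs] shom_op[OF \<phi> f xs] shom_op[OF \<psi> f] mp[OF xs]
      by (simp del: map_map)
  next
    fix r n xs assume r: "relar \<Sigma> r = Some n" and xs: "xs \<in> reln A r"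
    show "map (\<lambda>a\<in>carrier A. \<psi> (\<phi> a)) xs \<in> reln C r"
      unfolding mp[OF is_structure_rel[OF A r xs]] by (intro shom_rel[OF \<psi> r] shom_rel[OF \<phi> r] xs)
  qed (use shom_carrier[OF \<phi>] shom_carrier[OF \<psi>] in auto)
qed

text \<open>The universal property of the power. Through it, an operation of an alter ego, being a
  homomorphism out of a power, can be applied to several homomorphisms at once.\<close>

lemma shom_tuple:
  assumes A: "is_structure \<Sigma> A" and h: "\<And>s. s \<in> S \<Longrightarrow> h s \<in> shom \<Sigma> A M"
  shows "(\<lambda>a\<in>carrier A. \<lambda>s\<in>S. h s a) \<in> shom \<Sigma> A (pow \<Sigma> M S)" (is "?t \<in> _")
proof -
  have mp: "map (\<lambda>g. g s) (map ?t xs) = map (h s) xs" if "xs \<in> tuples (carrier A) n" "s \<in> S" for xs n s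
    using that by (auto simp: tuples_def)
  show ?thesis
  proof (rule shomI)
    fix f n xs assume f: "opar \<Sigma> f = Some n" and xs: "xs \<in> tuples (carrier A) n"
    show "?t (opn A f xs) = opn (pow \<Sigma> M S) f (map ?t xs)"
      unfolding opn_pow using is_structure_op[OF A f xs] mp[OF xs] shom_op[OF h f xs]
      by (auto simp del: map_map simp: fun_eq_iff)
  next
    fix r n xs assume r: "relar \<Sigma> r = Some n" and xs: "xs \<in> reln A r"
    have xs': "xs \<in> tuples (carrier A) n" by (rule is_structure_rel[OF A r xs])
    have "map ?t xs \<in> tuples (S \<rightarrow>\<^sub>E carrier M) n"
      by (rule map_tuples[OF xs']) (use shom_carrier[OF h] in auto)
    then show "map ?t xs \<in> reln (pow \<Sigma> M S) r"
      unfolding reln_pow[OF r] using mp[OF xs'] shom_rel[OF h r xs] by (simp del: map_map)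
  qed (use shom_carrier[OF h] in \<open>auto simp: carrier_pow\<close>)
qed

lemma shom_eval:
  assumes H: "is_sub \<Sigma> H (pow \<Sigma> M S)" and s: "s \<in> S"
  shows "(\<lambda>h\<in>H. h s) \<in> shom \<Sigma> (sub (pow \<Sigma> M S) H) M" (is "?e \<in> _")
proof -
  have mp: "map ?e xs = map (\<lambda>g. g s) xs" if "xs \<in> tuples H n" for xs n
    using that by (auto simp: tuples_def)
  show ?thesis
  proof (rule shomI)
    show "?e a \<in> carrier M" if "a \<in> carrier (sub (pow \<Sigma> M S) H)" for a
      using that H s by (auto simp: is_sub_def carrier_pow)
    fix f n xs assume f: "opar \<Sigma> f = Some n" and xs: "xs \<in> tuples (carrier (sub (pow \<Sigma> M S) H)) n"
    then have "opn (pow \<Sigma> M S) f xs \<in> H" using H by (auto simp: is_sub_def)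
    then show "?e (opn (sub (pow \<Sigma> M S) H) f xs) = opn M f (map ?e xs)"
      using mp[of xs n] xs s by (simp add: opn_pow del: map_eq_conv)
  next
    fix r n xs assume r: "relar \<Sigma> r = Some n" and xs: "xs \<in> reln (sub (pow \<Sigma> M S) H) r"
    then have "xs \<in> tuples H n" by (auto simp: reln_pow tuples_def)
    then show "map ?e xs \<in> reln M r" using mp[of xs n] xs s by (simp add: reln_pow[OF r] del: map_eq_conv)
  qed auto
qed

subsection \<open>Evaluation of members of the classes\<close>

lemma siso_eval_separates:
  assumes \<phi>: "siso \<Sigma> (\<lambda>a\<in>carrier A. \<lambda>h\<in>H. h a) A B" and ab: "a \<in> carrier A" "b \<in> carrier A"
    and eq: "\<And>h. h \<in> H \<Longrightarrow> h a = h b"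
  shows "a = b"
proof -
  have "(\<lambda>h\<in>H. h a) = (\<lambda>h\<in>H. h b)" using eq by auto
  then show ?thesis using \<phi> ab unfolding siso_def by (metis restrict_apply')
qed

text \<open>Relations in a power are tested coordinatewise, and the inverse of evaluation, being a
  homomorphism, brings them back to \<open>A\<close>.\<close>

lemma siso_eval_reflects:
  assumes \<phi>: "siso \<Sigma> (\<lambda>a\<in>carrier A. \<lambda>h\<in>H. h a) A (sub (pow \<Sigma> M H) C)" (is "siso \<Sigma> ?\<phi> _ _")
    and H: "H \<subseteq> shom \<Sigma> A M"
    and r: "relar \<Sigma> r = Some n" and xs: "xs \<in> tuples (carrier A) n"
    and rel: "\<And>h. h \<in> H \<Longrightarrow> map h xs \<in> reln M r"
  shows "xs \<in> reln A r"
proof -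
  from \<phi> obtain \<eta> where \<phi>h: "?\<phi> \<in> shom \<Sigma> A (sub (pow \<Sigma> M H) C)"
    and \<eta>: "\<eta> \<in> shom \<Sigma> (sub (pow \<Sigma> M H) C) A" "\<And>a. a \<in> carrier A \<Longrightarrow> \<eta> (?\<phi> a) = a"
    unfolding siso_def by blast
  have "map (\<lambda>g. g h) (map ?\<phi> xs) = map h xs" if "h \<in> H" for h
    using that xs by (auto simp: tuples_def)
  moreover have "map ?\<phi> xs \<in> tuples (H \<rightarrow>\<^sub>E carrier M) n"
    by (rule map_tuples[OF xs]) (use H shom_carrier[of _ \<Sigma> A M] in \<open>auto simp: PiE_iff\<close>)
  moreover have "map ?\<phi> xs \<in> tuples C n"
    by (rule map_tuples[OF xs]) (use shom_carrier[OF \<phi>h] in auto)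
  ultimately have "map ?\<phi> xs \<in> reln (sub (pow \<Sigma> M H) C) r"
    using rel unfolding reln_sub Int_iff reln_pow[OF r] in_lists_conv_set
    by (auto dest: tuples_memD simp del: map_map set_map)
  then have "map \<eta> (map ?\<phi> xs) \<in> reln A r" by (rule shom_rel[OF \<eta>(1) r])
  also have "map \<eta> (map ?\<phi> xs) = map (\<lambda>a. a) xs"
    unfolding map_map by (rule map_cong[OF refl]) (use \<eta>(2) tuples_memD[OF xs] in auto)
  finally show ?thesis by simp
qed

lemma ISP_is_structure: "A \<in> ISP \<Sigma> M \<Longrightarrow> is_structure \<Sigma> A"
  and ISP_nonempty: "A \<in> ISP \<Sigma> M \<Longrightarrow> carrier A \<noteq> {}"
  by (auto simp: ISP_def total_structure_def)

text \<open>All coordinates of the embedding promised by the class are homomorphisms into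
  \<open>M\<close>, so evaluation at every homomorphism is an embedding as well. What a duality adds
  for \<open>A\<close> is that the image is the whole bidual.\<close>

lemma siso_evalA_image:
  fixes A :: "('a, 'f, 'r) struct" and M :: "('m, 'f, 'r) struct"
  assumes A: "A \<in> ISP \<Sigma> M"
  shows "siso \<Sigma> (evalA \<Sigma> M A) A (sub (pow \<Sigma> M (shom \<Sigma> A M)) (evalA \<Sigma> M A ` carrier A))"
proof -
  obtain S :: "('a \<Rightarrow> 'm) set" and \<phi> C where C: "is_sub \<Sigma> C (pow \<Sigma> M S)"
    and \<phi>: "siso \<Sigma> \<phi> A (sub (pow \<Sigma> M S) C)"
    using A by (auto simp: ISP_def semb_def)
  have Cs: "C \<subseteq> carrier (pow \<Sigma> M S)" using C by (simp add: is_sub_def)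
  have SH: "(\<lambda>a\<in>carrier A. \<phi> a s) \<in> shom \<Sigma> A M" if "s \<in> S" for s
    using shom_proj[OF _ Cs ISP_is_structure[OF A] that] \<phi> by (simp add: siso_def)
  note * = siso_eval[OF ISP_is_structure[OF A] \<phi> Cs subset_refl SH]
  show ?thesis
    unfolding siso_def evalA_def carrier_sub
    using *(3,4) restrict_inv_into[OF *(1)] by blast
qed

lemma ISP_separates:
  assumes "A \<in> ISP \<Sigma> M" "a \<in> carrier A" "b \<in> carrier A" "\<And>h. h \<in> shom \<Sigma> A M \<Longrightarrow> h a = h b"
  shows "a = b"
  using siso_eval_separates[OF siso_evalA_image[OF assms(1), unfolded evalA_def]] assms(2-) by blast

lemma ISP_reflects:
  assumes "A \<in> ISP \<Sigma> M" "relar \<Sigma> r = Some n" "xs \<in> tuples (carrier A) n"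
    "\<And>h. h \<in> shom \<Sigma> A M \<Longrightarrow> map h xs \<in> reln M r"
  shows "xs \<in> reln A r"
  using siso_eval_reflects[OF siso_evalA_image[OF assms(1), unfolded evalA_def] subset_refl] assms(2-)
  by blast

lemma IScP_is_structure: "X \<in> IScP \<Sigma> M \<Longrightarrow> is_structure \<Sigma> X"
  and IScP_topspace: "X \<in> IScP \<Sigma> M \<Longrightarrow> topspace (topo X) = carrier X"
  by (auto simp: IScP_def is_tstructure_def)

lemma thom_subset_shom: "thom \<Sigma> X Y \<subseteq> shom \<Sigma> X Y"
  by (auto simp: thom_def)

text \<open>Coordinates of a topological embedding are continuous homomorphisms. Nonemptiness of
  \<open>S\<close> is kept because it provides a morphism into \<open>M\<close> even when
  \<open>X\<close> is empty.\<close>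

lemma IScP_coordinates:
  fixes X :: "('a, 'f, 'r) tstruct" and M :: "('m, 'f, 'r) tstruct"
  assumes X: "X \<in> IScP \<Sigma> M"
  obtains S :: "('a \<Rightarrow> 'm) set" and \<phi> C where "S \<noteq> {}" "C \<subseteq> carrier (pow \<Sigma> M S)"
    "siso \<Sigma> \<phi> X (sub (pow \<Sigma> M S) C)" "\<And>s. s \<in> S \<Longrightarrow> (\<lambda>a\<in>carrier X. \<phi> a s) \<in> thom \<Sigma> X M"
proof -
  obtain S :: "('a \<Rightarrow> 'm) set" and \<phi> C where S: "S \<noteq> {}" and C: "is_sub \<Sigma> C (pow \<Sigma> M S)"
    and \<phi>: "\<phi> \<in> thom \<Sigma> X (tsub (tpow \<Sigma> M S) C)" and \<phi>': "siso \<Sigma> \<phi> X (sub (pow \<Sigma> M S) C)"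
    using X by (auto simp: IScP_def temb_def tiso_def siso_def thom_def shom_tsub_tpow is_sub_tpow)
  have Cs: "C \<subseteq> carrier (pow \<Sigma> M S)" using C by (simp add: is_sub_def)
  have "(\<lambda>a\<in>carrier X. \<phi> a s) \<in> thom \<Sigma> X M" if s: "s \<in> S" for s
  proof -
    have "(\<lambda>a\<in>carrier X. \<phi> a s) \<in> shom \<Sigma> X M"
      using shom_proj[OF _ Cs IScP_is_structure[OF X] s] \<phi>' by (simp add: siso_def)
    moreover have "continuous_map (topo X) (topo M) (\<lambda>a. \<phi> a s)"
      using \<phi> s by (auto simp: thom_def continuous_map_in_subtopology continuous_map_componentwise)
    then have "continuous_map (topo X) (topo M) (\<lambda>a\<in>carrier X. \<phi> a s)"
      by (rule continuous_map_eq) (simp add: IScP_topspace[OF X])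
    ultimately show ?thesis by (simp add: thom_def)
  qed
  then show thesis using that S Cs \<phi>' by blast
qed

lemma IScP_thom_nonempty: "X \<in> IScP \<Sigma> M \<Longrightarrow> thom \<Sigma> X M \<noteq> {}"
  by (elim IScP_coordinates) blast

lemma siso_evalX_image:
  assumes X: "X \<in> IScP \<Sigma> M"
  shows "siso \<Sigma> (evalX \<Sigma> M X) X (sub (pow \<Sigma> M (thom \<Sigma> X M)) (evalX \<Sigma> M X ` carrier X))"
  using X
proof (rule IScP_coordinates)
  fix S :: "('a \<Rightarrow> 'd) set" and \<phi> C assume C: "C \<subseteq> carrier (pow \<Sigma> M S)"
    and \<phi>: "siso \<Sigma> \<phi> X (sub (pow \<Sigma> M S) C)" and SH: "\<And>s. s \<in> S \<Longrightarrow> (\<lambda>a\<in>carrier X. \<phi> a s) \<in> thom \<Sigma> X M"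
  note * = siso_eval[OF IScP_is_structure[OF X] \<phi> C thom_subset_shom SH]
  show ?thesis
    unfolding siso_def evalX_def carrier_sub
    using *(3,4) restrict_inv_into[OF *(1)] by blast
qed

lemma IScP_separates:
  assumes "X \<in> IScP \<Sigma> M" "a \<in> carrier X" "b \<in> carrier X" "\<And>h. h \<in> thom \<Sigma> X M \<Longrightarrow> h a = h b"
  shows "a = b"
  using siso_eval_separates[OF siso_evalX_image[OF assms(1), unfolded evalX_def]] assms(2-) by blast

lemma IScP_reflects:
  assumes "X \<in> IScP \<Sigma> M" "relar \<Sigma> r = Some n" "xs \<in> tuples (carrier X) n"
    "\<And>h. h \<in> thom \<Sigma> X M \<Longrightarrow> map h xs \<in> reln M r"
  shows "xs \<in> reln X r"
  using siso_eval_reflects[OF siso_evalX_image[OF assms(1), unfolded evalX_def] thom_subset_shom]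
    assms(2-) by blast

text \<open>The inverse of the embedding maps a closed subset of a compact power continuously onto
  \<open>X\<close>.\<close>

lemma IScP_compact:
  fixes X :: "('a, 'f, 'r) tstruct" and M :: "('m, 'f, 'r) tstruct"
  assumes X: "X \<in> IScP \<Sigma> M" and M: "compact_space (topo M)"
  shows "compact_space (topo X)"
proof -
  obtain S :: "('a \<Rightarrow> 'm) set" and \<phi> C where C: "is_sub \<Sigma> C (pow \<Sigma> M S)"
    "closedin (product_topology (\<lambda>_. topo M) S) C"
    and \<phi>: "tiso \<Sigma> \<phi> X (tsub (tpow \<Sigma> M S) C)"
    using X by (auto simp: IScP_def temb_def is_sub_tpow)
  let ?T = "subtopology (product_topology (\<lambda>_. topo M) S) C"
  from \<phi> obtain \<psi> where \<phi>h: "\<phi> \<in> thom \<Sigma> X (tsub (tpow \<Sigma> M S) C)"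
    and \<psi>: "continuous_map ?T (topo X) \<psi>" "\<psi> \<in> C \<rightarrow>\<^sub>E carrier X"
      "\<And>x. x \<in> carrier X \<Longrightarrow> \<psi> (\<phi> x) = x"
    by (auto simp: tiso_def thom_def shom_def)
  have "\<phi> x \<in> C" if "x \<in> carrier X" for x using \<phi>h that by (auto simp: thom_def shom_def)
  then have im: "\<psi> ` C = carrier X" using \<psi>(2,3) by (force simp: PiE_iff)
  have "compact_space (product_topology (\<lambda>_. topo M) S)"
    using M by (simp add: compact_space_product_topology)
  then have "compactin ?T C"
    using closedin_compact_space C(2) by (simp add: compactin_subtopology)
  then have "compactin (topo X) (\<psi> ` C)" using image_compactin \<psi>(1) by blast
  then show ?thesis using im IScP_topspace[OF X] by (simp add: compact_space_def)
qed

lemma continuous_evalX: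
  assumes X: "topspace (topo X) = carrier X"
  shows "continuous_map (topo X) (product_topology (\<lambda>_. topo M) (thom \<Sigma> X M)) (evalX \<Sigma> M X)"
proof -
  have "continuous_map (topo X) (topo M) (\<lambda>a. evalX \<Sigma> M X a h)" if "h \<in> thom \<Sigma> X M" for h
    by (rule continuous_map_eq[of _ _ h]) (use that in \<open>auto simp: X thom_def evalX_def\<close>)
  then show ?thesis by (auto simp: continuous_map_componentwise X evalX_def)
qed

text \<open>A continuous bijection from a compact space onto a Hausdorff space is a homeomorphism,
  so continuity of the algebraic inverse comes for free.\<close>

lemma tisoI_compact:
  assumes \<phi>: "siso \<Sigma> \<phi> X Y" and c: "continuous_map (topo X) (topo Y) \<phi>"
    and X: "topspace (topo X) = carrier X" "compact_space (topo X)"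
    and Y: "topspace (topo Y) = carrier Y" "Hausdorff_space (topo Y)"
  shows "tiso \<Sigma> \<phi> X Y"
proof -
  obtain \<psi> where \<phi>h: "\<phi> \<in> shom \<Sigma> X Y" and \<psi>: "\<psi> \<in> shom \<Sigma> Y X"
    "\<And>x. x \<in> carrier X \<Longrightarrow> \<psi> (\<phi> x) = x" "\<And>y. y \<in> carrier Y \<Longrightarrow> \<phi> (\<psi> y) = y"
    using \<phi> by (auto simp: siso_def)
  have "homeomorphic_map (topo X) (topo Y) \<phi>"
  proof (rule continuous_imp_homeomorphic_map[OF c X(2) Y(2)])
    show "\<phi> ` topspace (topo X) = topspace (topo Y)"
      unfolding X Y using shom_carrier[OF \<phi>h] shom_carrier[OF \<psi>(1)] \<psi>(3) by force
    show "inj_on \<phi> (topspace (topo X))"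
      unfolding X by (rule inj_on_inverseI[of _ \<psi>]) (rule \<psi>(2))
  qed
  then obtain \<theta> where \<theta>: "continuous_map (topo Y) (topo X) \<theta>" "\<And>x. x \<in> carrier X \<Longrightarrow> \<theta> (\<phi> x) = x"
    by (auto simp: homeomorphic_map_maps homeomorphic_maps_def X)
  \<comment> \<open>The topological inverse \<theta> and the homomorphic inverse \<psi> coincide
    because both invert \<phi>.\<close>
  have "\<theta> y = \<psi> y" if "y \<in> carrier Y" for y
    using \<theta>(2)[OF shom_carrier[OF \<psi>(1) that]] \<psi>(3)[OF that] by simp
  then have "continuous_map (topo Y) (topo X) \<psi>"
    using continuous_map_eq[OF \<theta>(1)] Y by simp
  then show ?thesis using \<phi>h \<psi> c by (auto simp: tiso_def thom_def)
qed

subsection \<open>Alter egos\<close>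

lemma op_fun_apply:
  assumes "length gs = n" "\<And>g. g \<in> set gs \<Longrightarrow> g x \<in> A"
  shows "op_fun n A F (\<lambda>i\<in>{..<n}. (gs ! i) x) = F (map (\<lambda>g. g x) gs)"
proof -
  have "map (\<lambda>i\<in>{..<n}. (gs ! i) x) [0..<n] = map (\<lambda>g. g x) gs"
    using assms(1) by (auto intro!: nth_equalityI)
  moreover have "(\<lambda>i\<in>{..<n}. (gs ! i) x) \<in> {..<n} \<rightarrow>\<^sub>E A" using assms by auto
  ultimately show ?thesis by (simp add: op_fun_def)
qed

text \<open>Lists of length \<open>n\<close> and extensional functions on \<open>{..<n}\<close>
  correspond bijectively, so \<open>rel_fun\<close> loses no information.\<close>

lemma rel_fun_iff:
  assumes R: "R \<subseteq> tuples A n" and xs: "length xs = n"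
  shows "(\<lambda>i\<in>{..<n}. xs ! i) \<in> rel_fun n R \<longleftrightarrow> xs \<in> R"
proof
  assume "(\<lambda>i\<in>{..<n}. xs ! i) \<in> rel_fun n R"
  then obtain ys where ys: "ys \<in> R" "(\<lambda>i\<in>{..<n}. xs ! i) = (\<lambda>i\<in>{..<n}. ys ! i)"
    by (auto simp: rel_fun_def)
  have "length ys = n" using ys(1) R by (auto simp: tuples_def)
  then have "xs = ys" using xs fun_cong[OF ys(2)]
    by (intro nth_equalityI) (auto simp: restrict_def, metis)
  then show "xs \<in> R" using ys(1) by simp
qed (auto simp: rel_fun_def)

lemma alter_ego_op:
  "alter_ego \<Sigma> P \<Sigma>' Q \<Longrightarrow> opar \<Sigma>' g = Some n \<Longrightarrow>
     op_fun n (carrier P) (opn Q g) \<in> shom \<Sigma> (pow \<Sigma> P {..<n}) P"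
  and alter_ego_carrier: "alter_ego \<Sigma> P \<Sigma>' Q \<Longrightarrow> carrier Q = carrier P"
  and alter_ego_topspace: "alter_ego \<Sigma> P \<Sigma>' Q \<Longrightarrow> topspace (topo Q) = carrier P"
  and alter_ego_compact: "alter_ego \<Sigma> P \<Sigma>' Q \<Longrightarrow> compact_space (topo Q)"
  and alter_ego_Hausdorff: "alter_ego \<Sigma> P \<Sigma>' Q \<Longrightarrow> Hausdorff_space (topo Q)"
  and alter_ego_closedin: "alter_ego \<Sigma> P \<Sigma>' Q \<Longrightarrow> relar \<Sigma> r = Some n \<Longrightarrow>
        closedin (product_topology (\<lambda>_. topo Q) {..<n}) (rel_fun n (reln P r))"
  and alter_ego_continuous: "alter_ego \<Sigma> P \<Sigma>' Q \<Longrightarrow> opar \<Sigma> f = Some n \<Longrightarrow>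
        continuous_map (product_topology (\<lambda>_. topo Q) {..<n}) (topo Q) (op_fun n (carrier P) (opn P f))"
  and alter_ego_structure: "alter_ego \<Sigma> P \<Sigma>' Q \<Longrightarrow> is_structure \<Sigma> P"
  by (simp_all add: alter_ego_def is_tstructure_def total_structure_def)

section \<open>Hom-sets as closed substructures of powers\<close>

text \<open>An operation of \<open>Q\<close> is a homomorphism from a power of \<open>P\<close>;
  composed with the tuple of the given homomorphisms it is their pointwise combination.\<close>

lemma is_sub_shom:
  assumes PQ: "alter_ego \<Sigma> P \<Sigma>' Q" and A: "is_structure \<Sigma> A"
  shows "is_sub \<Sigma>' (shom \<Sigma> A P) (pow \<Sigma>' Q (carrier A))"
  unfolding is_sub_def
proof (intro conjI allI impI ballI)
  show "shom \<Sigma> A P \<subseteq> carrier (pow \<Sigma>' Q (carrier A))"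
    using shom_subset_PiE by (simp add: carrier_pow alter_ego_carrier[OF PQ])
  fix f n gs assume f: "opar \<Sigma>' f = Some n" and gs: "gs \<in> tuples (shom \<Sigma> A P) n"
  let ?F = "op_fun n (carrier P) (opn Q f)"
  let ?t = "\<lambda>a\<in>carrier A. \<lambda>i\<in>{..<n}. (gs ! i) a"
  have len: "length gs = n" and hom: "\<And>g. g \<in> set gs \<Longrightarrow> g \<in> shom \<Sigma> A P"
    using gs by (auto simp: tuples_def)
  have "?t \<in> shom \<Sigma> A (pow \<Sigma> P {..<n})"
    by (rule shom_tuple[OF A]) (use len hom in auto)
  then have "(\<lambda>a\<in>carrier A. ?F (?t a)) \<in> shom \<Sigma> A P"
    by (rule shom_compose[OF A _ alter_ego_op[OF PQ f]])
  also have "(\<lambda>a\<in>carrier A. ?F (?t a)) = opn (pow \<Sigma>' Q (carrier A)) f gs"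
    unfolding opn_pow by (rule restrict_ext)
      (simp add: op_fun_apply[OF len shom_carrier[OF hom]])
  finally show "opn (pow \<Sigma>' Q (carrier A)) f gs \<in> shom \<Sigma> A P" .
qed

text \<open>Preserving an operation at a fixed argument tuple means equality of two continuous maps
  into a Hausdorff space; preserving a relation at a fixed tuple means lying in the preimage of a
  closed set. The hom-set is the intersection of these closed conditions.\<close>

lemma closedin_shom:
  assumes PQ: "alter_ego \<Sigma> P \<Sigma>' Q" and A: "is_structure \<Sigma> A"
  shows "closedin (product_topology (\<lambda>_. topo Q) (carrier A)) (shom \<Sigma> A P)"
proof -
  let ?T = "product_topology (\<lambda>_. topo Q) (carrier A)"
  have T: "topspace ?T = carrier A \<rightarrow>\<^sub>E carrier P" by (simp add: alter_ego_topspace[OF PQ])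
  have tup: "continuous_map ?T (product_topology (\<lambda>_. topo Q) {..<n}) (\<lambda>\<phi>. \<lambda>i\<in>{..<n}. \<phi> (xs ! i))"
    if "xs \<in> tuples (carrier A) n" for xs n
    using that by (auto simp: continuous_map_componentwise tuples_def
        intro!: continuous_map_product_projection)
  define CO where "CO = {{\<phi> \<in> topspace ?T. \<phi> (opn A f xs) = op_fun n (carrier P) (opn P f) (\<lambda>i\<in>{..<n}. \<phi> (xs ! i))}
    | f n xs. opar \<Sigma> f = Some n \<and> xs \<in> tuples (carrier A) n}"
  define CR where "CR = {{\<phi> \<in> topspace ?T. (\<lambda>i\<in>{..<n}. \<phi> (xs ! i)) \<in> rel_fun n (reln P r)}
    | r n xs. relar \<Sigma> r = Some n \<and> xs \<in> reln A r}"
  have "closedin ?T C" if "C \<in> insert (topspace ?T) (CO \<union> CR)" for C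
  proof -
    have "closedin ?T C" if mem: "C \<in> CO"
    proof -
      obtain f n xs where f: "opar \<Sigma> f = Some n" and xs: "xs \<in> tuples (carrier A) n"
        and C: "C = {\<phi> \<in> topspace ?T. \<phi> (opn A f xs) = op_fun n (carrier P) (opn P f) (\<lambda>i\<in>{..<n}. \<phi> (xs ! i))}"
        using mem unfolding CO_def by blast
      show ?thesis
        unfolding C
      proof (rule closedin_continuous_maps_eq[OF alter_ego_Hausdorff[OF PQ]])
        show "continuous_map ?T (topo Q) (\<lambda>\<phi>. \<phi> (opn A f xs))"
          by (rule continuous_map_product_projection[OF is_structure_op[OF A f xs]])
        show "continuous_map ?T (topo Q) (\<lambda>\<phi>. op_fun n (carrier P) (opn P f) (\<lambda>i\<in>{..<n}. \<phi> (xs ! i)))"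
          using continuous_map_compose[OF tup[OF xs] alter_ego_continuous[OF PQ f]] by (simp add: o_def)
      qed
    qed
    moreover have "closedin ?T C" if mem: "C \<in> CR"
    proof -
      obtain r n xs where r: "relar \<Sigma> r = Some n" and xs: "xs \<in> reln A r"
        and C: "C = {\<phi> \<in> topspace ?T. (\<lambda>i\<in>{..<n}. \<phi> (xs ! i)) \<in> rel_fun n (reln P r)}"
        using mem unfolding CR_def by blast
      show ?thesis
        unfolding C
        by (rule closedin_continuous_map_preimage[OF tup alter_ego_closedin[OF PQ r]])
          (rule is_structure_rel[OF A r xs])
    qed
    moreover have "closedin ?T (topspace ?T)" by (rule closedin_topspace)
    ultimately show ?thesis using that unfolding insert_iff Un_iff by metis
  qed
  \<comment> \<open>Having the whole space in the family bounds the intersection by the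
    power.\<close>
  then have "closedin ?T (\<Inter>(insert (topspace ?T) (CO \<union> CR)))"
    by (intro closedin_Inter) auto
  also have "\<Inter>(insert (topspace ?T) (CO \<union> CR)) = shom \<Sigma> A P"
  proof -
    have opeq: "op_fun n (carrier P) (opn P f) (\<lambda>i\<in>{..<n}. \<phi> (xs ! i)) = opn P f (map \<phi> xs)"
      if \<phi>: "\<phi> \<in> topspace ?T" and xs: "xs \<in> tuples (carrier A) n" for f n xs \<phi>
    proof -
      \<comment> \<open>\<open>op_fun_apply\<close> evaluates a list of functions at a point;
        constant functions on the unit type turn the list of values of \<phi> into such a
        list.\<close>
      have "op_fun n (carrier P) (opn P f) (\<lambda>i\<in>{..<n}. (map (\<lambda>x _. \<phi> x) xs ! i) ())
          = opn P f (map (\<lambda>g. g ()) (map (\<lambda>x _. \<phi> x) xs))"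
        by (rule op_fun_apply) (use \<phi> xs T in \<open>auto simp: tuples_def\<close>)
      moreover have "(\<lambda>i\<in>{..<n}. (map (\<lambda>x _. \<phi> x) xs ! i) ()) = (\<lambda>i\<in>{..<n}. \<phi> (xs ! i))"
        using xs by (auto simp: tuples_def)
      ultimately show ?thesis by (simp add: o_def del: restrict_apply)
    qed
    have releq: "(\<lambda>i\<in>{..<n}. \<phi> (xs ! i)) \<in> rel_fun n (reln P r) \<longleftrightarrow> map \<phi> xs \<in> reln P r"
      if r: "relar \<Sigma> r = Some n" and xs: "xs \<in> reln A r" for r n xs \<phi>
    proof -
      have len: "length xs = n" using is_structure_rel[OF A r xs] by (simp add: tuples_def)
      have "reln P r \<subseteq> tuples (carrier P) n"
        using is_structure_rel[OF alter_ego_structure[OF PQ] r] by blast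
      from rel_fun_iff[OF this, of "map \<phi> xs"] len show ?thesis
        by (simp cong: restrict_cong)
    qed
    show ?thesis
    proof (intro equalityI subsetI)
      fix \<phi> assume \<phi>: "\<phi> \<in> \<Inter>(insert (topspace ?T) (CO \<union> CR))"
      then have \<phi>T: "\<phi> \<in> topspace ?T" by blast
      show "\<phi> \<in> shom \<Sigma> A P"
      proof (rule shomI)
        fix f n xs assume f: "opar \<Sigma> f = Some n" and xs: "xs \<in> tuples (carrier A) n"
        then have "{\<phi> \<in> topspace ?T. \<phi> (opn A f xs) = op_fun n (carrier P) (opn P f) (\<lambda>i\<in>{..<n}. \<phi> (xs ! i))} \<in> CO"
          unfolding CO_def by blast
        then have "\<phi> (opn A f xs) = op_fun n (carrier P) (opn P f) (\<lambda>i\<in>{..<n}. \<phi> (xs ! i))"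
          using \<phi> by blast
        then show "\<phi> (opn A f xs) = opn P f (map \<phi> xs)" unfolding opeq[OF \<phi>T xs] .
      next
        fix r n xs assume r: "relar \<Sigma> r = Some n" and xs: "xs \<in> reln A r"
        then have "{\<phi> \<in> topspace ?T. (\<lambda>i\<in>{..<n}. \<phi> (xs ! i)) \<in> rel_fun n (reln P r)} \<in> CR"
          unfolding CR_def by blast
        then have "(\<lambda>i\<in>{..<n}. \<phi> (xs ! i)) \<in> rel_fun n (reln P r)" using \<phi> by blast
        then show "map \<phi> xs \<in> reln P r" unfolding releq[OF r xs] .
      qed (use \<phi>T[unfolded T] in \<open>auto simp: PiE_iff\<close>)
    next
      fix \<phi> assume \<phi>: "\<phi> \<in> shom \<Sigma> A P"
      then have \<phi>T: "\<phi> \<in> topspace ?T" unfolding T using shom_subset_PiE by blast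
      have "\<phi> \<in> C" if mem: "C \<in> CO" for C
      proof -
        obtain f n xs where f: "opar \<Sigma> f = Some n" and xs: "xs \<in> tuples (carrier A) n"
          and C: "C = {\<phi> \<in> topspace ?T. \<phi> (opn A f xs) = op_fun n (carrier P) (opn P f) (\<lambda>i\<in>{..<n}. \<phi> (xs ! i))}"
          using mem unfolding CO_def by blast
        show ?thesis
          unfolding C mem_Collect_eq opeq[OF \<phi>T xs] using \<phi>T shom_op[OF \<phi> f xs] by blast
      qed
      moreover have "\<phi> \<in> C" if mem: "C \<in> CR" for C
      proof -
        obtain r n xs where r: "relar \<Sigma> r = Some n" and xs: "xs \<in> reln A r"
          and C: "C = {\<phi> \<in> topspace ?T. (\<lambda>i\<in>{..<n}. \<phi> (xs ! i)) \<in> rel_fun n (reln P r)}"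
          using mem unfolding CR_def by blast
        show ?thesis
          unfolding C mem_Collect_eq releq[OF r xs] using \<phi>T shom_rel[OF \<phi> r xs] by blast
      qed
      ultimately show "\<phi> \<in> \<Inter>(insert (topspace ?T) (CO \<union> CR))" using \<phi>T by blast
    qed
  qed
  finally show ?thesis .
qed


lemma with_topo_simps [simp]:
  "carrier (with_topo T A) = carrier A" "opn (with_topo T A) = opn A"
  "reln (with_topo T A) = reln A" "topo (with_topo T A) = T"
  by (simp_all add: with_topo_def)

lemma shom_with_topo [simp]: "shom \<Sigma> X (with_topo T A) = shom \<Sigma> X A"
  by (simp add: shom_def)

lemma pow_with_topo [simp]: "pow \<Sigma> (with_topo T A) S = pow \<Sigma> A S"
  by (simp add: pow_def)

lemma dualD_simps [simp]:
  "carrier (dualD \<Sigma> P \<Sigma>' Q A) = shom \<Sigma> A P"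
  "opn (dualD \<Sigma> P \<Sigma>' Q A) = opn (pow \<Sigma>' Q (carrier A))"
  "reln (dualD \<Sigma> P \<Sigma>' Q A) r = reln (pow \<Sigma>' Q (carrier A)) r \<inter> lists (shom \<Sigma> A P)"
  "topo (dualD \<Sigma> P \<Sigma>' Q A) = subtopology (product_topology (\<lambda>_. topo Q) (carrier A)) (shom \<Sigma> A P)"
  by (simp_all add: dualD_def)

lemma shom_dualD:
  "shom \<Sigma>'' (dualD \<Sigma> P \<Sigma>' Q A) Z = shom \<Sigma>'' (sub (pow \<Sigma>' Q (carrier A)) (shom \<Sigma> A P)) Z"
  by (simp add: shom_def)

lemma carrier_dualE [simp]: "carrier (dualE \<Sigma> P \<Sigma>' Q X) = thom \<Sigma>' X Q"
  and opn_dualE [simp]: "opn (dualE \<Sigma> P \<Sigma>' Q X) = opn (pow \<Sigma> P (carrier X))"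
  by (simp_all add: dualE_def)

lemma is_structure_dualD:
  assumes "alter_ego \<Sigma> P \<Sigma>' Q" "is_structure \<Sigma> A"
  shows "is_structure \<Sigma>' (dualD \<Sigma> P \<Sigma>' Q A)"
  using is_structure_sub_pow[OF is_sub_shom[OF assms]] by (simp add: is_structure_def)

lemma topspace_dualD:
  assumes "alter_ego \<Sigma> P \<Sigma>' Q"
  shows "topspace (topo (dualD \<Sigma> P \<Sigma>' Q A)) = shom \<Sigma> A P"
  using alter_ego_topspace[OF assms] shom_subset_PiE[of \<Sigma> A P] by (simp add: inf_absorb2)

lemma compact_dualD:
  assumes PQ: "alter_ego \<Sigma> P \<Sigma>' Q" and A: "is_structure \<Sigma> A"
  shows "compact_space (topo (dualD \<Sigma> P \<Sigma>' Q A))"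
proof -
  have "compact_space (product_topology (\<lambda>_. topo Q) (carrier A))"
    using alter_ego_compact[OF PQ] by (simp add: compact_space_product_topology)
  from closedin_compact_space[OF this closedin_shom[OF PQ A]] show ?thesis
    by (simp add: compact_space_subtopology)
qed

lemma Hausdorff_dualD:
  assumes "alter_ego \<Sigma> P \<Sigma>' Q"
  shows "Hausdorff_space (topo (dualD \<Sigma> P \<Sigma>' Q A))"
  using alter_ego_Hausdorff[OF assms]
  by (simp add: Hausdorff_space_subtopology Hausdorff_space_product_topology)

lemma continuous_projection_dualD:
  assumes "a \<in> carrier A"
  shows "continuous_map (topo (dualD \<Sigma> P \<Sigma>' Q A)) (topo Q) (\<lambda>h. h a)"
  using assms by (auto intro: continuous_map_from_subtopology continuous_map_product_projection)

lemma evalA_in_thom: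
  assumes PQ: "alter_ego \<Sigma> P \<Sigma>' Q" and A: "is_structure \<Sigma> A" and a: "a \<in> carrier A"
  shows "evalA \<Sigma> P A a \<in> thom \<Sigma>' (dualD \<Sigma> P \<Sigma>' Q A) Q"
proof -
  have "continuous_map (topo (dualD \<Sigma> P \<Sigma>' Q A)) (topo Q) (evalA \<Sigma> P A a)"
    by (rule continuous_map_eq[OF continuous_projection_dualD[OF a]])
      (use a in \<open>simp add: topspace_dualD[OF PQ] evalA_def\<close>)
  then show ?thesis
    using shom_eval[OF is_sub_shom[OF PQ A] a] a by (simp add: thom_def shom_dualD evalA_def)
qed

text \<open>The two alter ego conditions share the work: an operation of \<open>P\<close> preserves
  the structure of \<open>Q\<close> by \<open>QP\<close>, and it respects continuity by
  \<open>PQ\<close>.\<close>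

lemma is_sub_thom:
  assumes PQ: "alter_ego \<Sigma> P \<Sigma>' (with_topo T Q)" and QP: "alter_ego \<Sigma>' Q \<Sigma> (with_topo T P)"
    and X: "is_structure \<Sigma>' X" "topspace (topo X) = carrier X"
  shows "is_sub \<Sigma> (thom \<Sigma>' X (with_topo T Q)) (pow \<Sigma> P (carrier X))"
  unfolding is_sub_def
proof (intro conjI allI impI ballI)
  have S: "is_sub \<Sigma> (shom \<Sigma>' X Q) (pow \<Sigma> P (carrier X))"
    using is_sub_shom[OF QP X(1)] by simp
  then show "thom \<Sigma>' X (with_topo T Q) \<subseteq> carrier (pow \<Sigma> P (carrier X))"
    by (auto simp: thom_def is_sub_def)
  fix f n gs assume f: "opar \<Sigma> f = Some n" and gs: "gs \<in> tuples (thom \<Sigma>' X (with_topo T Q)) n"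
  then have hom: "gs \<in> tuples (shom \<Sigma>' X Q) n" by (auto simp: tuples_def thom_def)
  let ?F = "op_fun n (carrier P) (opn P f)"
  have "continuous_map (topo X) (product_topology (\<lambda>_. T) {..<n}) (\<lambda>x. \<lambda>i\<in>{..<n}. (gs ! i) x)"
    using gs nth_mem[of _ gs] by (auto simp: continuous_map_componentwise tuples_def thom_def subset_iff)
  from continuous_map_compose[OF this] alter_ego_continuous[OF PQ f]
  have "continuous_map (topo X) T (\<lambda>x. ?F (\<lambda>i\<in>{..<n}. (gs ! i) x))"
    by (simp add: o_def)
  then have "continuous_map (topo X) T (opn (pow \<Sigma> P (carrier X)) f gs)"
  proof (rule continuous_map_eq)
    fix x assume "x \<in> topspace (topo X)"
    then have x: "x \<in> carrier X" by (simp add: X)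
    have "?F (\<lambda>i\<in>{..<n}. (gs ! i) x) = opn P f (map (\<lambda>g. g x) gs)"
      by (rule op_fun_apply)
        (use hom shom_carrier[OF _ x, of _ \<Sigma>' Q] alter_ego_carrier[OF QP] in \<open>auto simp: tuples_def\<close>)
    then show "?F (\<lambda>i\<in>{..<n}. (gs ! i) x) = opn (pow \<Sigma> P (carrier X)) f gs x"
      using x by (simp add: opn_pow)
  qed
  moreover have "opn (pow \<Sigma> P (carrier X)) f gs \<in> shom \<Sigma>' X Q"
    using S f hom by (simp add: is_sub_def)
  ultimately show "opn (pow \<Sigma> P (carrier X)) f gs \<in> thom \<Sigma>' X (with_topo T Q)"
    by (simp add: thom_def)
qed

text \<open>Both evaluation maps embed by membership in the classes, so only the two surjectivity
  hypotheses \<open>A\<close> and \<open>X\<close> remain. On the topological side compactness of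
  \<open>X\<close> makes the inverse continuous.\<close>

lemma fully_dualisesI:
  fixes P :: "('m, 'f, 'r) struct" and Q :: "('m, 'g, 'q) struct"
  assumes PQ: "alter_ego \<Sigma> P \<Sigma>' (with_topo T Q)" and QP: "alter_ego \<Sigma>' Q \<Sigma> (with_topo T P)"
    and A: "\<And>(A :: ('a, 'f, 'r) struct) \<alpha>. A \<in> ISP \<Sigma> P \<Longrightarrow>
      \<alpha> \<in> thom \<Sigma>' (dualD \<Sigma> P \<Sigma>' (with_topo T Q) A) (with_topo T Q) \<Longrightarrow>
      \<exists>a\<in>carrier A. \<forall>h\<in>shom \<Sigma> A P. \<alpha> h = h a"
    and X: "\<And>(X :: ('x, 'g, 'q) tstruct) \<beta>. X \<in> IScP \<Sigma>' (with_topo T Q) \<Longrightarrow>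
      \<beta> \<in> shom \<Sigma> (dualE \<Sigma> P \<Sigma>' (with_topo T Q) X) P \<Longrightarrow>
      \<exists>x\<in>carrier X. \<forall>h\<in>thom \<Sigma>' X (with_topo T Q). \<beta> h = h x"
  shows "fully_dualises TYPE('a) TYPE('x) \<Sigma>' (with_topo T Q) \<Sigma> P"
  unfolding fully_dualises_def
proof (intro conjI ballI PQ)
  let ?Q = "with_topo T Q"
  fix A :: "('a, 'f, 'r) struct" assume A': "A \<in> ISP \<Sigma> P"
  note sA = ISP_is_structure[OF A']
  have "evalA \<Sigma> P A ` carrier A = thom \<Sigma>' (dualD \<Sigma> P \<Sigma>' ?Q A) ?Q"
  proof
    show "thom \<Sigma>' (dualD \<Sigma> P \<Sigma>' ?Q A) ?Q \<subseteq> evalA \<Sigma> P A ` carrier A"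
    proof
      fix \<alpha> assume \<alpha>: "\<alpha> \<in> thom \<Sigma>' (dualD \<Sigma> P \<Sigma>' ?Q A) ?Q"
      then obtain a where a: "a \<in> carrier A" "\<forall>h\<in>shom \<Sigma> A P. \<alpha> h = h a" using A[OF A'] by blast
      have "\<alpha> = evalA \<Sigma> P A a"
        by (rule shom_eqI[of _ \<Sigma>' "dualD \<Sigma> P \<Sigma>' ?Q A" ?Q])
          (use \<alpha> a evalA_in_thom[OF PQ sA a(1)] in \<open>auto simp: thom_def evalA_def\<close>)
      then show "\<alpha> \<in> evalA \<Sigma> P A ` carrier A" using a(1) by blast
    qed
  qed (use evalA_in_thom[OF PQ sA] in blast)
  then show "siso \<Sigma> (evalA \<Sigma> P A) A (dualE \<Sigma> P \<Sigma>' ?Q (dualD \<Sigma> P \<Sigma>' ?Q A))"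
    using siso_evalA_image[OF A'] by (simp add: dualE_def)
next
  let ?Q = "with_topo T Q"
  fix X :: "('x, 'g, 'q) tstruct" assume X': "X \<in> IScP \<Sigma>' ?Q"
  note sX = IScP_is_structure[OF X'] and tX = IScP_topspace[OF X']
  note S = is_sub_thom[OF PQ QP sX tX]
  have ev: "evalX \<Sigma>' ?Q X x \<in> shom \<Sigma> (dualE \<Sigma> P \<Sigma>' ?Q X) P" if "x \<in> carrier X" for x
    using shom_eval[OF S that] that by (simp add: dualE_def evalX_def)
  have im: "evalX \<Sigma>' ?Q X ` carrier X = shom \<Sigma> (dualE \<Sigma> P \<Sigma>' ?Q X) P"
  proof
    show "shom \<Sigma> (dualE \<Sigma> P \<Sigma>' ?Q X) P \<subseteq> evalX \<Sigma>' ?Q X ` carrier X"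
    proof
      fix \<beta> assume \<beta>: "\<beta> \<in> shom \<Sigma> (dualE \<Sigma> P \<Sigma>' ?Q X) P"
      then obtain x where x: "x \<in> carrier X" "\<forall>h\<in>thom \<Sigma>' X ?Q. \<beta> h = h x" using X[OF X'] by blast
      have "\<beta> = evalX \<Sigma>' ?Q X x"
        by (rule shom_eqI[OF \<beta> ev[OF x(1)]]) (use x in \<open>simp add: evalX_def\<close>)
      then show "\<beta> \<in> evalX \<Sigma>' ?Q X ` carrier X" using x(1) by blast
    qed
  qed (use ev in blast)
  have sE: "is_structure \<Sigma> (dualE \<Sigma> P \<Sigma>' ?Q X)"
    using is_structure_sub_pow[OF S] by (simp add: dualE_def)
  show "tiso \<Sigma>' (evalX \<Sigma>' ?Q X) X (dualD \<Sigma> P \<Sigma>' ?Q (dualE \<Sigma> P \<Sigma>' ?Q X))"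
  proof (rule tisoI_compact[OF _ _ tX])
    show "compact_space (topo X)"
      by (rule IScP_compact[OF X' alter_ego_compact[OF PQ]])
    show "siso \<Sigma>' (evalX \<Sigma>' ?Q X) X (dualD \<Sigma> P \<Sigma>' ?Q (dualE \<Sigma> P \<Sigma>' ?Q X))"
      using siso_evalX_image[OF X'] by (simp add: im siso_def shom_def)
    show "continuous_map (topo X) (topo (dualD \<Sigma> P \<Sigma>' ?Q (dualE \<Sigma> P \<Sigma>' ?Q X))) (evalX \<Sigma>' ?Q X)"
      using continuous_evalX[OF tX, of ?Q \<Sigma>'] im tX by (auto simp: continuous_map_in_subtopology)
  qed (simp_all only: topspace_dualD[OF PQ] Hausdorff_dualD[OF PQ] dualD_simps(1))
qed

subsection \<open>Isomorphisms in the classes\<close>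

lemma is_structure_pow:
  assumes "is_structure \<Sigma> M"
  shows "is_structure \<Sigma> (pow \<Sigma> M S)"
  unfolding is_structure_def
proof (intro conjI allI impI ballI)
  fix f n xs assume f: "opar \<Sigma> f = Some n" and xs: "xs \<in> tuples (carrier (pow \<Sigma> M S)) n"
  have "map (\<lambda>g. g s) xs \<in> tuples (carrier M) n" if "s \<in> S" for s
    by (rule map_tuples[OF xs]) (use that in \<open>auto simp: carrier_pow\<close>)
  then show "opn (pow \<Sigma> M S) f xs \<in> carrier (pow \<Sigma> M S)"
    using is_structure_op[OF assms f] by (auto simp: opn_pow carrier_pow)
qed (auto simp: reln_pow carrier_pow)

text \<open>A bijective homomorphism may fail to reflect relations; \<open>refl\<close> is what
  makes the inverse on the image a homomorphism.\<close>

lemma siso_image: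
  assumes A: "is_structure \<Sigma> A" and B: "is_structure \<Sigma> B"
    and \<phi>: "\<phi> \<in> shom \<Sigma> A B" and inj: "inj_on \<phi> (carrier A)"
    and refl: "\<And>r n xs. relar \<Sigma> r = Some n \<Longrightarrow> xs \<in> tuples (carrier A) n \<Longrightarrow>
      map \<phi> xs \<in> reln B r \<Longrightarrow> xs \<in> reln A r"
  shows "is_sub \<Sigma> (\<phi> ` carrier A) B" and "siso \<Sigma> \<phi> A (sub B (\<phi> ` carrier A))"
proof -
  have lift: "\<exists>xs \<in> tuples (carrier A) n. ys = map \<phi> xs" if "ys \<in> tuples (\<phi> ` carrier A) n" for ys n
  proof -
    have "ys = map \<phi> (map (inv_into (carrier A) \<phi>) ys)"
      using that by (auto simp: tuples_def subset_iff f_inv_into_f intro!: map_idI[symmetric])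
    moreover have "map (inv_into (carrier A) \<phi>) ys \<in> tuples (carrier A) n"
      using that by (auto simp: tuples_def subset_iff inv_into_into)
    ultimately show ?thesis by blast
  qed
  show "is_sub \<Sigma> (\<phi> ` carrier A) B"
    unfolding is_sub_def
  proof (intro conjI allI impI ballI)
    fix f n ys assume f: "opar \<Sigma> f = Some n" and "ys \<in> tuples (\<phi> ` carrier A) n"
    then obtain xs where xs: "xs \<in> tuples (carrier A) n" "ys = map \<phi> xs" using lift by blast
    show "opn B f ys \<in> \<phi> ` carrier A"
      unfolding xs(2) shom_op[OF \<phi> f xs(1), symmetric] using is_structure_op[OF A f xs(1)] by blast
  qed (use shom_carrier[OF \<phi>] in blast)
  let ?i = "restrict (inv_into (carrier A) \<phi>) (\<phi> ` carrier A)"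
  have im: "map ?i (map \<phi> xs) = xs" if "xs \<in> tuples (carrier A) n" for xs n
    using that inj by (auto simp: tuples_def subset_iff intro!: map_idI)
  have "\<phi> \<in> shom \<Sigma> A (sub B (\<phi> ` carrier A))"
  proof (rule shomI)
    fix r n xs assume r: "relar \<Sigma> r = Some n" and xs: "xs \<in> reln A r"
    show "map \<phi> xs \<in> reln (sub B (\<phi> ` carrier A)) r"
      using shom_rel[OF \<phi> r xs] tuples_memD[OF is_structure_rel[OF A r xs]] by auto
  qed (use shom_extensional[OF \<phi>] shom_op[OF \<phi>] in auto)
  moreover have "?i \<in> shom \<Sigma> (sub B (\<phi> ` carrier A)) A"
  proof (rule shomI)
    fix f n ys assume f: "opar \<Sigma> f = Some n" and "ys \<in> tuples (carrier (sub B (\<phi> ` carrier A))) n"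
    then obtain xs where xs: "xs \<in> tuples (carrier A) n" "ys = map \<phi> xs" using lift[of ys n] by auto
    show "?i (opn (sub B (\<phi> ` carrier A)) f ys) = opn A f (map ?i ys)"
      unfolding opn_sub xs(2) im[OF xs(1)] shom_op[OF \<phi> f xs(1), symmetric]
      using is_structure_op[OF A f xs(1)] inj by simp
  next
    fix r n ys assume r: "relar \<Sigma> r = Some n" and ys: "ys \<in> reln (sub B (\<phi> ` carrier A)) r"
    then have "ys \<in> tuples (\<phi> ` carrier A) n"
      using is_structure_rel[OF B r, of ys] by (auto simp: tuples_def)
    then obtain xs where xs: "xs \<in> tuples (carrier A) n" "ys = map \<phi> xs" using lift by blast
    show "map ?i ys \<in> reln A r"
      unfolding xs(2) im[OF xs(1)] using refl[OF r xs(1)] ys xs(2) by simp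
  qed (use inj in auto)
  ultimately show "siso \<Sigma> \<phi> A (sub B (\<phi> ` carrier A))"
    unfolding siso_def carrier_sub using restrict_inv_into[OF inj] by blast
qed

lemma siso_sub_id:
  "(\<lambda>x\<in>C. x) \<in> shom \<Sigma> A A \<Longrightarrow> carrier A = C \<Longrightarrow> siso \<Sigma> (\<lambda>x\<in>C. x) A A"
  unfolding siso_def by (auto intro!: bexI[of _ "\<lambda>x\<in>C. x"])

lemma shom_id:
  assumes "is_structure \<Sigma> A"
  shows "(\<lambda>x\<in>carrier A. x) \<in> shom \<Sigma> A A"
proof -
  have m: "map (\<lambda>x\<in>carrier A. x) xs = xs" if "xs \<in> tuples (carrier A) n" for xs n
    using that by (intro map_idI) (auto simp: tuples_def)
  show ?thesis
  proof (rule shomI)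
    fix r n xs assume "relar \<Sigma> r = Some n" "xs \<in> reln A r"
    then show "map (\<lambda>x\<in>carrier A. x) xs \<in> reln A r"
      using m[OF is_structure_rel[OF assms]] by metis
  qed (use is_structure_op[OF assms] m in auto)
qed

text \<open>Both sides embed in the same power, \<open>X\<close> through \<phi> and the substructure
  through the identity. The index set may have any type, thanks to \<open>ISP_I\<close>.\<close>

lemma iso_ISP_I:
  assumes C: "is_sub \<Sigma> C (pow \<Sigma> M S)" and X: "is_structure \<Sigma> X" "carrier X \<noteq> {}"
    and \<phi>: "siso \<Sigma> \<phi> X (sub (pow \<Sigma> M S) C)"
  shows "iso_ISP \<Sigma> M \<phi> X (sub (pow \<Sigma> M S) C)"
  unfolding iso_ISP_def
proof (intro conjI \<phi>)
  show "X \<in> ISP \<Sigma> M"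
    by (rule ISP_I[of _ _ \<phi> _ S]) (use X C \<phi> in \<open>auto simp: total_structure_def semb_def\<close>)
  let ?Y = "sub (pow \<Sigma> M S) C"
  have Y: "is_structure \<Sigma> ?Y" by (rule is_structure_sub_pow[OF C])
  have "C \<noteq> {}" using \<phi> X(2) by (auto simp: siso_def shom_def)
  moreover have "siso \<Sigma> (\<lambda>x\<in>C. x) ?Y ?Y" using siso_sub_id[of C \<Sigma> ?Y] shom_id[OF Y] by simp
  ultimately show "?Y \<in> ISP \<Sigma> M"
    by (intro ISP_I[of _ _ "\<lambda>x\<in>C. x" _ S]) (use Y C in \<open>auto simp: total_structure_def semb_def\<close>)
qed

lemma iso_IScP_I:
  assumes C: "is_sub \<Sigma> C (pow \<Sigma> M S)" "closedin (product_topology (\<lambda>_. topo M) S) C" "S \<noteq> {}"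
    and M: "compact_space (topo M)" "Hausdorff_space (topo M)"
    and X: "is_structure \<Sigma> X" "topspace (topo X) = carrier X"
    and \<phi>: "tiso \<Sigma> \<phi> X (tsub (tpow \<Sigma> M S) C)"
  shows "iso_IScP \<Sigma> M \<phi> X (tsub (tpow \<Sigma> M S) C)"
  unfolding iso_IScP_def
proof (intro conjI \<phi>)
  show "X \<in> IScP \<Sigma> M"
    by (rule IScP_I[of _ _ \<phi> _ S])
      (use X C M \<phi> in \<open>auto simp: is_tstructure_def temb_def is_sub_tpow\<close>)
  let ?Y = "tsub (tpow \<Sigma> M S) C"
  have Y: "is_structure \<Sigma> ?Y" using is_structure_sub_pow[OF C(1)] by (simp add: is_structure_def)
  have tY: "topspace (topo ?Y) = C" using closedin_subset[OF C(2)] by auto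
  have "continuous_map (topo ?Y) (topo ?Y) (\<lambda>x\<in>C. x)"
    by (rule continuous_map_eq[OF continuous_map_id]) (use tY in auto)
  then have "(\<lambda>x\<in>C. x) \<in> thom \<Sigma> ?Y ?Y" using shom_id[OF Y] by (simp add: thom_def)
  then have "tiso \<Sigma> (\<lambda>x\<in>C. x) ?Y ?Y" unfolding tiso_def by (auto intro!: bexI[of _ "\<lambda>x\<in>C. x"])
  then show "?Y \<in> IScP \<Sigma> M"
    by (intro IScP_I[of _ _ "\<lambda>x\<in>C. x" _ S])
      (use Y tY C M in \<open>auto simp: is_tstructure_def temb_def is_sub_tpow\<close>)
qed

section \<open>Reducts and change of signature\<close>

definition subsignature :: "('f, 'r) signature \<Rightarrow> ('f, 'r) signature \<Rightarrow> bool" where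
  "subsignature \<Sigma>0 \<Sigma> \<longleftrightarrow> opar \<Sigma>0 \<subseteq>\<^sub>m opar \<Sigma> \<and> relar \<Sigma>0 \<subseteq>\<^sub>m relar \<Sigma>"

lemma subsignature_Some:
  assumes "subsignature \<Sigma>0 \<Sigma>"
  shows "opar \<Sigma>0 f = Some n \<Longrightarrow> opar \<Sigma> f = Some n" "relar \<Sigma>0 r = Some n \<Longrightarrow> relar \<Sigma> r = Some n"
  using assms by (auto simp: subsignature_def map_le_def dom_def; metis option.distinct(1))+

lemma is_structure_subsignature:
  "subsignature \<Sigma>0 \<Sigma> \<Longrightarrow> is_structure \<Sigma> A \<Longrightarrow> is_structure \<Sigma>0 A"
  unfolding is_structure_def by (meson subsignature_Some)

lemma shom_subsignature:
  "subsignature \<Sigma>0 \<Sigma> \<Longrightarrow> shom \<Sigma> A B \<subseteq> shom \<Sigma>0 A B"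
  unfolding shom_def by (auto dest: subsignature_Some)

lemma reduct_simps [simp]:
  "carrier (reduct \<Sigma> A) = carrier A"
  "opar \<Sigma> f = Some n \<Longrightarrow> opn (reduct \<Sigma> A) f = opn A f"
  "relar \<Sigma> r = Some n \<Longrightarrow> reln (reduct \<Sigma> A) r = reln A r"
  by (simp_all add: reduct_def)

lemma topo_reduct [simp]: "topo (reduct \<Sigma> X) = topo X"
  by (simp add: reduct_def)

lemma is_structure_reduct [simp]: "is_structure \<Sigma> (reduct \<Sigma> A) = is_structure \<Sigma> A"
  by (auto simp: is_structure_def)

lemma shom_reduct [simp]:
  "shom \<Sigma> (reduct \<Sigma> A) B = shom \<Sigma> A B" "shom \<Sigma> A (reduct \<Sigma> B) = shom \<Sigma> A B"
  by (auto simp: shom_def)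

lemma thom_reduct [simp]: "thom \<Sigma> (reduct \<Sigma> X) Y = thom \<Sigma> X Y"
  by (simp add: thom_def)

lemma siso_reduct [simp]: "siso \<Sigma> \<phi> (reduct \<Sigma> A) B = siso \<Sigma> \<phi> A B"
  by (simp add: siso_def)

lemma is_sub_reduct_power:
  "subsignature \<Sigma>0 \<Sigma> \<Longrightarrow> is_sub \<Sigma> D (pow \<Sigma> M S) \<Longrightarrow> is_sub \<Sigma>0 D (pow \<Sigma>0 M S)"
  unfolding is_sub_def carrier_pow opn_pow by (auto dest: subsignature_Some(1))

text \<open>\<open>pow\<close> consults the signature only for relation arities, and these agree on
  the symbols of the smaller signature.\<close>

lemma shom_pow_subsignature:
  assumes "subsignature \<Sigma>0 \<Sigma>"
  shows "shom \<Sigma>0 (sub (pow \<Sigma> M S) D) B = shom \<Sigma>0 (sub (pow \<Sigma>0 M S) D) B"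
    and "shom \<Sigma>0 B (sub (pow \<Sigma> M S) D) = shom \<Sigma>0 B (sub (pow \<Sigma>0 M S) D)"
proof -
  have "reln (pow \<Sigma> M S) r = reln (pow \<Sigma>0 M S) r" if "relar \<Sigma>0 r = Some n" for r n
    using that subsignature_Some(2)[OF assms that] by (simp add: pow_def)
  then show "shom \<Sigma>0 (sub (pow \<Sigma> M S) D) B = shom \<Sigma>0 (sub (pow \<Sigma>0 M S) D) B"
    and "shom \<Sigma>0 B (sub (pow \<Sigma> M S) D) = shom \<Sigma>0 B (sub (pow \<Sigma>0 M S) D)"
    by (auto simp: shom_def opn_pow)
qed

text \<open>Composition with \<open>w\<close> is a homomorphism for the smaller signature by the
  universal property of the power. Although \<open>w\<close> may collapse elements of
  \<open>M\<close>, \<open>inj\<close> and \<open>refl\<close> say that nothing is lost on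
  \<open>D\<close>.\<close>

lemma siso_pointwise:
  assumes sub: "subsignature \<Sigma>0 \<Sigma>" and D: "is_sub \<Sigma> D (pow \<Sigma> M S)" and N: "is_structure \<Sigma>0 N"
    and w: "w \<in> shom \<Sigma>0 M N"
    and inj: "\<And>g h. g \<in> D \<Longrightarrow> h \<in> D \<Longrightarrow> (\<And>s. s \<in> S \<Longrightarrow> w (g s) = w (h s)) \<Longrightarrow> g = h"
    and refl: "\<And>r n gs. relar \<Sigma>0 r = Some n \<Longrightarrow> gs \<in> tuples D n \<Longrightarrow>
      (\<And>s. s \<in> S \<Longrightarrow> map (\<lambda>g. w (g s)) gs \<in> reln N r) \<Longrightarrow>
      (\<And>s. s \<in> S \<Longrightarrow> map (\<lambda>g. g s) gs \<in> reln M r)"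
  defines "\<phi> \<equiv> \<lambda>g\<in>D. \<lambda>s\<in>S. w (g s)"
  shows "is_sub \<Sigma>0 (\<phi> ` D) (pow \<Sigma>0 N S)"
    and "siso \<Sigma>0 \<phi> (sub (pow \<Sigma> M S) D) (sub (pow \<Sigma>0 N S) (\<phi> ` D))"
proof -
  let ?A = "sub (pow \<Sigma>0 M S) D"
  have D0: "is_sub \<Sigma>0 D (pow \<Sigma>0 M S)" by (rule is_sub_reduct_power[OF sub D])
  have A: "is_structure \<Sigma>0 ?A" by (rule is_structure_sub_pow[OF D0])
  have DM: "g s \<in> carrier M" if "g \<in> D" "s \<in> S" for g s
    using D that by (auto simp: is_sub_def carrier_pow)
  have ev: "(\<lambda>g\<in>D. w (g s)) \<in> shom \<Sigma>0 ?A N" if s: "s \<in> S" for s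
  proof -
    have "(\<lambda>g\<in>D. w (g s)) = (\<lambda>g\<in>carrier ?A. w ((\<lambda>h\<in>D. h s) g))" by auto
    then show ?thesis using shom_compose[OF A shom_eval[OF D0 s] w] by simp
  qed
  have "(\<lambda>g\<in>carrier ?A. \<lambda>s\<in>S. (\<lambda>g\<in>D. w (g s)) g) \<in> shom \<Sigma>0 ?A (pow \<Sigma>0 N S)"
    by (rule shom_tuple[OF A ev])
  moreover have "(\<lambda>g\<in>carrier ?A. \<lambda>s\<in>S. (\<lambda>g\<in>D. w (g s)) g) = \<phi>"
    unfolding \<phi>_def by auto
  ultimately have \<phi>: "\<phi> \<in> shom \<Sigma>0 ?A (pow \<Sigma>0 N S)" by simp
  have inj': "inj_on \<phi> (carrier ?A)"
  proof (rule inj_onI)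
    fix g h assume gh: "g \<in> carrier ?A" "h \<in> carrier ?A" and eq: "\<phi> g = \<phi> h"
    show "g = h"
    proof (rule inj)
      fix s assume "s \<in> S"
      then show "w (g s) = w (h s)" using fun_cong[OF eq, of s] gh by (simp add: \<phi>_def)
    qed (use gh in simp_all)
  qed
  have refl': "xs \<in> reln ?A r"
    if r: "relar \<Sigma>0 r = Some n" and xs: "xs \<in> tuples (carrier ?A) n"
      and rel: "map \<phi> xs \<in> reln (pow \<Sigma>0 N S) r" for r n xs
  proof -
    have xs': "xs \<in> tuples D n" using xs by simp
    have "map (\<lambda>g. w (g s)) xs \<in> reln N r" if s: "s \<in> S" for s
    proof -
      have "map (\<lambda>g. g s) (map \<phi> xs) = map (\<lambda>g. w (g s)) xs"
        using s tuples_memD[OF xs'] by (auto simp: \<phi>_def)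
      then show ?thesis using rel s unfolding reln_pow[OF r] by metis
    qed
    then have "map (\<lambda>g. g s) xs \<in> reln M r" if "s \<in> S" for s using refl[OF r xs'] that by blast
    moreover have "xs \<in> tuples (S \<rightarrow>\<^sub>E carrier M) n"
      using xs' D by (auto simp: tuples_def is_sub_def carrier_pow)
    moreover have "xs \<in> lists D" using xs' by (auto simp: tuples_def)
    ultimately show ?thesis by (simp add: reln_pow[OF r])
  qed
  note * = siso_image[OF A is_structure_pow[OF N] \<phi> inj' refl', unfolded carrier_sub]
  show "is_sub \<Sigma>0 (\<phi> ` D) (pow \<Sigma>0 N S)" by (rule *(1))
  show "siso \<Sigma>0 \<phi> (sub (pow \<Sigma> M S) D) (sub (pow \<Sigma>0 N S) (\<phi> ` D))"
    using *(2) by (simp add: siso_def shom_pow_subsignature[OF sub])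
qed

section \<open>The structures \<open>M1\<close> and \<open>M2\<close>\<close>

lemma tuples_0: "xs \<in> tuples A 0 \<longleftrightarrow> xs = []"
  by (auto simp: tuples_def)

lemma tuples_1: "xs \<in> tuples A 1 \<longleftrightarrow> (\<exists>a\<in>A. xs = [a])"
  by (auto simp: tuples_def length_Suc_conv)

lemma tuples_2: "xs \<in> tuples A 2 \<longleftrightarrow> (\<exists>a\<in>A. \<exists>b\<in>A. xs = [a, b])"
  by (auto simp: tuples_def length_Suc_conv numeral_2_eq_2)

lemma opar_sig1_cases:
  assumes "opar sig1 f = Some n"
  obtains "f = Join" "n = 2" | "f = Meet" "n = 2" | "f = Neg" "n = 1" | "f = Zero" "n = 0" | "f = One" "n = 0"
  using assms by (auto simp: sig1_def split: if_splits)

lemma sig_simps [simp]: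
  "opar sig1 Join = Some 2" "opar sig1 Meet = Some 2" "opar sig1 Neg = Some 1"
  "opar sig1 Zero = Some 0" "opar sig1 One = Some 0" "relar sig1 r = None"
  "opar sig2 f = Some n \<longleftrightarrow> f = Shift \<and> n = 1" "relar sig2 r = Some m \<longleftrightarrow> m = 2"
  "opar lat_sig Join = Some 2" "opar lat_sig Meet = Some 2"
  "opar lat_sig Zero = Some 0" "opar lat_sig One = Some 0" "relar lat_sig r = None"
  "opar ord_sig f = None" "relar ord_sig r = Some m \<longleftrightarrow> m = 2"
  by (cases r; auto simp: sig1_def sig2_def lat_sig_def ord_sig_def)+

lemma opar_lat_sig_cases:
  assumes "opar lat_sig f = Some n"
  obtains "f = Join" "n = 2" | "f = Meet" "n = 2" | "f = Zero" "n = 0" | "f = One" "n = 0"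
  using assms by (auto simp: lat_sig_def split: if_splits)

lemma subsignature_lat: "subsignature lat_sig sig1"
  by (auto simp: subsignature_def map_le_def lat_sig_def sig1_def)

lemma subsignature_ord: "subsignature ord_sig sig2"
  by (auto simp: subsignature_def map_le_def ord_sig_def sig2_def)

lemma struct_simps [simp]:
  "carrier M1 = UNIV" "opn M1 = op1" "reln M1 r = {}"
  "carrier M2 = UNIV" "opn M2 = op2" "[a, b] \<in> reln M2 r \<longleftrightarrow> le2 a b"
  "carrier lat2 = UNIV" "opn lat2 = lat_op" "reln lat2 r = {}"
  "carrier ord2 = UNIV" "[p, q] \<in> reln ord2 r \<longleftrightarrow> p \<le> q"
  by (auto simp: M1_def M2_def lat2_def ord2_def)

lemma is_structure_M1: "is_structure sig1 M1" and is_structure_lat2: "is_structure lat_sig lat2"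
  by (auto simp: is_structure_def)

lemma is_structure_M2: "is_structure sig2 M2"
  by (auto simp: is_structure_def M2_def tuples_def)

lemma is_structure_ord2: "is_structure ord_sig ord2"
  by (auto simp: is_structure_def ord2_def tuples_def)

section \<open>The Cantor topology and the alter ego conditions\<close>

lemma compact_cantor: "compact_space cantor_topology"
  and Hausdorff_cantor: "Hausdorff_space cantor_topology"
  and topspace_cantor [simp]: "topspace cantor_topology = UNIV"
  by (simp_all add: cantor_topology_def compact_space_product_topology compact_space_discrete_topology
      Hausdorff_space_product_topology)

lemma continuous_map_cantor:
  "continuous_map T cantor_topology g \<longleftrightarrow> (\<forall>n. clopen_pred T (\<lambda>x. g x n))"
  by (simp add: cantor_topology_def continuous_map_componentwise)

lemma clopen_pred_component:
  assumes "i \<in> I"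
  shows "clopen_pred (product_topology (\<lambda>_. cantor_topology) I) (\<lambda>g. g i n)"
  using continuous_map_product_projection[OF assms, of "\<lambda>_. cantor_topology"]
  by (simp add: continuous_map_cantor)

lemma rel_fun_M2: "g \<in> rel_fun 2 (reln M2 r) \<longleftrightarrow> g \<in> {..<2} \<rightarrow>\<^sub>E UNIV \<and> le2 (g 0) (g 1)"
proof
  assume "g \<in> {..<2} \<rightarrow>\<^sub>E UNIV \<and> le2 (g 0) (g 1)"
  moreover from this have "g = (\<lambda>i\<in>{..<2}. [g 0, g 1] ! i)"
    by (auto simp: fun_eq_iff PiE_iff extensional_def less_2_cases_iff)
  ultimately show "g \<in> rel_fun 2 (reln M2 r)" unfolding rel_fun_def by auto
qed (auto simp: rel_fun_def M2_def)

lemma upt_2: "[0..<2] = [0, 1]"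
  by (simp add: upt_rec)

lemma op_fun_simps:
  "g \<in> {..<2} \<rightarrow>\<^sub>E UNIV \<Longrightarrow> op_fun 2 UNIV F g = F [g 0, g 1]"
  "g \<in> {..<1} \<rightarrow>\<^sub>E UNIV \<Longrightarrow> op_fun 1 UNIV F g = F [g 0]"
  "g \<in> {..<0} \<rightarrow>\<^sub>E UNIV \<Longrightarrow> op_fun 0 UNIV F g = F []"
  by (simp_all add: op_fun_def upt_2)

text \<open>For negation two reversals cancel: complementation reverses the order at every
  coordinate, and the shift exchanges even and odd coordinates, where \<open>le2\<close> has
  opposite directions.\<close>

lemma le2_ops:
  "le2 a a' \<Longrightarrow> le2 b b' \<Longrightarrow> le2 (\<lambda>n. a n \<or> b n) (\<lambda>n. a' n \<or> b' n)"
  "le2 a a' \<Longrightarrow> le2 b b' \<Longrightarrow> le2 (\<lambda>n. a n \<and> b n) (\<lambda>n. a' n \<and> b' n)"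
  "le2 a a' \<Longrightarrow> le2 (Not \<circ> a \<circ> Suc) (Not \<circ> a' \<circ> Suc)"
  "le2 (\<lambda>n. c) (\<lambda>n. c)"
  by (auto simp: le2_def)

text \<open>Each coordinate of a result is a Boolean combination of finitely many coordinates of the
  arguments.\<close>

lemma continuous_op1:
  assumes "opar sig1 f = Some n"
  shows "continuous_map (product_topology (\<lambda>_. cantor_topology) {..<n}) cantor_topology (op_fun n UNIV (op1 f))"
  using assms
proof (cases rule: opar_sig1_cases)
  case 1
  have "continuous_map (product_topology (\<lambda>_. cantor_topology) {..<n}) cantor_topology (\<lambda>g n. g 0 n \<or> g 1 n)"
    unfolding continuous_map_cantor using 1 by (intro allI clopen_pred_disj clopen_pred_component) auto
  then show ?thesis by (rule continuous_map_eq) (use 1 in \<open>simp add: op_fun_simps\<close>)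
next
  case 2
  have "continuous_map (product_topology (\<lambda>_. cantor_topology) {..<n}) cantor_topology (\<lambda>g n. g 0 n \<and> g 1 n)"
    unfolding continuous_map_cantor using 2 by (intro allI clopen_pred_conj clopen_pred_component) auto
  then show ?thesis by (rule continuous_map_eq) (use 2 in \<open>simp add: op_fun_simps\<close>)
next
  case 3
  have "continuous_map (product_topology (\<lambda>_. cantor_topology) {..<n}) cantor_topology (\<lambda>g n. \<not> g 0 (Suc n))"
    unfolding continuous_map_cantor using 3 by (intro allI clopen_pred_Not clopen_pred_component) auto
  then show ?thesis by (rule continuous_map_eq) (use 3 in \<open>simp add: op_fun_simps(2)[simplified] o_def\<close>)
next
  case 4
  have "continuous_map (product_topology (\<lambda>_. cantor_topology) {..<n}) cantor_topology (\<lambda>g n. False)"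
    by (simp add: continuous_map_cantor)
  then show ?thesis by (rule continuous_map_eq) (use 4 in \<open>simp add: op_fun_def\<close>)
next
  case 5
  have "continuous_map (product_topology (\<lambda>_. cantor_topology) {..<n}) cantor_topology (\<lambda>g n. True)"
    by (simp add: continuous_map_cantor)
  then show ?thesis by (rule continuous_map_eq) (use 5 in \<open>simp add: op_fun_def\<close>)
qed

lemma continuous_Shift:
  "continuous_map (product_topology (\<lambda>_. cantor_topology) {..<1::nat}) cantor_topology (op_fun 1 UNIV (op2 Shift))"
proof -
  have "continuous_map (product_topology (\<lambda>_. cantor_topology) {..<1::nat}) cantor_topology (\<lambda>g n. g 0 (Suc n))"
    unfolding continuous_map_cantor by (intro allI clopen_pred_component) auto
  then show ?thesis by (rule continuous_map_eq) (simp add: op_fun_simps(2)[simplified] o_def)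
qed

lemma closedin_le2:
  "closedin (product_topology (\<lambda>_. cantor_topology) {..<2}) (rel_fun 2 (reln M2 r))"
proof -
  let ?T = "product_topology (\<lambda>_. cantor_topology) {..<2::nat}"
  \<comment> \<open>Inequalities of truth values are written as disjunctions, for which clopen
    predicates have closure rules.\<close>
  have c: "clopen_pred ?T (\<lambda>g. if even n then \<not> g 0 n \<or> g 1 n else \<not> g 1 n \<or> g 0 n)" for n
    by (cases "even n"; simp only: if_True if_False simp_thms;
        intro clopen_pred_disj clopen_pred_Not clopen_pred_component; simp)
  have "rel_fun 2 (reln M2 r) = (\<Inter>n. {g \<in> topspace ?T. (if even n then \<not> g 0 n \<or> g 1 n else \<not> g 1 n \<or> g 0 n) = True})"
    by (auto simp: rel_fun_M2 le2_def set_eq_iff)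
  also have "closedin ?T \<dots>"
    by (intro closedin_INT closedin_clopen_pred c) auto
  finally show ?thesis .
qed

text \<open>The algebraic content is that the operations of \<open>M1\<close> preserve
  \<open>le2\<close> and that the shift commutes with each of them, negation included.\<close>

lemma alter_ego_12: "alter_ego sig1 M1 sig2 (with_topo cantor_topology M2)"
proof -
  have "is_sub sig1 (rel_fun 2 (reln M2 r)) (pow sig1 M1 {..<2::nat})" for r
    unfolding is_sub_def
  proof (intro conjI allI impI ballI)
    fix f n xs assume f: "opar sig1 f = Some n" and xs: "xs \<in> tuples (rel_fun 2 (reln M2 r)) n"
    show "opn (pow sig1 M1 {..<2::nat}) f xs \<in> rel_fun 2 (reln M2 r)"
      using f xs by (cases rule: opar_sig1_cases)
        (auto simp: tuples_0 tuples_1[simplified] tuples_2 rel_fun_M2 opn_pow intro!: le2_ops)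
  qed (auto simp: rel_fun_M2 carrier_pow)
  moreover have "op_fun 1 UNIV (op2 Shift) \<in> shom sig1 (pow sig1 M1 {..<1::nat}) M1"
  proof (rule shomI)
    fix f n xs assume f: "opar sig1 f = Some n" and xs: "xs \<in> tuples (carrier (pow sig1 M1 {..<1::nat})) n"
    have F: "op_fun 1 UNIV (op2 Shift) g = g 0 \<circ> Suc" if "g \<in> {..<1::nat} \<rightarrow>\<^sub>E UNIV" for g
      using op_fun_simps(2)[OF that, of "op2 Shift"] by simp
    have L: "op_fun 1 UNIV (op2 Shift) (opn (pow sig1 M1 {..<1::nat}) f xs) = op1 f (map (\<lambda>g. g 0) xs) \<circ> Suc"
      by (subst F) (auto simp: opn_pow)
    have R: "map (op_fun 1 UNIV (op2 Shift)) xs = map (\<lambda>g. g 0 \<circ> Suc) xs"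
      by (rule map_cong[OF refl], rule F) (use tuples_memD[OF xs] in \<open>simp add: carrier_pow\<close>)
    show "op_fun 1 UNIV (op2 Shift) (opn (pow sig1 M1 {..<1::nat}) f xs) = opn M1 f (map (op_fun 1 UNIV (op2 Shift)) xs)"
      unfolding L R using f xs
      by (cases rule: opar_sig1_cases) (auto simp: tuples_0 tuples_1[simplified] tuples_2)
  qed (auto simp: op_fun_def carrier_pow)
  ultimately show ?thesis
    using is_structure_M1 is_structure_M2 continuous_op1
    by (simp add: alter_ego_def total_structure_def is_tstructure_def compact_cantor Hausdorff_cantor
        is_structure_def)
qed

text \<open>The same facts read in the opposite direction: operations that commute with the shift
  and preserve \<open>le2\<close> are homomorphisms from powers of \<open>M2\<close> to
  \<open>M2\<close>. The topological side now concerns the shift and \<open>le2\<close>.\<close>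

lemma alter_ego_21: "alter_ego sig2 M2 sig1 (with_topo cantor_topology M1)"
proof -
  have "op_fun n UNIV (op1 f) \<in> shom sig2 (pow sig2 M2 {..<n}) M2" if f: "opar sig1 f = Some n" for f n
  proof (rule shomI)
    fix g m xs assume "opar sig2 g = Some m" and "xs \<in> tuples (carrier (pow sig2 M2 {..<n})) m"
    then obtain x where x: "x \<in> {..<n} \<rightarrow>\<^sub>E UNIV" "g = Shift" "xs = [x]"
      by (auto simp: tuples_1[simplified] carrier_pow)
    show "op_fun n UNIV (op1 f) (opn (pow sig2 M2 {..<n}) g xs) = opn M2 g (map (op_fun n UNIV (op1 f)) xs)"
      using f x by (cases rule: opar_sig1_cases)
        (auto simp: opn_pow op_fun_simps[simplified] fun_eq_iff)
  next
    fix r m xs assume "relar sig2 r = Some m" and xs: "xs \<in> reln (pow sig2 M2 {..<n}) r"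
    then obtain x y where xy: "x \<in> {..<n} \<rightarrow>\<^sub>E UNIV" "y \<in> {..<n} \<rightarrow>\<^sub>E UNIV" "xs = [x, y]"
      "\<And>i. i < n \<Longrightarrow> le2 (x i) (y i)"
      by (auto simp: reln_pow[where n = 2] tuples_2)
    show "map (op_fun n UNIV (op1 f)) xs \<in> reln M2 r"
      using f xy by (cases rule: opar_sig1_cases)
        (auto simp: op_fun_simps[simplified] intro!: le2_ops)
  qed (auto simp: op_fun_def carrier_pow)
  then show ?thesis
    using is_structure_M1 is_structure_M2 continuous_Shift closedin_le2
    by (simp add: alter_ego_def total_structure_def is_tstructure_def compact_cantor Hausdorff_cantor
        is_structure_def)
qed

subsection \<open>Homomorphisms into the two structures\<close>

lemma is_structure_sig1:
  assumes "is_structure sig1 A" "a \<in> carrier A" "b \<in> carrier A"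
  shows "opn A Join [a, b] \<in> carrier A" "opn A Meet [a, b] \<in> carrier A" "opn A Neg [a] \<in> carrier A"
    "opn A Zero [] \<in> carrier A" "opn A One [] \<in> carrier A"
  using assms is_structure_op[OF assms(1), of Join 2 "[a, b]"] is_structure_op[OF assms(1), of Meet 2 "[a, b]"]
    is_structure_op[OF assms(1), of Neg 1 "[a]"] is_structure_op[OF assms(1), of Zero 0 "[]"]
    is_structure_op[OF assms(1), of One 0 "[]"]
  by (simp_all add: tuples_def)

lemma is_structure_lat:
  assumes "is_structure lat_sig A"
  shows "a \<in> carrier A \<Longrightarrow> b \<in> carrier A \<Longrightarrow> opn A Join [a, b] \<in> carrier A"
    "a \<in> carrier A \<Longrightarrow> b \<in> carrier A \<Longrightarrow> opn A Meet [a, b] \<in> carrier A"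
    "opn A Zero [] \<in> carrier A" "opn A One [] \<in> carrier A"
  using is_structure_op[OF assms(1), of Join 2 "[a, b]"] is_structure_op[OF assms(1), of Meet 2 "[a, b]"]
    is_structure_op[OF assms(1), of Zero 0 "[]"] is_structure_op[OF assms(1), of One 0 "[]"]
  by (simp_all add: tuples_def)

lemma shom_lat:
  assumes "h \<in> shom lat_sig A B"
  shows "a \<in> carrier A \<Longrightarrow> b \<in> carrier A \<Longrightarrow> h (opn A Join [a, b]) = opn B Join [h a, h b]"
    "a \<in> carrier A \<Longrightarrow> b \<in> carrier A \<Longrightarrow> h (opn A Meet [a, b]) = opn B Meet [h a, h b]"
    "h (opn A Zero []) = opn B Zero []" "h (opn A One []) = opn B One []"
  using shom_op[OF assms, of Join 2 "[a, b]"] shom_op[OF assms, of Meet 2 "[a, b]"]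
    shom_op[OF assms, of Zero 0 "[]"] shom_op[OF assms, of One 0 "[]"]
  by (simp_all add: tuples_def)

lemma shom_Neg: "h \<in> shom sig1 A B \<Longrightarrow> a \<in> carrier A \<Longrightarrow> h (opn A Neg [a]) = opn B Neg [h a]"
  using shom_op[of h sig1 A B Neg 1 "[a]"] by (simp add: tuples_def)

lemma shom_Shift: "h \<in> shom sig2 A B \<Longrightarrow> a \<in> carrier A \<Longrightarrow> h (opn A Shift [a]) = opn B Shift [h a]"
  using shom_op[of h sig2 A B Shift 1 "[a]"] by (simp add: tuples_def)

lemma shom_Leq: "h \<in> shom sig2 A B \<Longrightarrow> [a, b] \<in> reln A r \<Longrightarrow> [h a, h b] \<in> reln B r"
  using shom_rel[of h sig2 A B r 2 "[a, b]"] by simp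

text \<open>Induction on the coordinate for all elements at once, passing from \<open>a\<close> to
  its negation. Every step reverses the implication, which yields the alternation in
  \<open>le2\<close>.\<close>

lemma shom_M1_le2:
  assumes A: "is_structure sig1 A" and h: "h \<in> shom sig1 A M1" "k \<in> shom sig1 A M1"
    and le: "\<And>a. a \<in> carrier A \<Longrightarrow> h a 0 \<Longrightarrow> k a 0" and a: "a \<in> carrier A"
  shows "le2 (h a) (k a)"
proof -
  have "if even n then h a n \<longrightarrow> k a n else k a n \<longrightarrow> h a n" for n
    using a
  proof (induction n arbitrary: a)
    case (Suc n)
    have N: "opn A Neg [a] \<in> carrier A" by (rule is_structure_sig1(3)[OF A Suc.prems Suc.prems])
    have "h (opn A Neg [a]) n = (\<not> h a (Suc n))" "k (opn A Neg [a]) n = (\<not> k a (Suc n))"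
      using shom_Neg[OF h(1) Suc.prems] shom_Neg[OF h(2) Suc.prems] by simp_all
    then show ?case using Suc.IH[OF N] by (cases "even n") auto
  qed (use le in auto)
  then show ?thesis unfolding le2_def by (metis le_boolI')
qed

lemma le2_antisym: "le2 a b \<Longrightarrow> le2 b a \<Longrightarrow> a = b"
  unfolding le2_def by (intro ext) (metis order_antisym)

lemma shom_M1_eq:
  assumes A: "is_structure sig1 A" and h: "h \<in> shom sig1 A M1" "k \<in> shom sig1 A M1"
    and eq: "\<And>a. a \<in> carrier A \<Longrightarrow> h a 0 = k a 0" and a: "a \<in> carrier A"
  shows "h a = k a"
  using shom_M1_le2[OF A h _ a] shom_M1_le2[OF A h(2,1) _ a] eq by (auto intro: le2_antisym)

text \<open>Coordinate \<open>n + 1\<close> at \<open>a\<close> is coordinate \<open>n\<close> at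
  the shift of \<open>a\<close>, so the comparison keeps its direction. The result is the lattice
  order of \<open>M1\<close>, not \<open>le2\<close>.\<close>

lemma shom_M2_le:
  assumes A: "is_structure sig2 A" and h: "h \<in> shom sig2 A M2" "k \<in> shom sig2 A M2"
    and le: "\<And>a. a \<in> carrier A \<Longrightarrow> h a 0 \<Longrightarrow> k a 0" and a: "a \<in> carrier A"
  shows "h a n \<Longrightarrow> k a n"
  using a
proof (induction n arbitrary: a)
  case (Suc n)
  have N: "opn A Shift [a] \<in> carrier A"
    using is_structure_op[OF A, of Shift 1 "[a]"] Suc.prems by (simp add: tuples_def)
  show ?case using Suc.IH[OF _ N] shom_Shift[OF h(1) Suc.prems(2)] shom_Shift[OF h(2) Suc.prems(2)] Suc.prems(1)
    by simp
qed (use le in auto)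

lemma shom_M2_eq:
  assumes A: "is_structure sig2 A" and h: "h \<in> shom sig2 A M2" "k \<in> shom sig2 A M2"
    and eq: "\<And>a. a \<in> carrier A \<Longrightarrow> h a 0 = k a 0" and a: "a \<in> carrier A"
  shows "h a = k a"
  using shom_M2_le[OF A h _ a] shom_M2_le[OF A h(2,1) _ a] eq by blast

text \<open>Separation is obtained at an unknown coordinate \<open>n\<close>, while
  \<open>omega\<close> reads coordinate 0; n-fold shifting inside \<open>H\<close> bridges the
  gap.\<close>

lemma is_sub_Shift_power:
  assumes H: "is_sub sig2 H (pow sig2 M2 S)" and h: "h \<in> H"
  shows "\<exists>h'\<in>H. \<forall>s\<in>S. h' s 0 = h s n"
  using h
proof (induction n arbitrary: h)
  case (Suc n)
  have "opn (pow sig2 M2 S) Shift [h] \<in> H"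
    using H Suc.prems by (simp add: is_sub_def tuples_def)
  from Suc.IH[OF this] show ?case by (simp add: opn_pow)
qed auto

text \<open>n-fold negation moves coordinate \<open>n\<close> to 0 and complements it
  \<open>n\<close> times; comparison with \<open>odd n\<close> is the exclusive or with this parity,
  matching the alternation in \<open>le2\<close>.\<close>

lemma is_sub_Neg_power:
  assumes H: "is_sub sig1 H (pow sig1 M1 S)" and h: "h \<in> H"
  shows "\<exists>h'\<in>H. \<forall>s\<in>S. h' s 0 = (h s n \<noteq> odd n)"
  using h
proof (induction n arbitrary: h)
  case (Suc n)
  have "opn (pow sig1 M1 S) Neg [h] \<in> H"
    using H Suc.prems by (simp add: is_sub_def tuples_def)
  \<comment> \<open>The complement introduced by this one negation turns the parity of
    \<open>n\<close> into that of \<open>Suc n\<close>.\<close>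
  from Suc.IH[OF this] obtain h' where "h' \<in> H" "\<forall>s\<in>S. h' s 0 = ((\<not> h s (Suc n)) \<noteq> odd n)"
    by (auto simp: opn_pow)
  then show ?case by (intro bexI[of _ h']) auto
qed auto

lemma omega_lat: "omega \<in> shom lat_sig M1 lat2"
proof (rule shomI)
  fix f n xs assume "opar lat_sig f = Some n" "xs \<in> tuples (carrier M1) n"
  then show "omega (opn M1 f xs) = opn lat2 f (map omega xs)"
    by (cases rule: opar_lat_sig_cases) (auto simp: tuples_0 tuples_2 omega_def)
qed auto

lemma omega_ord: "omega \<in> shom ord_sig M2 ord2"
  by (rule shomI) (auto simp: M2_def ord2_def omega_def le2_def)

text \<open>The elements formed by \<open>Meet\<close>, \<open>Join\<close>, \<open>Zero\<close> and
  \<open>One\<close> in \<open>A\<close> serve all homomorphisms alike. Agreement is asked only on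
  the carrier because homomorphisms are extensional, whereas the valuations in use are
  unrestricted.\<close>

lemma lattice_closed_carrier:
  assumes A: "is_structure lat_sig A"
    and Q: "\<And>q. q \<in> Q \<Longrightarrow> \<exists>h\<in>shom lat_sig A lat2. \<forall>a\<in>carrier A. q a = h a"
  shows "lattice_closed (carrier A) Q"
proof -
  note st = is_structure_lat[OF A]
  have meet: "q (opn A Meet [a, b]) = (q a \<and> q b)" and join: "q (opn A Join [a, b]) = (q a \<or> q b)"
    if q: "q \<in> Q" and a: "a \<in> carrier A" "b \<in> carrier A" for q a b
  proof -
    obtain h where h: "h \<in> shom lat_sig A lat2" "\<And>a. a \<in> carrier A \<Longrightarrow> q a = h a" using Q[OF q] by blast
    show "q (opn A Meet [a, b]) = (q a \<and> q b)" "q (opn A Join [a, b]) = (q a \<or> q b)"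
      using h(2) shom_lat[OF h(1)] st a by simp_all
  qed
  have one: "q (opn A One [])" and zero: "\<not> q (opn A Zero [])" if q: "q \<in> Q" for q
  proof -
    obtain h where h: "h \<in> shom lat_sig A lat2" "\<And>a. a \<in> carrier A \<Longrightarrow> q a = h a" using Q[OF q] by blast
    show "q (opn A One [])" "\<not> q (opn A Zero [])"
      using h(2) shom_lat[OF h(1)] st by simp_all
  qed
  show ?thesis
    unfolding lattice_closed_def
  proof (intro conjI ballI)
    show "\<exists>i\<in>carrier A. \<forall>q\<in>Q. q i"
      by (rule bexI[OF _ st(4)], rule ballI, erule one)
    show "\<exists>i\<in>carrier A. \<forall>q\<in>Q. \<not> q i"
      by (rule bexI[OF _ st(3)], rule ballI, erule zero)
    fix a b assume ab: "a \<in> carrier A" "b \<in> carrier A"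
    show "\<exists>k\<in>carrier A. \<forall>q\<in>Q. q k = (q a \<and> q b)"
      by (rule bexI[OF _ st(2)[OF ab]], rule ballI, rule meet[OF _ ab])
    show "\<exists>k\<in>carrier A. \<forall>q\<in>Q. q k = (q a \<or> q b)"
      by (rule bexI[OF _ st(1)[OF ab]], rule ballI, rule join[OF _ ab])
  qed
qed

lemma shom_M1_omega:
  assumes A: "is_structure lat_sig A" and h: "h \<in> shom lat_sig A M1"
  shows "\<exists>k\<in>shom lat_sig A lat2. \<forall>a\<in>carrier A. h a 0 = k a"
  using shom_compose[OF A h omega_lat] by (intro bexI) (auto simp: omega_def)

section \<open>Full dualities\<close>

lemma thom_clopen:
  "h \<in> thom \<Sigma> X (with_topo cantor_topology M) \<Longrightarrow> clopen_pred (topo X) (\<lambda>x. h x n)"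
  by (simp add: thom_def continuous_map_cantor)

lemma clopen_projection_dualD:
  "a \<in> carrier A \<Longrightarrow> clopen_pred (topo (dualD \<Sigma> P \<Sigma>' (with_topo cantor_topology M) A)) (\<lambda>h. h a n)"
  using continuous_projection_dualD[of a A \<Sigma> P \<Sigma>' "with_topo cantor_topology M"]
  by (simp add: continuous_map_cantor)

lemma is_structure_lat_sig1: "is_structure sig1 A \<Longrightarrow> is_structure lat_sig A"
  by (rule is_structure_subsignature[OF subsignature_lat])

lemma shom_lat_sig1: "h \<in> shom sig1 A B \<Longrightarrow> h \<in> shom lat_sig A B"
  using shom_subsignature[OF subsignature_lat] by blast

lemma shom_M1_omega':
  "is_structure sig1 A \<Longrightarrow> h \<in> shom sig1 A M1 \<Longrightarrow> \<exists>k\<in>shom lat_sig A lat2. \<forall>a\<in>carrier A. h a 0 = k a"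
  by (intro shom_M1_omega is_structure_lat_sig1 shom_lat_sig1)

lemma lattice_closed_insert_hom:
  assumes A: "is_structure sig1 A" and \<beta>: "\<beta> \<in> shom sig1 A M1"
    and e: "\<And>i. i \<in> I \<Longrightarrow> e i \<in> shom sig1 A M1" "\<And>i a. i \<in> I \<Longrightarrow> a \<in> carrier A \<Longrightarrow> p i a = e i a 0"
  shows "lattice_closed (carrier A) (insert (\<lambda>a. \<beta> a 0) (p ` I))"
proof (rule lattice_closed_carrier[OF is_structure_lat_sig1[OF A]])
  fix q assume "q \<in> insert (\<lambda>a. \<beta> a 0) (p ` I)"
  then consider "q = (\<lambda>a. \<beta> a 0)" | i where "i \<in> I" "q = p i" by blast
  then show "\<exists>k\<in>shom lat_sig A lat2. \<forall>a\<in>carrier A. q a = k a"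
  proof cases
    case 1
    then show ?thesis using shom_M1_omega'[OF A \<beta>] by simp
  next
    case (2 i)
    then show ?thesis using shom_M1_omega'[OF A e(1)[OF 2(1)]] e(2)[OF 2(1)] by simp
  qed
qed

lemma lattice_closed_homs:
  assumes A: "is_structure sig1 A"
    and e: "\<And>i. i \<in> I \<Longrightarrow> e i \<in> shom sig1 A M1" "\<And>i a. i \<in> I \<Longrightarrow> a \<in> carrier A \<Longrightarrow> p i a = e i a 0"
  shows "lattice_closed (carrier A) (p ` I)"
proof (rule lattice_closed_carrier[OF is_structure_lat_sig1[OF A]])
  fix q assume "q \<in> p ` I"
  then obtain i where i: "i \<in> I" "q = p i" by blast
  show "\<exists>k\<in>shom lat_sig A lat2. \<forall>a\<in>carrier A. q a = k a"
    using shom_M1_omega'[OF A e(1)[OF i(1)]] e(2)[OF i(1)] i(2) by simp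
qed

text \<open>A comparison at coordinate 0 spreads to all coordinates and so becomes an equation.
  Since \<open>sig1\<close> has no order symbol, this is the form in which homomorphisms of the dual
  can preserve it.\<close>

lemma Meet_eq_left:
  assumes A: "is_structure sig2 A" and h: "h \<in> shom sig2 A M2" "k \<in> shom sig2 A M2"
    and le: "\<And>a. a \<in> carrier A \<Longrightarrow> h a 0 \<Longrightarrow> k a 0"
  shows "opn (pow sig1 M1 (carrier A)) Meet [h, k] = h"
proof
  fix a
  \<comment> \<open>Off the carrier both sides take the default value of extensional
    functions.\<close>
  show "opn (pow sig1 M1 (carrier A)) Meet [h, k] a = h a"
    using shom_M2_le[OF A h le] extensional_arb[OF shom_extensional[OF h(1)]]
    by (cases "a \<in> carrier A") (auto simp: opn_pow)
qed

lemma Leq_pow_M2: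
  "h \<in> S \<rightarrow>\<^sub>E UNIV \<Longrightarrow> k \<in> S \<rightarrow>\<^sub>E UNIV \<Longrightarrow> (\<And>s. s \<in> S \<Longrightarrow> le2 (h s) (k s)) \<Longrightarrow> [h, k] \<in> reln (pow sig2 M2 S) Leq"
  by (simp add: reln_pow[where n = 2] tuples_2)

lemma is_structure_dualE_12:
  "X \<in> IScP sig2 (with_topo cantor_topology M2) \<Longrightarrow>
    is_structure sig1 (dualE sig1 M1 sig2 (with_topo cantor_topology M2) X)"
  unfolding dualE_def
  by (intro is_structure_sub_pow is_sub_thom alter_ego_12 alter_ego_21 IScP_is_structure IScP_topspace)

lemma is_structure_dualE_21:
  "X \<in> IScP sig1 (with_topo cantor_topology M1) \<Longrightarrow>
    is_structure sig2 (dualE sig2 M2 sig1 (with_topo cantor_topology M1) X)"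
  unfolding dualE_def
  by (intro is_structure_sub_pow is_sub_thom alter_ego_12 alter_ego_21 IScP_is_structure IScP_topspace)

text \<open>Points are the homomorphisms on \<open>A\<close>; predicates are the elements of
  \<open>A\<close>, which form a lattice. Homomorphisms comparable at coordinate 0 are related by
  \<open>le2\<close>, and \<alpha> preserves this relation, so \<alpha> is monotone at coordinate
  0.\<close>

lemma evalA_surj_12:
  assumes A: "A \<in> ISP sig1 M1"
    and \<alpha>: "\<alpha> \<in> thom sig2 (dualD sig1 M1 sig2 (with_topo cantor_topology M2) A) (with_topo cantor_topology M2)"
  shows "\<exists>a\<in>carrier A. \<forall>h\<in>shom sig1 A M1. \<alpha> h = h a"
proof -
  let ?D = "dualD sig1 M1 sig2 (with_topo cantor_topology M2) A"
  note sA = ISP_is_structure[OF A]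
  have \<alpha>s: "\<alpha> \<in> shom sig2 ?D M2" using \<alpha> by (simp add: thom_def)
  have "\<exists>a\<in>carrier A. \<forall>h\<in>topspace (topo ?D). h a 0 = \<alpha> h 0"
  proof (rule monotone_in_lattice)
    show "compact_space (topo ?D)" by (rule compact_dualD[OF alter_ego_12 sA])
    show "lattice_closed (carrier A) ((\<lambda>h a. h a 0) ` topspace (topo ?D))"
      unfolding topspace_dualD[OF alter_ego_12]
      using is_structure_lat_sig1[OF sA] shom_M1_omega'[OF sA] by (intro lattice_closed_carrier) auto
    fix h k assume "h \<in> topspace (topo ?D)" "k \<in> topspace (topo ?D)" and \<alpha>hk: "\<alpha> h 0" "\<not> \<alpha> k 0"
    then have h: "h \<in> shom sig1 A M1" "k \<in> shom sig1 A M1"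
      unfolding topspace_dualD[OF alter_ego_12] by simp_all
    show "\<exists>a\<in>carrier A. h a 0 \<and> \<not> k a 0"
    proof (rule ccontr)
      assume "\<not> ?thesis"
      then have "le2 (h a) (k a)" if "a \<in> carrier A" for a
        using shom_M1_le2[OF sA h _ that] by blast
      then have "[h, k] \<in> reln ?D Leq"
        using Leq_pow_M2[of h "carrier A" k] h shom_subset_PiE[of sig1 A M1] by auto
      from shom_Leq[OF \<alpha>s this] \<alpha>hk show False by (auto simp: le2_def)
    qed
  qed (erule clopen_projection_dualD, rule thom_clopen[OF \<alpha>])
  then obtain a where a: "a \<in> carrier A" "\<forall>h\<in>shom sig1 A M1. h a 0 = \<alpha> h 0"
    unfolding topspace_dualD[OF alter_ego_12] by blast
  have ev: "evalA sig1 M1 A a \<in> shom sig2 ?D M2"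
    using evalA_in_thom[OF alter_ego_12 sA a(1)] by (simp add: thom_def)
  \<comment> \<open>Both maps are homomorphisms from the dual of \<open>A\<close> into
    \<open>M2\<close>, so coordinate 0 determines the others.\<close>
  have "\<alpha> h = evalA sig1 M1 A a h" if "h \<in> shom sig1 A M1" for h
    by (rule shom_M2_eq[OF is_structure_dualD[OF alter_ego_12 sA] \<alpha>s ev])
      (use a that in \<open>auto simp: evalA_def\<close>)
  then show ?thesis using a(1) by (auto simp: evalA_def)
qed

text \<open>The predicates are the continuous homomorphisms on \<open>X\<close>; their structure of
  type \<open>sig1\<close> supplies the lattice, and \<beta> at coordinate 0 is a lattice
  homomorphism on it. Its compatibility with the order is tested on the equation from
  \<open>Meet_eq_left\<close>.\<close>

lemma evalX_surj_12:
  assumes X: "X \<in> IScP sig2 (with_topo cantor_topology M2)"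
    and \<beta>: "\<beta> \<in> shom sig1 (dualE sig1 M1 sig2 (with_topo cantor_topology M2) X) M1"
  shows "\<exists>x\<in>carrier X. \<forall>h\<in>thom sig2 X (with_topo cantor_topology M2). \<beta> h = h x"
proof -
  let ?E = "dualE sig1 M1 sig2 (with_topo cantor_topology M2) X"
  note sX = IScP_is_structure[OF X] and tX = IScP_topspace[OF X]
  let ?H = "thom sig2 X (with_topo cantor_topology M2)"
  note sub = is_sub_thom[OF alter_ego_12 alter_ego_21 sX tX]
  note sE = is_structure_dualE_12[OF X]
  have ev: "(\<lambda>h\<in>?H. h x) \<in> shom sig1 ?E M1" if "x \<in> carrier X" for x
    using shom_eval[OF sub that] by (simp add: dualE_def)
  have "\<exists>x\<in>topspace (topo X). \<forall>h\<in>?H. h x 0 = \<beta> h 0"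
  proof (rule hom_is_point)
    show "compact_space (topo X)" using IScP_compact[OF X] compact_cantor by simp
    show "lattice_closed ?H (insert (\<lambda>h. \<beta> h 0) ((\<lambda>x h. h x 0) ` topspace (topo X)))"
      using lattice_closed_insert_hom[OF sE \<beta> ev, of "topspace (topo X)" "\<lambda>x. x" "\<lambda>x h. h x 0"] tX by simp
    fix h k assume h: "h \<in> ?H" "k \<in> ?H" and \<beta>hk: "\<beta> h 0" "\<not> \<beta> k 0"
    then have hk: "h \<in> shom sig2 X M2" "k \<in> shom sig2 X M2" by (auto simp: thom_def)
    show "\<exists>x\<in>topspace (topo X). h x 0 \<and> \<not> k x 0"
    proof (rule ccontr)
      assume "\<not> ?thesis"
      then have "opn ?E Meet [h, k] = h"
        using Meet_eq_left[OF sX hk] tX by auto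
      then have "\<beta> h = op1 Meet [\<beta> h, \<beta> k]"
        using shom_lat(2)[OF shom_lat_sig1[OF \<beta>], of h k] h by simp
      then have "\<beta> h 0 = (\<beta> h 0 \<and> \<beta> k 0)" by (metis op1.simps(2))
      then show False using \<beta>hk by simp
    qed
  qed (rule thom_clopen)
  then obtain x where x: "x \<in> carrier X" "\<forall>h\<in>?H. h x 0 = \<beta> h 0" using tX by auto
  have "\<beta> h = (\<lambda>h\<in>?H. h x) h" if "h \<in> ?H" for h
    by (rule shom_M1_eq[OF sE \<beta> ev[OF x(1)]]) (use x that in auto)
  then show ?thesis using x(1) by auto
qed

text \<open>\<open>A\<close> carries only an order and a shift, but its dual is a lattice, so the
  points are combined rather than the predicates. At coordinate 0, \<alpha> is a clopen lattice
  homomorphism on this dual.\<close>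

lemma evalA_surj_21:
  assumes A: "A \<in> ISP sig2 M2"
    and \<alpha>: "\<alpha> \<in> thom sig1 (dualD sig2 M2 sig1 (with_topo cantor_topology M1) A) (with_topo cantor_topology M1)"
  shows "\<exists>a\<in>carrier A. \<forall>h\<in>shom sig2 A M2. \<alpha> h = h a"
proof -
  let ?D = "dualD sig2 M2 sig1 (with_topo cantor_topology M1) A"
  note sA = ISP_is_structure[OF A]
  note sD = is_structure_dualD[OF alter_ego_21 sA]
  have \<alpha>s: "\<alpha> \<in> shom sig1 ?D M1" using \<alpha> by (simp add: thom_def)
  have ev: "evalA sig2 M2 A a \<in> shom sig1 ?D M1" if "a \<in> carrier A" for a
    using evalA_in_thom[OF alter_ego_21 sA that] by (simp add: thom_def)
  have "\<exists>a\<in>carrier A. \<forall>h\<in>topspace (topo ?D). h a 0 = \<alpha> h 0"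
  proof (rule hom_in_family)
    show "compact_space (topo ?D)" by (rule compact_dualD[OF alter_ego_21 sA])
    show "lattice_closed (topspace (topo ?D)) (insert (\<lambda>h. \<alpha> h 0) ((\<lambda>a h. h a 0) ` carrier A))"
      unfolding topspace_dualD[OF alter_ego_21]
      using lattice_closed_insert_hom[OF sD \<alpha>s ev, of "carrier A" "\<lambda>a. a" "\<lambda>a h. h a 0"]
      by (simp add: evalA_def)
    fix h k assume "h \<in> topspace (topo ?D)" "k \<in> topspace (topo ?D)" and \<alpha>hk: "\<alpha> h 0" "\<not> \<alpha> k 0"
    then have h: "h \<in> shom sig2 A M2" "k \<in> shom sig2 A M2"
      unfolding topspace_dualD[OF alter_ego_21] by simp_all
    show "\<exists>a\<in>carrier A. h a 0 \<and> \<not> k a 0"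
    proof (rule ccontr)
      assume "\<not> ?thesis"
      then have "opn ?D Meet [h, k] = h" using Meet_eq_left[OF sA h] by auto
      then have "\<alpha> h = op1 Meet [\<alpha> h, \<alpha> k]"
        using shom_lat(2)[OF shom_lat_sig1[OF \<alpha>s], of h k] h by simp
      then have "\<alpha> h 0 = (\<alpha> h 0 \<and> \<alpha> k 0)" by (metis op1.simps(2))
      then show False using \<alpha>hk by simp
    qed
  qed (erule clopen_projection_dualD, rule thom_clopen[OF \<alpha>])
  then obtain a where a: "a \<in> carrier A" "\<forall>h\<in>shom sig2 A M2. h a 0 = \<alpha> h 0"
    unfolding topspace_dualD[OF alter_ego_21] by blast
  have "\<alpha> h = evalA sig2 M2 A a h" if "h \<in> shom sig2 A M2" for h
    by (rule shom_M1_eq[OF sD \<alpha>s ev[OF a(1)]]) (use a that in \<open>auto simp: evalA_def\<close>)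
  then show ?thesis using a(1) by (auto simp: evalA_def)
qed

text \<open>The lattice is \<open>X\<close> itself. Its dual carries only an order and a shift, so
  what \<beta> provides at coordinate 0 is monotonicity, and \<open>monotone_is_point\<close> asks
  for no more.\<close>

lemma evalX_surj_21:
  assumes X: "X \<in> IScP sig1 (with_topo cantor_topology M1)"
    and \<beta>: "\<beta> \<in> shom sig2 (dualE sig2 M2 sig1 (with_topo cantor_topology M1) X) M2"
  shows "\<exists>x\<in>carrier X. \<forall>h\<in>thom sig1 X (with_topo cantor_topology M1). \<beta> h = h x"
proof -
  let ?E = "dualE sig2 M2 sig1 (with_topo cantor_topology M1) X"
  note sX = IScP_is_structure[OF X] and tX = IScP_topspace[OF X]
  let ?H = "thom sig1 X (with_topo cantor_topology M1)"
  note sub = is_sub_thom[OF alter_ego_21 alter_ego_12 sX tX]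
  note sE = is_structure_dualE_21[OF X]
  have "\<exists>x\<in>topspace (topo X). \<forall>h\<in>?H. h x 0 = \<beta> h 0"
  proof (rule monotone_is_point)
    show "compact_space (topo X)" using IScP_compact[OF X] compact_cantor by simp
    show "lattice_closed (topspace (topo X)) ((\<lambda>h x. h x 0) ` ?H)"
      unfolding tX using is_structure_lat_sig1[OF sX] shom_M1_omega'[OF sX]
      by (intro lattice_closed_carrier) (auto simp: thom_def)
    fix h k assume h: "h \<in> ?H" "k \<in> ?H" and \<beta>hk: "\<beta> h 0" "\<not> \<beta> k 0"
    then have hk: "h \<in> shom sig1 X M1" "k \<in> shom sig1 X M1" by (auto simp: thom_def)
    show "\<exists>x\<in>topspace (topo X). h x 0 \<and> \<not> k x 0"
    proof (rule ccontr)
      assume "\<not> ?thesis"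
      then have "le2 (h x) (k x)" if "x \<in> carrier X" for x
        using shom_M1_le2[OF sX hk _ that] tX by blast
      then have "[h, k] \<in> reln ?E Leq"
        using Leq_pow_M2[of h "carrier X" k] h hk shom_subset_PiE[of sig1 X M1] by (auto simp: dualE_def)
      from shom_Leq[OF \<beta> this] \<beta>hk show False by (auto simp: le2_def)
    qed
  qed (rule thom_clopen)
  then obtain x where x: "x \<in> carrier X" "\<forall>h\<in>?H. h x 0 = \<beta> h 0" using tX by auto
  have ev: "(\<lambda>h\<in>?H. h x) \<in> shom sig2 ?E M2"
    using shom_eval[OF sub x(1)] by (simp add: dualE_def)
  have "\<beta> h = (\<lambda>h\<in>?H. h x) h" if "h \<in> ?H" for h
    by (rule shom_M2_eq[OF sE \<beta> ev]) (use x that in auto)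
  then show ?thesis using x(1) by auto
qed

lemma fully_dualises_12: "fully_dualises TYPE('a) TYPE('x) sig2 M2_T sig1 M1"
  unfolding M2_T_def
  by (rule fully_dualisesI[OF alter_ego_12 alter_ego_21 evalA_surj_12 evalX_surj_12])

lemma fully_dualises_21: "fully_dualises TYPE('a) TYPE('x) sig1 M1_T sig2 M2"
  unfolding M1_T_def
  by (rule fully_dualisesI[OF alter_ego_21 alter_ego_12 evalA_surj_21 evalX_surj_21])

subsection \<open>Extension along embeddings\<close>

text \<open>On the side of \<open>A\<close> everything refers to the lattice reduct, so
  \<open>f\<close> can be an arbitrary two-valued lattice homomorphism. The points are the
  homomorphisms on \<open>B\<close>, and \<open>A\<close> serves as the lattice of predicates on
  them.\<close>

lemma extend_lattice_hom:
  assumes B: "B \<in> ISP sig1 M1" and A: "is_structure lat_sig A"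
    and \<phi>: "\<phi> \<in> shom lat_sig A B" "inj_on \<phi> (carrier A)" and f: "f \<in> shom lat_sig A lat2"
  shows "\<exists>h\<in>shom sig1 B M1. \<forall>a\<in>carrier A. h (\<phi> a) 0 = f a"
proof -
  let ?D = "dualD sig1 M1 sig2 (with_topo cantor_topology M2) B"
  note sB = ISP_is_structure[OF B]
  note sub = is_sub_shom[OF alter_ego_12 sB, simplified]
  have \<phi>B: "\<phi> a \<in> carrier B" if "a \<in> carrier A" for a using shom_carrier[OF \<phi>(1) that] .
  have "\<exists>h\<in>topspace (topo ?D). \<forall>a\<in>carrier A. h (\<phi> a) 0 = f a"
  proof (rule hom_is_point)
    show "compact_space (topo ?D)" by (rule compact_dualD[OF alter_ego_12 sB])
    show "lattice_closed (carrier A) (insert f ((\<lambda>h a. h (\<phi> a) 0) ` topspace (topo ?D)))"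
      unfolding topspace_dualD[OF alter_ego_12]
    proof (rule lattice_closed_carrier[OF A])
      fix q assume "q \<in> insert f ((\<lambda>h a. h (\<phi> a) 0) ` shom sig1 B M1)"
      then consider "q = f" | h where "h \<in> shom sig1 B M1" "q = (\<lambda>a. h (\<phi> a) 0)" by blast
      then show "\<exists>k\<in>shom lat_sig A lat2. \<forall>a\<in>carrier A. q a = k a"
      proof cases
        case (2 h)
        show ?thesis
          using shom_M1_omega[OF A shom_compose[OF A \<phi>(1) shom_lat_sig1[OF 2(1)]]] 2(2) by auto
      qed (use f in blast)
    qed
    fix a b assume ab: "a \<in> carrier A" "b \<in> carrier A" "f a" "\<not> f b"
    have m: "opn A Meet [a, b] \<in> carrier A" using is_structure_lat(2)[OF A ab(1,2)] .
    \<comment> \<open>That \<open>a\<close> does not lie below \<open>b\<close> is expressed by an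
      inequality of elements, which injectivity of \<phi> carries to \<open>B\<close>, where
      homomorphisms into \<open>M1\<close> separate.\<close>
    have "f (opn A Meet [a, b]) \<noteq> f a" using shom_lat(2)[OF f ab(1,2)] ab(3,4) by simp
    then have "\<phi> (opn A Meet [a, b]) \<noteq> \<phi> a" using inj_onD[OF \<phi>(2) _ m ab(1)] by metis
    then obtain h where h: "h \<in> shom sig1 B M1" "h (\<phi> (opn A Meet [a, b])) \<noteq> h (\<phi> a)"
      using ISP_separates[OF B \<phi>B[OF m] \<phi>B[OF ab(1)]] by blast
    have "h (\<phi> (opn A Meet [a, b])) = (\<lambda>n. h (\<phi> a) n \<and> h (\<phi> b) n)"
      using shom_lat(2)[OF \<phi>(1) ab(1,2)] shom_lat(2)[OF shom_lat_sig1[OF h(1)] \<phi>B[OF ab(1)] \<phi>B[OF ab(2)]]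
      by simp
    then obtain n where n: "h (\<phi> a) n" "\<not> h (\<phi> b) n" using h(2) by (auto simp: fun_eq_iff)
    \<comment> \<open>The shift on the dual of \<open>B\<close> moves the separating coordinate
      \<open>n\<close> to 0.\<close>
    obtain h' where "h' \<in> shom sig1 B M1" "\<forall>s\<in>carrier B. h' s 0 = h s n"
      using is_sub_Shift_power[OF sub h(1)] by blast
    then show "\<exists>h\<in>topspace (topo ?D). h (\<phi> a) 0 \<and> \<not> h (\<phi> b) 0"
      unfolding topspace_dualD[OF alter_ego_12] using n \<phi>B ab by (intro bexI[of _ h']) auto
  qed (rule clopen_projection_dualD, rule \<phi>B)
  then show ?thesis unfolding topspace_dualD[OF alter_ego_12] .
qed

lemma not_le2_cases:
  assumes "\<not> le2 a b"
  obtains n where "even n" "a n" "\<not> b n" | n where "odd n" "\<not> a n" "b n"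
  using assms by (auto simp: le2_def)

lemma extend_monotone_clopen:
  assumes Y: "Y \<in> IScP sig2 (with_topo cantor_topology M2)"
    and T: "compact_space T" and \<phi>: "continuous_map T (topo Y) \<phi>" and f: "clopen_pred T f"
    and mono: "\<And>x y. x \<in> topspace T \<Longrightarrow> y \<in> topspace T \<Longrightarrow> [\<phi> x, \<phi> y] \<in> reln Y Leq \<Longrightarrow> f x \<Longrightarrow> f y"
  shows "\<exists>h\<in>thom sig2 Y (with_topo cantor_topology M2). \<forall>x\<in>topspace T. h (\<phi> x) 0 = f x"
proof -
  let ?E = "dualE sig1 M1 sig2 (with_topo cantor_topology M2) Y"
  let ?H = "thom sig2 Y (with_topo cantor_topology M2)"
  note sY = IScP_is_structure[OF Y] and tY = IScP_topspace[OF Y]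
  note sub = is_sub_thom[OF alter_ego_12 alter_ego_21 sY tY]
  note sE = is_structure_dualE_12[OF Y]
  have \<phi>Y: "\<phi> x \<in> carrier Y" if "x \<in> topspace T" for x
    using continuous_map_image_subset_topspace[OF \<phi>] that tY by auto
  have ev: "(\<lambda>h\<in>?H. h y) \<in> shom sig1 ?E M1" if "y \<in> carrier Y" for y
    using shom_eval[OF sub that] by (simp add: dualE_def)
  show ?thesis
  proof (rule monotone_in_lattice[OF T _ f])
    show "clopen_pred T (\<lambda>x. h (\<phi> x) 0)" if "h \<in> ?H" for h
      using continuous_map_compose[OF \<phi> thom_clopen[OF that]] by (simp add: o_def)
    show "lattice_closed ?H ((\<lambda>x h. h (\<phi> x) 0) ` topspace T)"
      using lattice_closed_homs[OF sE ev, of "topspace T" \<phi> "\<lambda>x h. h (\<phi> x) 0"] \<phi>Y by simp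
    fix x y assume xy: "x \<in> topspace T" "y \<in> topspace T" "f x" "\<not> f y"
    have "[\<phi> x, \<phi> y] \<notin> reln Y Leq" using mono xy by blast
    then obtain h where h: "h \<in> ?H" "\<not> le2 (h (\<phi> x)) (h (\<phi> y))"
      using IScP_reflects[OF Y, of Leq 2 "[\<phi> x, \<phi> y]"] \<phi>Y xy by (auto simp: tuples_2)
    \<comment> \<open>Failure of \<open>le2\<close> reads true, false at an even coordinate and
      false, true at an odd one; the exclusive or with the parity makes both read true,
      false.\<close>
    obtain n where n: "(h (\<phi> x) n \<noteq> odd n) \<and> \<not> (h (\<phi> y) n \<noteq> odd n)"
      using h(2) by (auto elim: not_le2_cases)
    obtain h' where "h' \<in> ?H" "\<forall>s\<in>carrier Y. h' s 0 = (h s n \<noteq> odd n)"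
      using is_sub_Neg_power[OF sub h(1)] by blast
    then show "\<exists>h\<in>?H. h (\<phi> x) 0 \<and> \<not> h (\<phi> y) 0"
      using n \<phi>Y xy by (intro bexI[of _ h']) auto
  qed
qed

text \<open>The homomorphisms on \<open>B\<close> form a compact lattice of points, so
  \<open>A\<close> may be any set and \<open>f\<close> any function monotone for the order pulled
  back from \<open>B\<close>.\<close>

lemma extend_monotone:
  assumes B: "B \<in> ISP sig2 M2" and \<phi>: "\<And>a. a \<in> A \<Longrightarrow> \<phi> a \<in> carrier B"
    and mono: "\<And>a b. a \<in> A \<Longrightarrow> b \<in> A \<Longrightarrow> [\<phi> a, \<phi> b] \<in> reln B Leq \<Longrightarrow> f a \<Longrightarrow> f b"
  shows "\<exists>h\<in>shom sig2 B M2. \<forall>a\<in>A. h (\<phi> a) 0 = f a"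
proof -
  let ?D = "dualD sig2 M2 sig1 (with_topo cantor_topology M1) B"
  note sB = ISP_is_structure[OF B]
  note sub = is_sub_shom[OF alter_ego_21 sB, simplified]
  note sD = is_structure_dualD[OF alter_ego_21 sB]
  have ev: "evalA sig2 M2 B b \<in> shom sig1 ?D M1" if "b \<in> carrier B" for b
    using evalA_in_thom[OF alter_ego_21 sB that] by (simp add: thom_def)
  have "\<exists>h\<in>topspace (topo ?D). \<forall>a\<in>A. h (\<phi> a) 0 = f a"
  proof (rule monotone_is_point)
    show "compact_space (topo ?D)" by (rule compact_dualD[OF alter_ego_21 sB])
    show "lattice_closed (topspace (topo ?D)) ((\<lambda>a h. h (\<phi> a) 0) ` A)"
      unfolding topspace_dualD[OF alter_ego_21]
      using lattice_closed_homs[OF sD ev, of A \<phi> "\<lambda>a h. h (\<phi> a) 0"] \<phi> by (simp add: evalA_def)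
    fix a b assume ab: "a \<in> A" "b \<in> A" "f a" "\<not> f b"
    have "[\<phi> a, \<phi> b] \<notin> reln B Leq" using mono ab by blast
    then obtain h where h: "h \<in> shom sig2 B M2" "\<not> le2 (h (\<phi> a)) (h (\<phi> b))"
      using ISP_reflects[OF B, of Leq 2 "[\<phi> a, \<phi> b]"] \<phi> ab by (auto simp: tuples_2)
    obtain n where n: "(h (\<phi> a) n \<noteq> odd n) \<and> \<not> (h (\<phi> b) n \<noteq> odd n)"
      using h(2) by (auto elim: not_le2_cases)
    obtain h' where "h' \<in> shom sig2 B M2" "\<forall>s\<in>carrier B. h' s 0 = (h s n \<noteq> odd n)"
      using is_sub_Neg_power[OF sub h(1)] by blast
    then show "\<exists>h\<in>topspace (topo ?D). h (\<phi> a) 0 \<and> \<not> h (\<phi> b) 0"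
      unfolding topspace_dualD[OF alter_ego_21] using n \<phi> ab by (intro bexI[of _ h']) auto
  qed (rule clopen_projection_dualD, rule \<phi>)
  then show ?thesis unfolding topspace_dualD[OF alter_ego_21] .
qed

text \<open>Now the elements of \<open>X\<close> are the points and form the lattice;
  \<open>f\<close> is shown to be one of the predicates induced by the dual of
  \<open>Y\<close>.\<close>

lemma extend_clopen_lattice_hom:
  assumes Y: "Y \<in> IScP sig1 (with_topo cantor_topology M1)"
    and X: "is_structure lat_sig X" "topspace (topo X) = carrier X" "compact_space (topo X)"
    and \<phi>: "\<phi> \<in> shom lat_sig X Y" "inj_on \<phi> (carrier X)" "continuous_map (topo X) (topo Y) \<phi>"
    and f: "f \<in> shom lat_sig X lat2" "clopen_pred (topo X) f"
  shows "\<exists>h\<in>thom sig1 Y (with_topo cantor_topology M1). \<forall>x\<in>carrier X. h (\<phi> x) 0 = f x"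
proof -
  let ?H = "thom sig1 Y (with_topo cantor_topology M1)"
  note sY = IScP_is_structure[OF Y] and tY = IScP_topspace[OF Y]
  note sub = is_sub_thom[OF alter_ego_21 alter_ego_12 sY tY]
  have \<phi>Y: "\<phi> x \<in> carrier Y" if "x \<in> carrier X" for x using shom_carrier[OF \<phi>(1) that] .
  have "\<exists>h\<in>?H. \<forall>x\<in>topspace (topo X). h (\<phi> x) 0 = f x"
  proof (rule hom_in_family[OF X(3) _ f(2)])
    show "clopen_pred (topo X) (\<lambda>x. h (\<phi> x) 0)" if "h \<in> ?H" for h
      using continuous_map_compose[OF \<phi>(3) thom_clopen[OF that]] by (simp add: o_def)
    show "lattice_closed (topspace (topo X)) (insert f ((\<lambda>h x. h (\<phi> x) 0) ` ?H))"
      unfolding X(2)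
    proof (rule lattice_closed_carrier[OF X(1)])
      fix q assume "q \<in> insert f ((\<lambda>h x. h (\<phi> x) 0) ` ?H)"
      then consider "q = f" | h where "h \<in> shom sig1 Y M1" "q = (\<lambda>x. h (\<phi> x) 0)"
        by (auto simp: thom_def)
      then show "\<exists>k\<in>shom lat_sig X lat2. \<forall>x\<in>carrier X. q x = k x"
      proof cases
        case (2 h)
        show ?thesis
          using shom_M1_omega[OF X(1) shom_compose[OF X(1) \<phi>(1) shom_lat_sig1[OF 2(1)]]] 2(2) by auto
      qed (use f in blast)
    qed
    fix a b assume "a \<in> topspace (topo X)" "b \<in> topspace (topo X)" "f a" "\<not> f b"
    then have ab: "a \<in> carrier X" "b \<in> carrier X" "f a" "\<not> f b" by (simp_all add: X)
    have m: "opn X Meet [a, b] \<in> carrier X" using is_structure_lat(2)[OF X(1) ab(1,2)] .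
    have "f (opn X Meet [a, b]) \<noteq> f a" using shom_lat(2)[OF f(1) ab(1,2)] ab(3,4) by simp
    then have "\<phi> (opn X Meet [a, b]) \<noteq> \<phi> a" using inj_onD[OF \<phi>(2) _ m ab(1)] by metis
    then obtain h where h: "h \<in> ?H" "h (\<phi> (opn X Meet [a, b])) \<noteq> h (\<phi> a)"
      using IScP_separates[OF Y \<phi>Y[OF m] \<phi>Y[OF ab(1)]] by blast
    then have h': "h \<in> shom sig1 Y M1" by (simp add: thom_def)
    have "h (\<phi> (opn X Meet [a, b])) = (\<lambda>n. h (\<phi> a) n \<and> h (\<phi> b) n)"
      using shom_lat(2)[OF \<phi>(1) ab(1,2)] shom_lat(2)[OF shom_lat_sig1[OF h'] \<phi>Y[OF ab(1)] \<phi>Y[OF ab(2)]]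
      by simp
    then obtain n where n: "h (\<phi> a) n" "\<not> h (\<phi> b) n" using h(2) by (auto simp: fun_eq_iff)
    obtain k where "k \<in> ?H" "\<forall>s\<in>carrier Y. k s 0 = h s n"
      using is_sub_Shift_power[OF sub h(1)] by blast
    then show "\<exists>h\<in>?H. h (\<phi> a) 0 \<and> \<not> h (\<phi> b) 0"
      using n \<phi>Y ab by (intro bexI[of _ k]) auto
  qed
  then show ?thesis by (simp add: X)
qed

section \<open>Injectivity\<close>

lemma sembD:
  assumes "semb \<Sigma> \<phi> A B"
  shows "\<phi> \<in> shom \<Sigma> A B" and "inj_on \<phi> (carrier A)"
    and "relar \<Sigma> r = Some n \<Longrightarrow> xs \<in> tuples (carrier A) n \<Longrightarrow> map \<phi> xs \<in> reln B r \<Longrightarrow> xs \<in> reln A r"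
proof -
  obtain C \<psi> where C: "is_sub \<Sigma> C B" and \<phi>: "\<phi> \<in> shom \<Sigma> A (sub B C)"
    and \<psi>: "\<psi> \<in> shom \<Sigma> (sub B C) A" "\<And>a. a \<in> carrier A \<Longrightarrow> \<psi> (\<phi> a) = a"
    using assms by (auto simp: semb_def siso_def)
  have \<phi>C: "\<phi> a \<in> C" if "a \<in> carrier A" for a using shom_carrier[OF \<phi> that] by simp
  show "\<phi> \<in> shom \<Sigma> A B" using \<phi> C by (auto simp: shom_def is_sub_def PiE_iff)
  show "inj_on \<phi> (carrier A)" by (rule inj_on_inverseI[of _ \<psi>]) (rule \<psi>(2))
  assume r: "relar \<Sigma> r = Some n" and xs: "xs \<in> tuples (carrier A) n" and "map \<phi> xs \<in> reln B r"
  then have "map \<phi> xs \<in> reln (sub B C) r" using \<phi>C tuples_memD[OF xs] by auto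
  then have "map \<psi> (map \<phi> xs) \<in> reln A r" by (rule shom_rel[OF \<psi>(1) r])
  also have "map \<psi> (map \<phi> xs) = xs"
    unfolding map_map by (rule map_idI) (use \<psi>(2) tuples_memD[OF xs] in auto)
  finally show "xs \<in> reln A r" .
qed

lemma tembD:
  assumes "temb \<Sigma> \<phi> X Y"
  shows "semb \<Sigma> \<phi> X Y" and "continuous_map (topo X) (topo Y) \<phi>"
proof -
  obtain C \<psi> where C: "is_sub \<Sigma> C Y" and \<phi>: "\<phi> \<in> thom \<Sigma> X (tsub Y C)"
    and \<psi>: "\<psi> \<in> thom \<Sigma> (tsub Y C) X" "\<forall>x\<in>carrier X. \<psi> (\<phi> x) = x" "\<forall>y\<in>C. \<phi> (\<psi> y) = y"
    using assms by (auto simp: temb_def tiso_def)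
  have "siso \<Sigma> \<phi> X (sub Y C)"
    using \<phi> \<psi> by (auto simp: siso_def thom_def shom_def)
  then show "semb \<Sigma> \<phi> X Y" using C by (auto simp: semb_def)
  show "continuous_map (topo X) (topo Y) \<phi>"
    using \<phi> by (auto simp: thom_def continuous_map_in_subtopology)
qed

text \<open>The composite of \<open>omega\<close> with \<open>g\<close> is extended along \<phi>.
  The extension composed with \<phi> agrees with \<open>g\<close> at coordinate 0, hence at every
  coordinate.\<close>

lemma injective_A1: "injective_ISP TYPE('a) TYPE('b) sig1 M1"
  unfolding injective_ISP_def
proof (intro ballI allI impI)
  fix A :: "('a, op_sym, rel_sym) struct" and B :: "('b, op_sym, rel_sym) struct" and \<phi> g
  assume A: "A \<in> ISP sig1 M1" and B: "B \<in> ISP sig1 M1" and \<phi>g: "semb sig1 \<phi> A B \<and> g \<in> shom sig1 A M1"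
  note sA = ISP_is_structure[OF A] and \<phi> = sembD(1,2)[OF conjunct1[OF \<phi>g]]
  obtain f where f: "f \<in> shom lat_sig A lat2" "\<And>a. a \<in> carrier A \<Longrightarrow> g a 0 = f a"
    using shom_M1_omega'[OF sA] \<phi>g by blast
  obtain h where h: "h \<in> shom sig1 B M1" "\<forall>a\<in>carrier A. h (\<phi> a) 0 = f a"
    using extend_lattice_hom[OF B is_structure_lat_sig1[OF sA] shom_lat_sig1[OF \<phi>(1)] \<phi>(2) f(1)] by blast
  have "(\<lambda>a\<in>carrier A. h (\<phi> a)) a = g a" if "a \<in> carrier A" for a
    by (rule shom_M1_eq[OF sA shom_compose[OF sA \<phi>(1) h(1)]]) (use \<phi>g h f that in auto)
  then show "\<exists>h\<in>shom sig1 B M1. \<forall>a\<in>carrier A. h (\<phi> a) = g a" using h(1) by auto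
qed

lemma shom_M2_mono: "g \<in> shom sig2 A M2 \<Longrightarrow> [a, b] \<in> reln A Leq \<Longrightarrow> g a 0 \<Longrightarrow> g b 0"
  using shom_Leq[of g A M2 a b Leq] by (auto simp: le2_def)

lemma injective_A2: "injective_ISP TYPE('a) TYPE('b) sig2 M2"
  unfolding injective_ISP_def
proof (intro ballI allI impI)
  fix A :: "('a, op_sym, rel_sym) struct" and B :: "('b, op_sym, rel_sym) struct" and \<phi> g
  assume A: "A \<in> ISP sig2 M2" and B: "B \<in> ISP sig2 M2" and \<phi>g: "semb sig2 \<phi> A B \<and> g \<in> shom sig2 A M2"
  note sA = ISP_is_structure[OF A] and \<phi> = sembD[OF conjunct1[OF \<phi>g]]
  have g: "g \<in> shom sig2 A M2" using \<phi>g by simp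
  have "\<exists>h\<in>shom sig2 B M2. \<forall>a\<in>carrier A. h (\<phi> a) 0 = g a 0"
  proof (rule extend_monotone[OF B shom_carrier[OF \<phi>(1)]])
    fix a b assume "a \<in> carrier A" "b \<in> carrier A" "[\<phi> a, \<phi> b] \<in> reln B Leq" "g a 0"
    \<comment> \<open>The embedding reflects the order, so coordinate 0 of \<open>g\<close> is
      monotone for the order pulled back from \<open>B\<close>.\<close>
    then show "g b 0" using \<phi>(3)[of Leq 2 "[a, b]"] shom_M2_mono[OF g] by (simp add: tuples_2)
  qed
  then obtain h where h: "h \<in> shom sig2 B M2" "\<forall>a\<in>carrier A. h (\<phi> a) 0 = g a 0" by blast
  have "(\<lambda>a\<in>carrier A. h (\<phi> a)) a = g a" if "a \<in> carrier A" for a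
    by (rule shom_M2_eq[OF sA shom_compose[OF sA \<phi>(1) h(1)] g]) (use h that in auto)
  then show "\<exists>h\<in>shom sig2 B M2. \<forall>a\<in>carrier A. h (\<phi> a) = g a" using h(1) by auto
qed

lemma injective_X2: "injective_IScP TYPE('x) TYPE('y) sig2 M2_T"
  unfolding injective_IScP_def M2_T_def
proof (intro ballI allI impI)
  fix X :: "('x, op_sym, rel_sym) tstruct" and Y :: "('y, op_sym, rel_sym) tstruct" and \<phi> g
  assume X: "X \<in> IScP sig2 (with_topo cantor_topology M2)" and Y: "Y \<in> IScP sig2 (with_topo cantor_topology M2)"
    and \<phi>g: "temb sig2 \<phi> X Y \<and> g \<in> thom sig2 X (with_topo cantor_topology M2)"
  note sX = IScP_is_structure[OF X] and tX = IScP_topspace[OF X]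
  note temb = tembD[OF conjunct1[OF \<phi>g]]
  note \<phi> = sembD[OF temb(1)]
  have g: "g \<in> shom sig2 X M2" using \<phi>g by (simp add: thom_def)
  have "\<exists>h\<in>thom sig2 Y (with_topo cantor_topology M2). \<forall>x\<in>topspace (topo X). h (\<phi> x) 0 = g x 0"
  proof (rule extend_monotone_clopen[OF Y _ temb(2) thom_clopen[OF conjunct2[OF \<phi>g]]])
    show "compact_space (topo X)" using IScP_compact[OF X] compact_cantor by simp
    fix x y assume "x \<in> topspace (topo X)" "y \<in> topspace (topo X)" "[\<phi> x, \<phi> y] \<in> reln Y Leq" "g x 0"
    then show "g y 0" using \<phi>(3)[of Leq 2 "[x, y]"] shom_M2_mono[OF g] tX by (simp add: tuples_2)
  qed
  then obtain h where h: "h \<in> thom sig2 Y (with_topo cantor_topology M2)" "\<forall>x\<in>carrier X. h (\<phi> x) 0 = g x 0"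
    using tX by auto
  have "(\<lambda>x\<in>carrier X. h (\<phi> x)) x = g x" if "x \<in> carrier X" for x
    by (rule shom_M2_eq[OF sX shom_compose[OF sX \<phi>(1)] g]) (use h that in \<open>auto simp: thom_def\<close>)
  then show "\<exists>h\<in>thom sig2 Y (with_topo cantor_topology M2). \<forall>x\<in>carrier X. h (\<phi> x) = g x" using h(1) by auto
qed

lemma injective_X1: "injective_IScP TYPE('x) TYPE('y) sig1 M1_T"
  unfolding injective_IScP_def M1_T_def
proof (intro ballI allI impI)
  fix X :: "('x, op_sym, rel_sym) tstruct" and Y :: "('y, op_sym, rel_sym) tstruct" and \<phi> g
  assume X: "X \<in> IScP sig1 (with_topo cantor_topology M1)" and Y: "Y \<in> IScP sig1 (with_topo cantor_topology M1)"
    and \<phi>g: "temb sig1 \<phi> X Y \<and> g \<in> thom sig1 X (with_topo cantor_topology M1)"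
  note sX = IScP_is_structure[OF X] and tX = IScP_topspace[OF X]
  note temb = tembD[OF conjunct1[OF \<phi>g]]
  note \<phi> = sembD(1,2)[OF temb(1)]
  have g: "g \<in> shom sig1 X M1" using \<phi>g by (simp add: thom_def)
  obtain f where f: "f \<in> shom lat_sig X lat2" "\<And>x. x \<in> carrier X \<Longrightarrow> g x 0 = f x"
    using shom_M1_omega'[OF sX g] by blast
  \<comment> \<open>On the carrier, which is the whole space, \<open>f\<close> agrees with the
    continuous coordinate 0 of \<open>g\<close>.\<close>
  have "clopen_pred (topo X) f"
    using continuous_map_eq[OF thom_clopen[OF conjunct2[OF \<phi>g], of 0]] f(2) tX by simp
  moreover have "compact_space (topo X)" using IScP_compact[OF X] compact_cantor by simp
  ultimately obtain h where h: "h \<in> thom sig1 Y (with_topo cantor_topology M1)" "\<forall>x\<in>carrier X. h (\<phi> x) 0 = f x"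
    using extend_clopen_lattice_hom[OF Y is_structure_lat_sig1[OF sX] tX _ shom_lat_sig1[OF \<phi>(1)] \<phi>(2) temb(2) f(1)]
    by blast
  have "(\<lambda>x\<in>carrier X. h (\<phi> x)) x = g x" if "x \<in> carrier X" for x
    by (rule shom_M1_eq[OF sX shom_compose[OF sX \<phi>(1)] g]) (use h f that in \<open>auto simp: thom_def\<close>)
  then show "\<exists>h\<in>thom sig1 Y (with_topo cantor_topology M1). \<forall>x\<in>carrier X. h (\<phi> x) = g x" using h(1) by auto
qed

section \<open>Composition with \<open>\<omega>\<close>\<close>

text \<open>The map is continuous from a compact space, so its image is closed and its inverse
  continuous. Nonemptiness of \<open>A\<close> makes the index set of the power nonempty, as
  \<open>IScP\<close> demands. The image is a parameter \<open>C\<close>, to be identified with the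
  hom-set of the reduct in each case.\<close>

lemma iso_dualD_omega:
  fixes \<Sigma> :: "('f, 'r) signature"
  assumes PQ: "alter_ego \<Sigma> P \<Sigma>' (with_topo cantor_topology Q)" and A: "is_structure \<Sigma> A" "carrier A \<noteq> {}"
    and sub: "subsignature \<Sigma>0 \<Sigma>'" and N: "is_structure \<Sigma>0 N" "carrier N = UNIV"
    and \<omega>: "omega \<in> shom \<Sigma>0 Q N"
    and inj: "\<And>h k. h \<in> shom \<Sigma> A P \<Longrightarrow> k \<in> shom \<Sigma> A P \<Longrightarrow>
      (\<And>a. a \<in> carrier A \<Longrightarrow> omega (h a) = omega (k a)) \<Longrightarrow> h = k"
    and refl: "\<And>r n hs. relar \<Sigma>0 r = Some n \<Longrightarrow> hs \<in> tuples (shom \<Sigma> A P) n \<Longrightarrow>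
      (\<And>a. a \<in> carrier A \<Longrightarrow> map (\<lambda>h. omega (h a)) hs \<in> reln N r) \<Longrightarrow>
      (\<And>a. a \<in> carrier A \<Longrightarrow> map (\<lambda>h. h a) hs \<in> reln Q r)"
    and C: "omega_comp (carrier A) (shom \<Sigma> A P) ` shom \<Sigma> A P = C"
  shows "iso_IScP \<Sigma>0 (with_topo (discrete_topology UNIV) N) (omega_comp (carrier A) (shom \<Sigma> A P))
     (reduct \<Sigma>0 (dualD \<Sigma> P \<Sigma>' (with_topo cantor_topology Q) A))
     (tsub (tpow \<Sigma>0 (with_topo (discrete_topology UNIV) N) (carrier A)) C)"
proof -
  let ?D = "dualD \<Sigma> P \<Sigma>' (with_topo cantor_topology Q) A" and ?\<phi> = "omega_comp (carrier A) (shom \<Sigma> A P)"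
  let ?N = "with_topo (discrete_topology UNIV) N"
  let ?T = "product_topology (\<lambda>_. discrete_topology (UNIV :: bool set)) (carrier A)"
  have D: "is_sub \<Sigma>' (shom \<Sigma> A P) (pow \<Sigma>' Q (carrier A))" using is_sub_shom[OF PQ A(1)] by simp
  have *: "is_sub \<Sigma>0 C (pow \<Sigma>0 N (carrier A))"
    "siso \<Sigma>0 (omega_comp (carrier A) (shom \<Sigma> A P)) (sub (pow \<Sigma>' Q (carrier A)) (shom \<Sigma> A P)) (sub (pow \<Sigma>0 N (carrier A)) C)"
    unfolding C[symmetric] omega_comp_def
    by (rule siso_pointwise[OF sub D N(1) \<omega>]; (rule inj | rule refl); assumption)+
  have sC: "is_sub \<Sigma>0 C (pow \<Sigma>0 ?N (carrier A))" using *(1) by simp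
  have siso: "siso \<Sigma>0 ?\<phi> (reduct \<Sigma>0 ?D) (tsub (tpow \<Sigma>0 ?N (carrier A)) C)"
    using *(2) by (simp add: siso_def shom_def)
  have tD: "topspace (topo ?D) = shom \<Sigma> A P" by (rule topspace_dualD[OF PQ])
  have cont: "continuous_map (topo ?D) ?T ?\<phi>"
  proof -
    have "clopen_pred (topo ?D) (\<lambda>h. ?\<phi> h a)" if a: "a \<in> carrier A" for a
      by (rule continuous_map_eq[OF clopen_projection_dualD[OF a, of _ _ _ _ 0]])
        (use a tD in \<open>simp add: omega_comp_def omega_def\<close>)
    then show ?thesis
      unfolding continuous_map_componentwise tD by (auto simp: omega_comp_def)
  qed
  have comp: "compact_space (topo ?D)" by (rule compact_dualD[OF PQ A(1)])
  have "compactin ?T (?\<phi> ` shom \<Sigma> A P)"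
    using image_compactin[OF _ cont] comp tD by (simp add: compact_space_def)
  then have cl: "closedin ?T C"
    unfolding C by (rule compactin_imp_closedin[rotated]) (simp add: Hausdorff_space_product_topology)
  have tiso: "tiso \<Sigma>0 ?\<phi> (reduct \<Sigma>0 ?D) (tsub (tpow \<Sigma>0 ?N (carrier A)) C)"
  proof (rule tisoI_compact[OF siso])
    show "continuous_map (topo (reduct \<Sigma>0 ?D)) (topo (tsub (tpow \<Sigma>0 ?N (carrier A)) C)) ?\<phi>"
      using cont C tD by (auto simp: continuous_map_in_subtopology)
    show "topspace (topo (tsub (tpow \<Sigma>0 ?N (carrier A)) C)) = carrier (tsub (tpow \<Sigma>0 ?N (carrier A)) C)"
      using closedin_subset[OF cl] by auto
  qed (use comp tD in \<open>simp_all add: Hausdorff_space_subtopology Hausdorff_space_product_topology\<close>)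
  show ?thesis
  proof (rule iso_IScP_I[OF sC _ A(2) _ _ _ _ tiso])
    show "is_structure \<Sigma>0 (reduct \<Sigma>0 ?D)"
      using is_structure_subsignature[OF sub is_structure_dualD[OF PQ A(1)]] by simp
  qed (use cl tD in \<open>simp_all add: compact_space_discrete_topology\<close>)
qed

text \<open>Nonemptiness of the hom-set enters because members of \<open>ISP\<close> are
  nonempty.\<close>

lemma iso_dualE_omega:
  assumes D: "is_sub \<Sigma> (thom \<Sigma>' X Q) (pow \<Sigma> P (carrier X))" "thom \<Sigma>' X Q \<noteq> {}"
    and sub: "subsignature \<Sigma>0 \<Sigma>" and N: "is_structure \<Sigma>0 N"
    and \<omega>: "omega \<in> shom \<Sigma>0 P N"
    and inj: "\<And>h k. h \<in> thom \<Sigma>' X Q \<Longrightarrow> k \<in> thom \<Sigma>' X Q \<Longrightarrow>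
      (\<And>x. x \<in> carrier X \<Longrightarrow> omega (h x) = omega (k x)) \<Longrightarrow> h = k"
    and refl: "\<And>r n hs. relar \<Sigma>0 r = Some n \<Longrightarrow> hs \<in> tuples (thom \<Sigma>' X Q) n \<Longrightarrow>
      (\<And>x. x \<in> carrier X \<Longrightarrow> map (\<lambda>h. omega (h x)) hs \<in> reln N r) \<Longrightarrow>
      (\<And>x. x \<in> carrier X \<Longrightarrow> map (\<lambda>h. h x) hs \<in> reln P r)"
    and C: "omega_comp (carrier X) (thom \<Sigma>' X Q) ` thom \<Sigma>' X Q = C"
  shows "iso_ISP \<Sigma>0 N (omega_comp (carrier X) (thom \<Sigma>' X Q))
     (reduct \<Sigma>0 (dualE \<Sigma> P \<Sigma>' Q X)) (sub (pow \<Sigma>0 N (carrier X)) C)"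
proof -
  have *: "is_sub \<Sigma>0 C (pow \<Sigma>0 N (carrier X))"
    "siso \<Sigma>0 (omega_comp (carrier X) (thom \<Sigma>' X Q)) (sub (pow \<Sigma> P (carrier X)) (thom \<Sigma>' X Q)) (sub (pow \<Sigma>0 N (carrier X)) C)"
    unfolding C[symmetric] omega_comp_def
    by (rule siso_pointwise[OF sub D(1) N \<omega>]; (rule inj | rule refl); assumption)+
  show ?thesis
  proof (rule iso_ISP_I[OF *(1)])
    show "is_structure \<Sigma>0 (reduct \<Sigma>0 (dualE \<Sigma> P \<Sigma>' Q X))"
      using is_structure_subsignature[OF sub is_structure_sub_pow[OF D(1)]] by (simp add: dualE_def)
    show "siso \<Sigma>0 (omega_comp (carrier X) (thom \<Sigma>' X Q)) (reduct \<Sigma>0 (dualE \<Sigma> P \<Sigma>' Q X)) (sub (pow \<Sigma>0 N (carrier X)) C)"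
      using *(2) by (simp add: dualE_def)
  qed (use D in simp)
qed

lemma omega_comp_image:
  assumes sub: "\<And>h. h \<in> H \<Longrightarrow> (\<lambda>a\<in>A. omega (h a)) \<in> C"
    and ext: "\<And>f. f \<in> C \<Longrightarrow> f \<in> extensional A"
    and surj: "\<And>f. f \<in> C \<Longrightarrow> \<exists>h\<in>H. \<forall>a\<in>A. h a 0 = f a"
  shows "omega_comp A H ` H = C"
proof
  show "omega_comp A H ` H \<subseteq> C" using sub by (auto simp: omega_comp_def)
  show "C \<subseteq> omega_comp A H ` H"
  proof
    fix f assume f: "f \<in> C"
    then obtain h where h: "h \<in> H" "\<forall>a\<in>A. h a 0 = f a" using surj by blast
    have "f = omega_comp A H h"
      using h ext[OF f] by (auto simp: omega_comp_def omega_def fun_eq_iff extensional_def)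
    then show "f \<in> omega_comp A H ` H" using h(1) by blast
  qed
qed

lemma omega_inj_M1:
  "is_structure sig1 A \<Longrightarrow> h \<in> shom sig1 A M1 \<Longrightarrow> k \<in> shom sig1 A M1 \<Longrightarrow>
    (\<And>a. a \<in> carrier A \<Longrightarrow> omega (h a) = omega (k a)) \<Longrightarrow> h = k"
  using shom_eqI[of h sig1 A M1 k] shom_M1_eq[of A h k] by (simp add: omega_def)

lemma omega_inj_M2:
  "is_structure sig2 A \<Longrightarrow> h \<in> shom sig2 A M2 \<Longrightarrow> k \<in> shom sig2 A M2 \<Longrightarrow>
    (\<And>a. a \<in> carrier A \<Longrightarrow> omega (h a) = omega (k a)) \<Longrightarrow> h = k"
  using shom_eqI[of h sig2 A M2 k] shom_M2_eq[of A h k] by (simp add: omega_def)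

lemma omega_reflects_order:
  assumes A: "is_structure sig1 A" and r: "relar ord_sig r = Some n" and hs: "hs \<in> tuples (shom sig1 A M1) n"
    and le: "\<And>a. a \<in> carrier A \<Longrightarrow> map (\<lambda>h. omega (h a)) hs \<in> reln ord2 r" and a: "a \<in> carrier A"
  shows "map (\<lambda>h. h a) hs \<in> reln M2 r"
proof -
  obtain h k where hk: "hs = [h, k]" "h \<in> shom sig1 A M1" "k \<in> shom sig1 A M1"
    using r hs by (auto simp: tuples_2)
  have "h b 0 \<Longrightarrow> k b 0" if "b \<in> carrier A" for b using le[OF that] by (simp add: hk(1) omega_def)
  from shom_M1_le2[OF A hk(2,3) this a] show ?thesis by (simp add: hk(1))
qed

lemma iso_dualD_12:
  assumes A: "A \<in> ISP sig1 M1"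
  shows "iso_IScP ord_sig ord2_T (omega_comp (carrier A) (shom sig1 A M1))
    (reduct ord_sig (dualD sig1 M1 sig2 M2_T A)) (dualD lat_sig lat2 ord_sig ord2_T (reduct lat_sig A))"
proof -
  note sA = ISP_is_structure[OF A]
  have C: "omega_comp (carrier A) (shom sig1 A M1) ` shom sig1 A M1 = shom lat_sig A lat2"
  proof (rule omega_comp_image)
    show "(\<lambda>a\<in>carrier A. omega (h a)) \<in> shom lat_sig A lat2" if "h \<in> shom sig1 A M1" for h
      by (rule shom_compose[OF is_structure_lat_sig1[OF sA] shom_lat_sig1[OF that] omega_lat])
    fix f assume f: "f \<in> shom lat_sig A lat2"
    note id = shom_id[OF is_structure_lat_sig1[OF sA]]
    have "inj_on (\<lambda>x\<in>carrier A. x) (carrier A)" by (auto simp: inj_on_def)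
    from extend_lattice_hom[OF A is_structure_lat_sig1[OF sA] id this f]
    show "\<exists>h\<in>shom sig1 A M1. \<forall>a\<in>carrier A. h a 0 = f a" by auto
  qed (rule shom_extensional)
  have "iso_IScP ord_sig (with_topo (discrete_topology UNIV) ord2) (omega_comp (carrier A) (shom sig1 A M1))
    (reduct ord_sig (dualD sig1 M1 sig2 (with_topo cantor_topology M2) A))
    (tsub (tpow ord_sig (with_topo (discrete_topology UNIV) ord2) (carrier A)) (shom lat_sig A lat2))"
    by (rule iso_dualD_omega[OF alter_ego_12 sA ISP_nonempty[OF A] subsignature_ord is_structure_ord2 _
          omega_ord omega_inj_M1[OF sA] omega_reflects_order[OF sA] C]) auto
  then show ?thesis by (simp add: M2_T_def ord2_T_def dualD_def[of lat_sig])
qed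

lemma iso_dualD_21:
  assumes A: "A \<in> ISP sig2 M2"
  shows "iso_IScP lat_sig lat2_T (omega_comp (carrier A) (shom sig2 A M2))
    (reduct lat_sig (dualD sig2 M2 sig1 M1_T A)) (dualD ord_sig ord2 lat_sig lat2_T (reduct ord_sig A))"
proof -
  note sA = ISP_is_structure[OF A]
  note sA0 = is_structure_subsignature[OF subsignature_ord sA]
  have C: "omega_comp (carrier A) (shom sig2 A M2) ` shom sig2 A M2 = shom ord_sig A ord2"
  proof (rule omega_comp_image)
    show "(\<lambda>a\<in>carrier A. omega (h a)) \<in> shom ord_sig A ord2" if "h \<in> shom sig2 A M2" for h
      using shom_compose[OF sA0 _ omega_ord] that shom_subsignature[OF subsignature_ord] by blast
    fix f assume f: "f \<in> shom ord_sig A ord2"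
    show "\<exists>h\<in>shom sig2 A M2. \<forall>a\<in>carrier A. h a 0 = f a"
    proof (rule extend_monotone[OF A, of _ "\<lambda>a. a"])
      show "f b" if "[a, b] \<in> reln A Leq" "f a" for a b
        using shom_rel[OF f _ that(1), of 2] that(2) by simp
    qed
  qed (rule shom_extensional)
  \<comment> \<open>The lattice signature has no relation symbols, so reflection holds
    vacuously.\<close>
  have "iso_IScP lat_sig (with_topo (discrete_topology UNIV) lat2) (omega_comp (carrier A) (shom sig2 A M2))
    (reduct lat_sig (dualD sig2 M2 sig1 (with_topo cantor_topology M1) A))
    (tsub (tpow lat_sig (with_topo (discrete_topology UNIV) lat2) (carrier A)) (shom ord_sig A ord2))"
    by (rule iso_dualD_omega[OF alter_ego_21 sA ISP_nonempty[OF A] subsignature_lat is_structure_lat2 _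
          omega_lat omega_inj_M2[OF sA] _ C]) auto
  then show ?thesis by (simp add: M1_T_def lat2_T_def dualD_def[of ord_sig])
qed

lemma continuous_omega_restrict:
  assumes "h \<in> thom \<Sigma> X (with_topo cantor_topology M)" "topspace (topo X) = carrier X"
  shows "clopen_pred (topo X) (\<lambda>x\<in>carrier X. omega (h x))"
  by (rule continuous_map_eq[OF thom_clopen[OF assms(1), of 0]]) (simp add: assms(2) omega_def)

lemma iso_dualE_12:
  assumes X: "X \<in> IScP sig2 M2_T"
  shows "iso_ISP lat_sig lat2 (omega_comp (carrier X) (thom sig2 X M2_T))
    (reduct lat_sig (dualE sig1 M1 sig2 M2_T X)) (dualE lat_sig lat2 ord_sig ord2_T (reduct ord_sig X))"
proof -
  let ?Q = "with_topo cantor_topology M2"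
  have X': "X \<in> IScP sig2 ?Q" using X by (simp add: M2_T_def)
  note sX = IScP_is_structure[OF X'] and tX = IScP_topspace[OF X']
  note sX0 = is_structure_subsignature[OF subsignature_ord sX]
  have C: "omega_comp (carrier X) (thom sig2 X ?Q) ` thom sig2 X ?Q = thom ord_sig X ord2_T"
  proof (rule omega_comp_image)
    show "(\<lambda>x\<in>carrier X. omega (h x)) \<in> thom ord_sig X ord2_T" if h: "h \<in> thom sig2 X ?Q" for h
    proof -
      have "h \<in> shom ord_sig X M2"
        using h shom_subsignature[OF subsignature_ord, of X M2] by (auto simp: thom_def)
      from shom_compose[OF sX0 this omega_ord] continuous_omega_restrict[OF h tX]
      show ?thesis by (simp add: thom_def ord2_T_def)
    qed
    fix f assume f: "f \<in> thom ord_sig X ord2_T"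
    have "\<exists>h\<in>thom sig2 X ?Q. \<forall>x\<in>topspace (topo X). h x 0 = f x"
    \<comment> \<open>With the identity for \<phi>, the pulled back order is that of
      \<open>X\<close>.\<close>
    proof (rule extend_monotone_clopen[OF X' _ continuous_map_id[unfolded id_def]])
      show "compact_space (topo X)" using IScP_compact[OF X'] compact_cantor by simp
      show "clopen_pred (topo X) f" using f by (simp add: thom_def ord2_T_def)
      have "f \<in> shom ord_sig X ord2" using f by (simp add: thom_def ord2_T_def)
      then show "f y" if "[x, y] \<in> reln X Leq" "f x" for x y
        using shom_rel[of f ord_sig X ord2 Leq 2 "[x, y]"] that by simp
    qed
    then show "\<exists>h\<in>thom sig2 X ?Q. \<forall>x\<in>carrier X. h x 0 = f x" unfolding tX .
  qed (auto simp: thom_def dest: shom_extensional)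
  note S = is_sub_thom[OF alter_ego_12 alter_ego_21 sX tX]
  have "iso_ISP lat_sig lat2 (omega_comp (carrier X) (thom sig2 X ?Q))
    (reduct lat_sig (dualE sig1 M1 sig2 ?Q X)) (sub (pow lat_sig lat2 (carrier X)) (thom ord_sig X ord2_T))"
    by (rule iso_dualE_omega[OF S IScP_thom_nonempty[OF X'] subsignature_lat is_structure_lat2 omega_lat _ _ C])
      (auto simp: thom_def intro: omega_inj_M2[OF sX])
  then show ?thesis by (simp add: M2_T_def dualE_def[of lat_sig])
qed

lemma iso_dualE_21:
  assumes X: "X \<in> IScP sig1 M1_T"
  shows "iso_ISP ord_sig ord2 (omega_comp (carrier X) (thom sig1 X M1_T))
    (reduct ord_sig (dualE sig2 M2 sig1 M1_T X)) (dualE ord_sig ord2 lat_sig lat2_T (reduct lat_sig X))"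
proof -
  let ?Q = "with_topo cantor_topology M1"
  have X': "X \<in> IScP sig1 ?Q" using X by (simp add: M1_T_def)
  note sX = IScP_is_structure[OF X'] and tX = IScP_topspace[OF X']
  note sX0 = is_structure_lat_sig1[OF sX]
  have C: "omega_comp (carrier X) (thom sig1 X ?Q) ` thom sig1 X ?Q = thom lat_sig X lat2_T"
  proof (rule omega_comp_image)
    show "(\<lambda>x\<in>carrier X. omega (h x)) \<in> thom lat_sig X lat2_T" if h: "h \<in> thom sig1 X ?Q" for h
    proof -
      have "h \<in> shom lat_sig X M1" using h shom_lat_sig1 by (auto simp: thom_def)
      from shom_compose[OF sX0 this omega_lat] continuous_omega_restrict[OF h tX]
      show ?thesis by (simp add: thom_def lat2_T_def)
    qed
    fix f assume f: "f \<in> thom lat_sig X lat2_T"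
    have "\<exists>h\<in>thom sig1 X ?Q. \<forall>x\<in>carrier X. h ((\<lambda>x\<in>carrier X. x) x) 0 = f x"
    proof (rule extend_clopen_lattice_hom[OF X' sX0 tX _ shom_id[OF sX0]])
      show "compact_space (topo X)" using IScP_compact[OF X'] compact_cantor by simp
      show "continuous_map (topo X) (topo X) (\<lambda>x\<in>carrier X. x)"
        by (rule continuous_map_eq[OF continuous_map_id]) (simp add: tX)
    qed (use f in \<open>auto simp: thom_def lat2_T_def inj_on_def\<close>)
    then show "\<exists>h\<in>thom sig1 X ?Q. \<forall>x\<in>carrier X. h x 0 = f x" by simp
  qed (auto simp: thom_def dest: shom_extensional)
  note S = is_sub_thom[OF alter_ego_21 alter_ego_12 sX tX]
  have "iso_ISP ord_sig ord2 (omega_comp (carrier X) (thom sig1 X ?Q))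
    (reduct ord_sig (dualE sig2 M2 sig1 ?Q X)) (sub (pow ord_sig ord2 (carrier X)) (thom lat_sig X lat2_T))"
  proof (rule iso_dualE_omega[OF S IScP_thom_nonempty[OF X'] subsignature_ord is_structure_ord2 omega_ord _ _ C])
    show "h = k" if "h \<in> thom sig1 X ?Q" "k \<in> thom sig1 X ?Q"
      "\<And>x. x \<in> carrier X \<Longrightarrow> omega (h x) = omega (k x)" for h k
      using omega_inj_M1[OF sX] that by (auto simp: thom_def)
    fix r n hs x assume "relar ord_sig r = Some n" "hs \<in> tuples (thom sig1 X ?Q) n"
      and "\<And>x. x \<in> carrier X \<Longrightarrow> map (\<lambda>h. omega (h x)) hs \<in> reln ord2 r" "x \<in> carrier X"
    then show "map (\<lambda>h. h x) hs \<in> reln M2 r"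
      by (intro omega_reflects_order[OF sX]) (auto simp: tuples_def thom_def)
  qed
  then show ?thesis by (simp add: M1_T_def dualE_def[of ord_sig])
qed

theorem theorem4p6:
  shows
    "fully_dualises TYPE('a) TYPE('x) sig2 M2_T sig1 M1 \<and>
     injective_ISP TYPE('a) TYPE('b) sig1 M1 \<and>
     injective_IScP TYPE('x) TYPE('y) sig2 M2_T \<and>
     fully_dualises TYPE('a) TYPE('x) sig1 M1_T sig2 M2 \<and>
     injective_ISP TYPE('a) TYPE('b) sig2 M2 \<and>
     injective_IScP TYPE('x) TYPE('y) sig1 M1_T \<and>
     (\<forall>A \<in> (ISP sig1 M1 :: ('a, op_sym, rel_sym) struct set).
       iso_IScP ord_sig ord2_T (omega_comp (carrier A) (shom sig1 A M1))
         (reduct ord_sig (dualD sig1 M1 sig2 M2_T A))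
         (dualD lat_sig lat2 ord_sig ord2_T (reduct lat_sig A))) \<and>
     (\<forall>X \<in> (IScP sig2 M2_T :: ('x, op_sym, rel_sym) tstruct set).
       iso_ISP lat_sig lat2 (omega_comp (carrier X) (thom sig2 X M2_T))
         (reduct lat_sig (dualE sig1 M1 sig2 M2_T X))
         (dualE lat_sig lat2 ord_sig ord2_T (reduct ord_sig X))) \<and>
     (\<forall>A \<in> (ISP sig2 M2 :: ('a, op_sym, rel_sym) struct set).
       iso_IScP lat_sig lat2_T (omega_comp (carrier A) (shom sig2 A M2))
         (reduct lat_sig (dualD sig2 M2 sig1 M1_T A))
         (dualD ord_sig ord2 lat_sig lat2_T (reduct ord_sig A))) \<and>
     (\<forall>X \<in> (IScP sig1 M1_T :: ('x, op_sym, rel_sym) tstruct set).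
       iso_ISP ord_sig ord2 (omega_comp (carrier X) (thom sig1 X M1_T))
         (reduct ord_sig (dualE sig2 M2 sig1 M1_T X))
         (dualE ord_sig ord2 lat_sig lat2_T (reduct lat_sig X))) \<and>
     strongly_dualises TYPE('a) TYPE('x) TYPE('y) sig2 M2_T sig1 M1 \<and>
     strongly_dualises TYPE('a) TYPE('x) TYPE('y) sig1 M1_T sig2 M2"
  unfolding strongly_dualises_def
  by (intro conjI ballI fully_dualises_12 fully_dualises_21 injective_A1 injective_A2 injective_X1
      injective_X2 iso_dualD_12 iso_dualD_21 iso_dualE_12 iso_dualE_21)

end
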